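(* Let $a_n'$ be the $n$-th zero of the function $\operatorname{Ai}'$ and let $b\in\mathbb{R}$. Then, as $n\to\infty$, $$\lambda_n(b) = -a_n' - \frac{b}{a_n'} + \mathcal{O}(n^{-4/3}) \quad\text{and}\quad \kappa_n(b) = -\log(-a_n') + \frac{b^2}{a_n'} + \mathcal{O}(n^{-4/3}),$$ where the error terms are uniform for $b$ in bounded subsets of $\mathbb{R}$.
   Context: $\operatorname{Ai}$ is the Airy function of the first kind; the zeros of $\operatorname{Ai}'$ are ordered so that $a_{n+1}'<a_n'<0$ for $n\in\mathbb{N}$ (the prime in $a_n'$ is part of the notation). For $b\in\mathbb{R}$, $H_b$ is the self-adjoint operator in $L^2(\mathbb{R}_+)$ acting as $H_b\varphi=-\varphi''+x\varphi$ on the domain of all $\varphi\in L^2(\mathbb{R}_+)$ with $\varphi,\varphi'\in \mathrm{AC}_{loc}([0,\infty))$, $-\varphi''+x\varphi\in L^2(\mathbb{R}_+)$ and $\varphi'(0)-b\varphi(0)=0$. Its spectrum is simple and discrete, consisting of eigenvalues $\lambda_1(b)<\lambda_2(b)<\cdots$, which are the real solutions $\lambda$ of $\operatorname{Ai}'(-\lambda)-b\operatorname{Ai}(-\lambda)=0$. The (logarithmic) norming constants $\kappa_n(b)$ are defined by $$e^{\kappa_n(b)} = \frac{|\psi_0(\lambda_n(b),0)|^2}{\|\psi_0(\lambda_n(b),\cdot)\|_{L^2(\mathbb{R}_+)}^2},\qquad \psi_0(z,x)=\sqrt{\pi}\operatorname{Ai}(x-z).$$ *)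

theory Defs
  imports "HOL-Analysis.Analysis"
begin

text \<open>
  The Airy function of the first kind, given by its everywhere convergent Maclaurin series.
  The two coefficients are \<open>Ai(0) = 3\<^sup>-\<^sup>2\<^sup>/\<^sup>3 / \<Gamma>(2/3)\<close> and
  \<open>Ai'(0) = - 3\<^sup>-\<^sup>1\<^sup>/\<^sup>3 / \<Gamma>(1/3)\<close>; note that
  \<open>3\<^sup>k (1/3)\<^sub>k = 1 \<cdot> 4 \<cdot> \<dots> \<cdot> (3k-2)\<close> and \<open>3\<^sup>k (2/3)\<^sub>k = 2 \<cdot> 5 \<cdot> \<dots> \<cdot> (3k-1)\<close>.
  The definition is used both on the reals and on the complex numbers.
\<close>

definition Ai :: "'a::{real_normed_field,banach} \<Rightarrow> 'a" where
  "Ai z =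
     of_real (3 powr (-2/3) / Gamma (2/3)) *
       (\<Sum>k. of_real (3 ^ k * pochhammer (1/3) k / fact (3 * k)) * z ^ (3 * k))
   - of_real (3 powr (-1/3) / Gamma (1/3)) *
       (\<Sum>k. of_real (3 ^ k * pochhammer (2/3) k / fact (3 * k + 1)) * z ^ (3 * k + 1))"

text \<open>The zeros of \<open>Ai'\<close> in decreasing order, counted from \<open>n = 1\<close>.\<close>

definition airy_deriv_zero :: "nat \<Rightarrow> real" where
  "airy_deriv_zero n =
     (THE a. deriv Ai a = 0 \<and> finite {y. a < y \<and> deriv Ai y = 0} \<and>
             card {y. a < y \<and> deriv Ai y = 0} + 1 = n)"

text \<open>
  Elements of \<open>L\<^sup>2(\<real>\<^sub>+)\<close> are represented by functions on the real line; their values on the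
  negative half-line are irrelevant.
\<close>

definition L2_halfline :: "(real \<Rightarrow> complex) set" where
  "L2_halfline = {f. f \<in> borel_measurable (lebesgue_on {0..}) \<and>
                     integrable (lebesgue_on {0..}) (\<lambda>x. (cmod (f x))\<^sup>2)}"

definition L2_norm_halfline :: "(real \<Rightarrow> complex) \<Rightarrow> real" where
  "L2_norm_halfline f = sqrt (LINT x|lebesgue_on {0..}. (cmod (f x))\<^sup>2)"

text \<open>
  Absolute continuity on \<open>[a, b]\<close>; a finite family of pairwise disjoint intervals
  \<open>(s, t)\<close> is represented by the finite set of its pairs of endpoints.
\<close>

definition abs_cont_on :: "real \<Rightarrow> real \<Rightarrow> (real \<Rightarrow> complex) \<Rightarrow> bool" where
  "abs_cont_on a b f \<longleftrightarrow>
     (\<forall>\<epsilon>>0. \<exists>\<delta>>0. \<forall>D :: (real \<times> real) set.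
        finite D \<and> (\<forall>(s, t)\<in>D. a \<le> s \<and> s < t \<and> t \<le> b) \<and>
        pairwise (\<lambda>I J. disjnt {fst I<..<snd I} {fst J<..<snd J}) D \<and>
        (\<Sum>(s, t)\<in>D. t - s) < \<delta>
        \<longrightarrow> (\<Sum>(s, t)\<in>D. cmod (f t - f s)) < \<epsilon>)"

definition AC_loc :: "(real \<Rightarrow> complex) set" where
  "AC_loc = {f. \<forall>R>0. abs_cont_on 0 R f}"

text \<open>
  The pointwise derivative on \<open>[0, \<infinity>)\<close>, one-sided at \<open>0\<close>; it is unspecified at points
  where the function is not differentiable.
\<close>

definition hderiv :: "(real \<Rightarrow> complex) \<Rightarrow> real \<Rightarrow> complex" where
  "hderiv f x = vector_derivative f (at x within {0..})"

definition stark_op :: "(real \<Rightarrow> complex) \<Rightarrow> real \<Rightarrow> complex" where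
  "stark_op \<phi> x = - hderiv (hderiv \<phi>) x + of_real x * \<phi> x"

definition stark_domain :: "real \<Rightarrow> (real \<Rightarrow> complex) set" where
  "stark_domain b = {\<phi>. \<phi> \<in> L2_halfline \<and> \<phi> \<in> AC_loc \<and> hderiv \<phi> \<in> AC_loc \<and>
                        stark_op \<phi> \<in> L2_halfline \<and> hderiv \<phi> 0 - of_real b * \<phi> 0 = 0}"

text \<open>Eigenvalues of \<open>H\<^sub>b\<close>, the operator \<open>stark_op\<close> on \<open>stark_domain b\<close>.\<close>

definition stark_eigenvalue :: "real \<Rightarrow> complex \<Rightarrow> bool" where
  "stark_eigenvalue b z \<longleftrightarrow>
     (\<exists>\<phi>\<in>stark_domain b. \<not> (AE x in lebesgue_on {0..}. \<phi> x = 0) \<and>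
        (AE x in lebesgue_on {0..}. stark_op \<phi> x = z * \<phi> x))"

text \<open>
  The eigenvalues in increasing order, counted from \<open>n = 1\<close>; they are all real
  because \<open>H\<^sub>b\<close> is self-adjoint, and simple.
\<close>

definition lam :: "nat \<Rightarrow> real \<Rightarrow> real" where
  "lam n b =
     (THE l. stark_eigenvalue b (of_real l) \<and>
             finite {y. y < l \<and> stark_eigenvalue b (of_real y)} \<and>
             card {y. y < l \<and> stark_eigenvalue b (of_real y)} + 1 = n)"

definition psi0 :: "complex \<Rightarrow> real \<Rightarrow> complex" where
  "psi0 z x = of_real (sqrt pi) * Ai (of_real x - z)"

definition kappa :: "nat \<Rightarrow> real \<Rightarrow> real" where
  "kappa n b = ln ((cmod (psi0 (of_real (lam n b)) 0))\<^sup>2 /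
                   (L2_norm_halfline (psi0 (of_real (lam n b))))\<^sup>2)"

end

theory Submission
  imports Defs
begin

text \<open>
  A real number \<open>l\<close> is an eigenvalue of \<open>H\<^sub>b\<close> exactly if \<open>Ai'(-l) = b Ai(-l)\<close>: square
  integrability singles out the multiples of \<open>Ai(x - l)\<close> among the solutions of
  \<open>-\<phi>'' + x \<phi> = l \<phi>\<close>, and the boundary condition at \<open>0\<close> is then this equation
  (\<open>stark_eigenvalue_iff\<close>).  In the \<open>(Ai, Ai')\<close> plane let \<open>\<theta>(l)\<close> be the
  polar angle of the point \<open>(Ai(-l), Ai'(-l))\<close>.  Its derivative is the positive quantity
  \<open>(\<integral> Ai\<^sup>2 over [-l, \<infinity>)) / (Ai(-l)\<^sup>2 + Ai'(-l)\<^sup>2)\<close>, and \<open>\<theta>\<close> increases from \<open>-\<pi>/2\<close> to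
  \<open>\<infinity>\<close>.  Hence \<open>\<lambda>\<^sub>n(b)\<close> is the point where \<open>\<theta> = arctan b + (n - 1) \<pi>\<close>, and
  \<open>-a\<^sub>n'\<close> is the same point for \<open>b = 0\<close> (\<open>robin_equation_iff\<close>,
  \<open>lam_eq_robin_root\<close>, \<open>airy_deriv_zero_eq\<close>); the two enumerations agree without any
  asymptotic knowledge of \<open>Ai\<close>.

  Between these two points the quotient \<open>m(l) = Ai'(-l) / Ai(-l) = tan \<theta>(l)\<close> runs from \<open>0\<close> to
  \<open>b\<close> and solves the Riccati equation \<open>m' = l + m\<^sup>2\<close>.  The mean value theorem gives
  \<open>b = (\<lambda>\<^sub>n(b) + a\<^sub>n') (\<xi> + m(\<xi>)\<^sup>2)\<close> with \<open>\<xi>\<close> between the two points, so that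
  \<open>\<lambda>\<^sub>n(b) = -a\<^sub>n' - b / a\<^sub>n' + O(a\<^sub>n'\<^sup>-\<^sup>2)\<close> uniformly for bounded \<open>b\<close>
  (\<open>robin_root_mean_value\<close>, \<open>robin_root_expansion\<close>).  The primitive
  \<open>Ai'\<^sup>2 - y Ai\<^sup>2\<close> of \<open>-Ai\<^sup>2\<close> evaluates the norm of \<open>\<psi>\<^sub>0\<close> and yields
  \<open>\<kappa>\<^sub>n(b) = - ln (\<lambda>\<^sub>n(b) + b\<^sup>2)\<close> (\<open>kappa_eq\<close>), from which the second expansion follows.
  A Sturm comparison shows that consecutive zeros of \<open>Ai'\<close> are at least
  \<open>\<pi> / sqrt (-a\<^sub>n\<^sub>+\<^sub>1')\<close> apart; this gives \<open>-a\<^sub>n' \<ge> (n - 1)\<^sup>2\<^sup>/\<^sup>3\<close> and turns the errors into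
  \<open>O(n\<^sup>-\<^sup>4\<^sup>/\<^sup>3)\<close> (\<open>robin_root_0_spacing\<close>, \<open>robin_root_0_lower\<close>).

  Besides the differential equation and the signs of \<open>Ai(0)\<close> and \<open>Ai'(0)\<close>, the only information
  about \<open>Ai\<close> that enters is that it is bounded on the positive half-line
  (\<open>Ai_bounded_halfline\<close>); convexity does the rest.  On the operator side, the
  definition of the domain speaks of absolutely continuous functions and of derivatives that
  may fail to exist on a null set, so that Lebesgue's differentiation theorem for absolutely
  continuous functions is needed to see that eigenfunctions are classical solutions
  (\<open>AC_loc_has_derivative\<close>).
\<close>

section \<open>Families of intervals\<close>

definition nonoverlapping :: "real \<Rightarrow> real \<Rightarrow> (real \<times> real) set \<Rightarrow> bool" where
  "nonoverlapping a b D \<longleftrightarrow>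
     finite D \<and> (\<forall>I\<in>D. a \<le> fst I \<and> fst I < snd I \<and> snd I \<le> b) \<and>
     pairwise (\<lambda>I J. disjnt {fst I<..<snd I} {fst J<..<snd J}) D"

text \<open>
  Total increment of \<open>f\<close>; for the identity it is the total length of the family.
\<close>

definition incr :: "(real \<Rightarrow> 'v::real_normed_vector) \<Rightarrow> (real \<times> real) set \<Rightarrow> 'v" where
  "incr f D = (\<Sum>I\<in>D. f (snd I) - f (fst I))"

definition ac_on :: "real \<Rightarrow> real \<Rightarrow> (real \<Rightarrow> 'v::real_normed_vector) \<Rightarrow> bool" where
  "ac_on a b f \<longleftrightarrow>
     (\<forall>\<epsilon>>0. \<exists>\<delta>>0. \<forall>D. nonoverlapping a b D \<and> incr (\<lambda>x. x) D < \<delta> \<longrightarrow>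
        (\<Sum>I\<in>D. norm (f (snd I) - f (fst I))) < \<epsilon>)"

lemma nonoverlapping_subset: "nonoverlapping a b D \<Longrightarrow> D' \<subseteq> D \<Longrightarrow> nonoverlapping a b D'"
  unfolding nonoverlapping_def by (meson finite_subset pairwise_subset subset_iff)

lemma disjnt_open_intervals:
  fixes s t s' t' :: real
  assumes "s < t" "s' < t'" "disjnt {s<..<t} {s'<..<t'}"
  shows "t \<le> s' \<or> t' \<le> s"
proof (rule ccontr)
  assume "\<not> ?thesis"
  then have "max s s' < min t t'" using assms by auto
  then obtain z where "max s s' < z" "z < min t t'" using dense by blast
  then have "z \<in> {s<..<t} \<inter> {s'<..<t'}" by auto
  with assms(3) show False unfolding disjnt_def by blast
qed

text \<open>
  Increments telescope. The induction removes the interval with the largest left end point \<open>s\<close>: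
  all others end at or before \<open>s\<close>, and the only new gap lies between its right end point and \<open>b\<close>.
\<close>

lemma gaps_exist:
  fixes f :: "real \<Rightarrow> 'v::real_normed_vector"
  assumes "nonoverlapping a b D" "a \<le> b"
  shows "\<exists>G. nonoverlapping a b G \<and> (\<forall>I\<in>D. \<forall>J\<in>G. disjnt {fst I<..<snd I} {fst J<..<snd J}) \<and>
           incr (\<lambda>x. x) D + incr (\<lambda>x. x) G = b - a \<and> incr f D + incr f G = f b - f a"
  using assms
proof (induction "card D" arbitrary: D b)
  case 0
  then have D: "D = {}" by (simp add: nonoverlapping_def)
  show ?case
  proof (cases "a < b")
    case True
    then show ?thesis
      by (intro exI[of _ "{(a,b)}"]) (auto simp: D nonoverlapping_def incr_def)
  next
    case False
    then show ?thesis
      using 0 by (intro exI[of _ "{}"]) (auto simp: D nonoverlapping_def incr_def)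
  qed
next
  case (Suc n)
  have fin: "finite D" using Suc.prems by (simp add: nonoverlapping_def)
  have ne: "D \<noteq> {}" using Suc.hyps(2) by auto
  define s where "s = Max (fst ` D)"
  have "s \<in> fst ` D" unfolding s_def using fin ne by (intro Max_in) auto
  then obtain t where st: "(s, t) \<in> D" by auto
  have smax: "fst I \<le> s" if "I \<in> D" for I unfolding s_def using fin that by simp
  have bd: "a \<le> s" "s < t" "t \<le> b" using Suc.prems st unfolding nonoverlapping_def by auto
  define D' where "D' = D - {(s,t)}"
  have left: "snd I \<le> s" if "I \<in> D'" for I
  proof -
    have "disjnt {fst I<..<snd I} {s<..<t}"
    proof -
      have "pairwise (\<lambda>I J. disjnt {fst I<..<snd I} {fst J<..<snd J}) D"
        using Suc.prems by (simp add: nonoverlapping_def)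
      moreover have "I \<in> D" "I \<noteq> (s,t)" using that by (auto simp: D'_def)
      ultimately show ?thesis using st unfolding pairwise_def by (metis fst_conv snd_conv)
    qed
    moreover have "fst I < snd I" using that Suc.prems by (auto simp: D'_def nonoverlapping_def)
    ultimately have "snd I \<le> s \<or> t \<le> fst I" using disjnt_open_intervals bd by blast
    then show ?thesis using smax[of I] that bd by (auto simp: D'_def)
  qed
  have "nonoverlapping a b D'" using Suc.prems nonoverlapping_subset D'_def by blast
  then have no: "nonoverlapping a s D'" using left unfolding nonoverlapping_def by auto
  have "card D' = n" using Suc.hyps(2) st fin by (simp add: D'_def)
  from Suc.hyps(1)[OF this[symmetric] no bd(1)] obtain G where
    G: "nonoverlapping a s G" "\<And>I J. I\<in>D' \<Longrightarrow> J\<in>G \<Longrightarrow> disjnt {fst I<..<snd I} {fst J<..<snd J}"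
       "incr (\<lambda>x. x) D' + incr (\<lambda>x. x) G = s - a" "incr f D' + incr f G = f s - f a"
    by blast
  have D: "D = insert (s,t) D'" "(s,t) \<notin> D'" "finite D'" using st fin by (auto simp: D'_def)
  have Gs: "a \<le> fst J \<and> fst J < snd J \<and> snd J \<le> s" if "J \<in> G" for J
    using G(1) that by (auto simp: nonoverlapping_def)
  have finG: "finite G" using G(1) by (simp add: nonoverlapping_def)
  have incrD: "incr h D = (h t - h s) + incr h D'" for h :: "real \<Rightarrow> 'w::real_normed_vector"
    unfolding incr_def D(1) using D by (subst sum.insert) auto
  show ?case
  proof (cases "t < b")
    case True
    have notin: "(t,b) \<notin> G" using Gs[of "(t,b)"] bd by auto
    have incrG: "incr h (insert (t,b) G) =
      (h b - h t) + incr h G" for h :: "real \<Rightarrow> 'w::real_normed_vector"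
      unfolding incr_def using finG notin by (subst sum.insert) auto
    have dj: "disjnt {t<..<b} {fst J<..<snd J}" "disjnt {fst J<..<snd J} {t<..<b}" if "J \<in> G" for J
      using Gs[OF that] bd by (auto simp: disjnt_def)
    have "nonoverlapping a b (insert (t,b) G)"
      unfolding nonoverlapping_def
    proof (intro conjI)
      show "finite (insert (t, b) G)" using finG by simp
      show "\<forall>I\<in>insert (t, b) G. a \<le> fst I \<and> fst I < snd I \<and> snd I \<le> b"
        using Gs bd True by force
      show "pairwise (\<lambda>I J. disjnt {fst I<..<snd I} {fst J<..<snd J}) (insert (t, b) G)"
        using G(1) dj unfolding nonoverlapping_def pairwise_insert by auto
    qed
    moreover have "\<forall>I\<in>D. \<forall>J\<in>insert (t,b) G. disjnt {fst I<..<snd I} {fst J<..<snd J}"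
    proof (intro ballI)
      fix I J assume I: "I \<in> D" and J: "J \<in> insert (t,b) G"
      have sndI: "snd I \<le> t" using I left[of I] bd by (auto simp: D)
      consider "I = (s,t)" "J \<in> G" | "J = (t,b)" | "I \<in> D'" "J \<in> G" using I J D by blast
      then show "disjnt {fst I<..<snd I} {fst J<..<snd J}"
      proof cases
        case 1 then show ?thesis using Gs[of J] by (auto simp: disjnt_def)
      next
        case 2 then show ?thesis using sndI by (auto simp: disjnt_def)
      next
        case 3 then show ?thesis using G(2) by blast
      qed
    qed
    ultimately show ?thesis
      using G(3,4) by (intro exI[of _ "insert (t,b) G"]) (simp add: incrD incrG algebra_simps)
  next
    case False
    then have tb: "t = b" using bd by simp
    have "nonoverlapping a b G" using G(1) bd unfolding nonoverlapping_def by force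
    moreover have "\<forall>I\<in>D. \<forall>J\<in>G. disjnt {fst I<..<snd I} {fst J<..<snd J}"
    proof (intro ballI)
      fix I J assume I: "I \<in> D" and J: "J \<in> G"
      consider "I = (s,t)" | "I \<in> D'" using I D by blast
      then show "disjnt {fst I<..<snd I} {fst J<..<snd J}"
      proof cases
        case 1 then show ?thesis using Gs[OF J] by (auto simp: disjnt_def)
      next
        case 2 then show ?thesis using G(2) J by blast
      qed
    qed
    ultimately show ?thesis
      using G(3,4) by (intro exI[of _ G]) (simp add: incrD tb algebra_simps)
  qed
qed

text \<open>
  The part of \<open>V\<close> that \<open>W\<close> leaves uncovered is again a finite family of intervals: it consists of
  the gaps left in \<open>[a, b]\<close> by \<open>W\<close> and the gaps of \<open>V\<close> taken together.
\<close>

lemma residual_family: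
  fixes f :: "real \<Rightarrow> 'v::real_normed_vector"
  assumes V: "nonoverlapping a b V" and W: "nonoverlapping a b W" and "a \<le> b"
    and sub: "\<And>J. J \<in> W \<Longrightarrow> \<exists>I\<in>V. {fst J..snd J} \<subseteq> {fst I..snd I}"
  shows "\<exists>R. nonoverlapping a b R \<and> incr (\<lambda>x. x) R = incr (\<lambda>x. x) V - incr (\<lambda>x. x) W \<and>
             incr f R = incr f V - incr f W"
proof -
  obtain G where G: "nonoverlapping a b G"
       "\<And>I J. I\<in>V \<Longrightarrow> J\<in>G \<Longrightarrow> disjnt {fst I<..<snd I} {fst J<..<snd J}"
       "incr (\<lambda>x. x) V + incr (\<lambda>x. x) G = b - a" "incr f V + incr f G = f b - f a"
    using gaps_exist[OF V \<open>a \<le> b\<close>, of f] by blast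
  have dj: "disjnt {fst I<..<snd I} {fst J<..<snd J}" if IW: "I \<in> W" "J \<in> G" for I J
  proof -
    obtain K where K: "K \<in> V" "{fst I..snd I} \<subseteq> {fst K..snd K}"
      using sub[OF IW(1)] by blast
    have "fst I < snd I" using W IW by (auto simp: nonoverlapping_def)
    then have "{fst I<..<snd I} \<subseteq> {fst K<..<snd K}" using K(2) by auto
    then show ?thesis using disjnt_subset1[OF G(2)[OF K(1) IW(2)]] by blast
  qed
  have disj: "W \<inter> G = {}"
  proof -
    have "False" if "I \<in> W" "I \<in> G" for I
    proof -
      have "fst I < snd I" using W that by (auto simp: nonoverlapping_def)
      then have "{fst I<..<snd I} \<noteq> {}" by simp
      then show False using dj[OF that] by (simp add: disjnt_def)
    qed
    then show ?thesis by blast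
  qed
  have fin: "finite W" "finite G" using W G(1) by (auto simp: nonoverlapping_def)
  have no: "nonoverlapping a b (W \<union> G)"
    unfolding nonoverlapping_def
  proof (intro conjI)
    show "finite (W \<union> G)" using fin by simp
    show "\<forall>I\<in>W \<union> G. a \<le> fst I \<and> fst I < snd I \<and> snd I \<le> b"
      using W G(1) by (auto simp: nonoverlapping_def)
    show "pairwise (\<lambda>I J. disjnt {fst I<..<snd I} {fst J<..<snd J}) (W \<union> G)"
    proof (rule pairwiseI)
      fix I J assume IJ: "I \<in> W \<union> G" "J \<in> W \<union> G" "I \<noteq> J"
      have "pairwise (\<lambda>I J. disjnt {fst I<..<snd I} {fst J<..<snd J}) W"
        "pairwise (\<lambda>I J. disjnt {fst I<..<snd I} {fst J<..<snd J}) G"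
        using W G(1) by (simp_all add: nonoverlapping_def)
      then show "disjnt {fst I<..<snd I} {fst J<..<snd J}"
        using IJ dj[of I J] disjnt_sym[OF dj[of J I]] unfolding pairwise_def by blast
    qed
  qed
  have incrU: "incr h (W \<union> G) = incr h W + incr h G" for h :: "real \<Rightarrow> 'w::real_normed_vector"
    unfolding incr_def using fin disj by (rule sum.union_disjoint)
  obtain R where R: "nonoverlapping a b R" "incr (\<lambda>x. x) (W \<union> G) + incr (\<lambda>x. x) R = b - a"
       "incr f (W \<union> G) + incr f R = f b - f a"
    using gaps_exist[OF no \<open>a \<le> b\<close>, of f] by blast
  show ?thesis
  proof (intro exI conjI)
    show "incr (\<lambda>x. x) R = incr (\<lambda>x. x) V - incr (\<lambda>x. x) W"
      using R(2) G(3) by (simp add: incrU algebra_simps)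
    have "incr f V = (f b - f a) - incr f G" using G(4) by (simp add: eq_diff_eq)
    moreover have "incr f R = (f b - f a) - (incr f W + incr f G)"
      using R(3) by (simp add: incrU eq_diff_eq add.commute)
    ultimately show "incr f R = incr f V - incr f W" by simp
  qed (fact R(1))
qed

lemma norm_incr_le: "norm (incr f D) \<le> (\<Sum>I\<in>D. norm (f (snd I) - f (fst I)))"
  unfolding incr_def by (rule norm_sum)

lemma incr_id_nonneg: "nonoverlapping a b D \<Longrightarrow> 0 \<le> incr (\<lambda>x. x) D"
  unfolding incr_def nonoverlapping_def by (intro sum_nonneg) (simp add: less_imp_le)

lemma measure_closed_intervals:
  fixes D :: "(real \<times> real) set"
  assumes "finite D" "\<And>I. I \<in> D \<Longrightarrow> fst I < snd I"
    "pairwise (\<lambda>I J. disjnt {fst I..snd I} {fst J..snd J}) D"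
  shows "measure lebesgue (\<Union>I\<in>D. {fst I..snd I}) = incr (\<lambda>x. x) D"
  using assms
proof (induction D rule: finite_induct)
  case empty then show ?case by (simp add: incr_def)
next
  case (insert I D)
  have m: "(\<Union>I\<in>D. {fst I..snd I}) \<in> lmeasurable"
    using insert.hyps by (intro fmeasurable.finite_UN) auto
  have d: "{fst I..snd I} \<inter> (\<Union>I\<in>D. {fst I..snd I}) = {}"
  proof -
    have "{fst I..snd I} \<inter> {fst J..snd J} = {}" if "J \<in> D" for J
      using insert.prems(2) insert.hyps that unfolding pairwise_insert disjnt_def by metis
    then show ?thesis by blast
  qed
  have "measure lebesgue ({fst I..snd I} \<union> (\<Union>I\<in>D. {fst I..snd I})) =
        measure lebesgue {fst I..snd I} + measure lebesgue (\<Union>I\<in>D. {fst I..snd I})"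
    using m d by (simp add: measure_Un3)
  also have "measure lebesgue (\<Union>I\<in>D. {fst I..snd I}) = incr (\<lambda>x. x) D"
    using insert by (auto simp: pairwise_insert)
  also have "measure lebesgue {fst I..snd I} = snd I - fst I"
    using insert.prems(1)[of I] by simp
  finally show ?case using insert.hyps by (simp add: incr_def)
qed

text \<open>
  The finite form of Vitali's covering theorem. The theorem gives a countable disjoint subfamily;
  since its total length is bounded by the measure of \<open>U\<close>, all but finitely many members have
  small total length and are absorbed in the exceptional set \<open>T\<close>.
\<close>

lemma vitali_finite_family:
  fixes E U :: "real set" and Q :: "real \<Rightarrow> real \<Rightarrow> bool"
  assumes "open U" and U: "U \<in> lmeasurable" and "E \<subseteq> U"
    and Q: "\<And>x d. x \<in> E \<Longrightarrow> 0 < d \<Longrightarrow> \<exists>s t. s \<le> x \<and> x \<le> t \<and> s < t \<and> t - s < d \<and> Q s t"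
    and "0 < e"
  obtains D T where "finite D" 
    "\<And>I. I \<in> D \<Longrightarrow> fst I < snd I \<and> {fst I..snd I} \<subseteq> U \<and> Q (fst I) (snd I)"
    "pairwise (\<lambda>I J. disjnt {fst I..snd I} {fst J..snd J}) D"
    "T \<in> lmeasurable" "measure lebesgue T < e" "E \<subseteq> (\<Union>I\<in>D. {fst I..snd I}) \<union> T"
proof -
  define K where "K = {I. fst I < snd I \<and> {fst I..snd I} \<subseteq> U \<and> Q (fst I) (snd I)}"
  define c where "c I = (fst I + snd I) / 2" for I :: "real \<times> real"
  define r where "r I = (snd I - fst I) / 2" for I :: "real \<times> real"
  have cb: "cball (c I) (r I) = {fst I..snd I}" for I
    by (auto simp: cball_eq_atLeastAtMost c_def r_def field_simps)
  obtain C where C: "countable C" "C \<subseteq> K"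
     "pairwise (\<lambda>i j. disjnt (cball (c i) (r i)) (cball (c j) (r j))) C"
     "negligible(E - (\<Union>i \<in> C. cball (c i) (r i)))"
  proof (rule Vitali_covering_theorem_cballs[of K r E c])
    show "0 < r i" if "i \<in> K" for i using that by (simp add: K_def r_def)
    show "\<exists>i. i \<in> K \<and> x \<in> cball (c i) (r i) \<and> r i < d" if x: "x \<in> E" "0 < d" for x d
    proof -
      obtain \<epsilon> where \<epsilon>: "\<epsilon> > 0" "ball x \<epsilon> \<subseteq> U" using \<open>open U\<close> \<open>E \<subseteq> U\<close> x(1) openE by blast
      obtain s t where st: "s \<le> x" "x \<le> t" "s < t" "t - s < min d \<epsilon>" "Q s t"
        using Q[OF x(1), of "min d \<epsilon>"] \<epsilon>(1) x(2) by auto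
      have "{s..t} \<subseteq> ball x \<epsilon>" using st by (auto simp: dist_real_def)
      then have "(s,t) \<in> K" using st \<epsilon> by (auto simp: K_def)
      moreover have "x \<in> cball (c (s,t)) (r (s,t))" unfolding cb using st by simp
      moreover have "r (s,t) < d" using st by (simp add: r_def)
      ultimately show ?thesis by blast
    qed
  qed auto
  define F where "F = (\<lambda>I. {fst I..snd I}) ` C"
  have Fsub: "\<Union>F' \<subseteq> U" if "F' \<subseteq> F" for F' using that C(2) by (auto simp: F_def K_def)
  have Fm: "S \<in> lmeasurable" if "S \<in> F" for S using that by (auto simp: F_def)
  have B: "measure lebesgue (\<Union>D') \<le> measure lebesgue U" if "D' \<subseteq> F" "finite D'" for D'
    using that Fm by (intro measure_mono_fmeasurable Fsub U fmeasurableD fmeasurable.finite_Union) auto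
  have cF: "countable F" using C(1) by (simp add: F_def)
  obtain F' where F': "F' \<subseteq> F" "finite F'" "measure lebesgue (\<Union>F) - e < measure lebesgue (\<Union>F')"
    using measure_countable_Union_approachable[OF cF \<open>0 < e\<close> Fm B] by blast
  obtain D where D: "D \<subseteq> C" "finite D" "F' = (\<lambda>I. {fst I..snd I}) ` D"
    using finite_subset_image[OF F'(2)] F'(1) unfolding F_def by blast
  have UF: "\<Union>F \<in> lmeasurable"
  proof (rule fmeasurableI2[OF U Fsub[OF subset_refl]])
    show "\<Union>F \<in> sets lebesgue" using Fm by (intro sets.countable_Union[OF cF]) blast
  qed
  have UF': "\<Union>F' \<in> lmeasurable" using F' Fm by (intro fmeasurable.finite_Union) auto
  define N where "N = E - \<Union>F"
  have N: "negligible N" using C(4) unfolding N_def F_def cb by simp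
  define T where "T = (\<Union>F - \<Union>F') \<union> N"
  show ?thesis
  proof (rule that[of D T])
    show "finite D" by fact
    show "fst I < snd I \<and> {fst I..snd I} \<subseteq> U \<and> Q (fst I) (snd I)" if "I \<in> D" for I
      using that D(1) C(2) by (auto simp: K_def)
    show "pairwise (\<lambda>I J. disjnt {fst I..snd I} {fst J..snd J}) D"
      using C(3) D(1) unfolding cb by (rule pairwise_subset)
    have Nm: "N \<in> lmeasurable" "measure lebesgue N = 0" using N negligible_iff_measure by blast+
    show "T \<in> lmeasurable" unfolding T_def using UF UF' Nm by blast
    have "measure lebesgue T \<le> measure lebesgue (\<Union>F - \<Union>F') + measure lebesgue N"
      unfolding T_def using UF UF' Nm by (intro measure_Un_le) auto
    also have "measure lebesgue (\<Union>F - \<Union>F') = measure lebesgue (\<Union>F) - measure lebesgue (\<Union>F')"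
      using UF UF' F'(1) by (intro measurable_measure_Diff) auto
    finally show "measure lebesgue T < e" using F'(3) Nm(2) by linarith
    show "E \<subseteq> (\<Union>I\<in>D. {fst I..snd I}) \<union> T"
      unfolding T_def N_def D(3) by blast
  qed
qed

section \<open>Differentiation of absolutely continuous functions\<close>

lemma nonoverlapping_of_disjoint_closed:
  assumes "finite D" "\<And>I. I \<in> D \<Longrightarrow> fst I < snd I \<and> {fst I..snd I} \<subseteq> U"
    "pairwise (\<lambda>I J. disjnt {fst I..snd I} {fst J..snd J}) D" "U \<subseteq> {a<..<b}"
  shows "nonoverlapping a b D"
  unfolding nonoverlapping_def
proof (intro conjI ballI)
  show "finite D" by fact
  show "pairwise (\<lambda>I J. disjnt {fst I<..<snd I} {fst J<..<snd J}) D"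
    using assms(3) by (rule pairwise_mono) (auto simp: disjnt_def)
  fix I assume I: "I \<in> D"
  have "fst I \<in> {fst I..snd I}" "snd I \<in> {fst I..snd I}" using assms(2)[OF I] by auto
  then have "fst I \<in> {a<..<b}" "snd I \<in> {a<..<b}" using assms(2)[OF I] assms(4) by blast+
  then show "a \<le> fst I" "snd I \<le> b" by auto
  show "fst I < snd I" using assms(2)[OF I] by simp
qed

text \<open>
  The covering arguments below apply to arbitrary sets; the infimum \<open>s\<close> of the measures of
  measurable supersets serves as outer measure.
\<close>

lemma outer_measure_witness:
  fixes E S :: "real set"
  assumes "\<not> negligible E" "E \<subseteq> S" "S \<in> lmeasurable"
  obtains s where "s > 0" "\<And>T. T \<in> lmeasurable \<Longrightarrow> E \<subseteq> T \<Longrightarrow> s \<le> measure lebesgue T"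
    "\<And>e. e > 0 \<Longrightarrow> \<exists>U. open U \<and> U \<in> lmeasurable \<and> E \<subseteq> U \<and> measure lebesgue U < s + e"
proof -
  define X where "X = {measure lebesgue T | T. T \<in> lmeasurable \<and> E \<subseteq> T}"
  obtain e0 where e0: "e0 > 0" "\<And>T. E \<subseteq> T \<Longrightarrow> T \<in> lmeasurable \<Longrightarrow> e0 \<le> measure lebesgue T"
    using assms(1) unfolding negligible_outer by (meson not_less)
  have ne: "X \<noteq> {}" using assms by (auto simp: X_def)
  have bd: "bdd_below X" by (rule bdd_belowI[of _ 0]) (auto simp: X_def)
  show thesis
  proof (rule that[of "Inf X"])
    have "e0 \<le> Inf X" using ne e0(2) by (intro cInf_greatest) (auto simp: X_def)
    then show "Inf X > 0" using e0(1) by linarith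
    show "Inf X \<le> measure lebesgue T" if "T \<in> lmeasurable" "E \<subseteq> T" for T
      using that bd by (intro cInf_lower) (auto simp: X_def)
    show "\<exists>U. open U \<and> U \<in> lmeasurable \<and> E \<subseteq> U \<and> measure lebesgue U < Inf X + e" if epos: "e > 0" for e
    proof -
      have "Inf X < Inf X + e/2" using that by simp
      then obtain x where "x \<in> X" "x < Inf X + e/2" using cInf_lessD[OF ne] by blast
      then obtain T where T: "T \<in> lmeasurable" "E \<subseteq> T" "measure lebesgue T < Inf X + e/2"
        by (auto simp: X_def)
      obtain U where U: "open U" "T \<subseteq> U" "U - T \<in> lmeasurable" "emeasure lebesgue (U - T) < ennreal (e/2)"
        using sets_lebesgue_outer_open[OF fmeasurableD[OF T(1)] half_gt_zero[OF epos]] by metis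
      have "U = T \<union> (U - T)" using U(2) by blast
      then have Um: "U \<in> lmeasurable" using T(1) U(3) by (metis fmeasurable.Un)
      have "measure lebesgue (U - T) < e/2"
        using U(4) that emeasure_eq_measure2[OF U(3)] by (simp add: ennreal_less_iff)
      moreover have "measure lebesgue U \<le> measure lebesgue T + measure lebesgue (U - T)"
        using \<open>U = T \<union> (U - T)\<close> T(1) U(3) by (metis measure_Un_le fmeasurableD)
      ultimately show ?thesis using U(1,2) T(2,3) Um by (intro exI[of _ U]) auto
    qed
  qed
qed

text \<open>
  Lebesgue's argument. If \<open>E\<close> had outer measure \<open>s > 0\<close>, almost all of it would be covered by
  finitely many short intervals \<open>V\<close> with slopes below \<open>p\<close> and total length close to \<open>s\<close>, and
  again, inside \<open>V\<close>, by intervals \<open>W\<close> with slopes above \<open>q\<close>. The residual family has small length,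
  so by absolute continuity \<open>f\<close> increases by nearly the same amount over \<open>V\<close> and \<open>W\<close>, which
  contradicts \<open>p < q\<close>.
\<close>

lemma two_slopes_negligible:
  fixes f :: "real \<Rightarrow> real"
  assumes ac: "ac_on a b f" and "p < q" and E: "E \<subseteq> {a<..<b}"
    and lo: "\<And>x d. x \<in> E \<Longrightarrow> 0 < d \<Longrightarrow>
       \<exists>s t. s \<le> x \<and> x \<le> t \<and> s < t \<and> t - s < d \<and> f t - f s < p * (t - s)"
    and hi: "\<And>x d. x \<in> E \<Longrightarrow> 0 < d \<Longrightarrow>
       \<exists>s t. s \<le> x \<and> x \<le> t \<and> s < t \<and> t - s < d \<and> f t - f s > q * (t - s)"
  shows "negligible E"
proof (rule ccontr)
  assume nn: "\<not> negligible E"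
  have ab: "{a<..<b} \<in> lmeasurable" by simp
  obtain s where s: "s > 0" "\<And>T. T \<in> lmeasurable \<Longrightarrow> E \<subseteq> T \<Longrightarrow> s \<le> measure lebesgue T"
    "\<And>e. e > 0 \<Longrightarrow> \<exists>U. open U \<and> U \<in> lmeasurable \<and> E \<subseteq> U \<and> measure lebesgue U < s + e"
    using outer_measure_witness[OF nn E ab] by blast
  have "E \<noteq> {}" using nn by auto
  then have aleb: "a \<le> b" using E by force
  define \<eta> where "\<eta> = (q - p) * s / 4"
  have "\<eta> > 0" using \<open>p < q\<close> s(1) by (simp add: \<eta>_def)
  then obtain \<delta> where \<delta>: "\<delta> > 0" "\<And>D. nonoverlapping a b D \<Longrightarrow> incr (\<lambda>x. x) D < \<delta> \<Longrightarrow>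
        (\<Sum>I\<in>D. norm (f (snd I) - f (fst I))) < \<eta>"
    using ac unfolding ac_on_def by blast
  \<comment> \<open>lengths are controlled up to \<open>3 e\<close>; the last bound makes \<open>3 |q| e\<close> at most \<open>(q - p) s / 4\<close>\<close>
  define e where "e = min (s/2) (min (\<delta>/3) ((q - p) * s / (12 * (\<bar>q\<bar> + 1))))"
  have e: "e > 0" "e \<le> s/2" "3 * e \<le> \<delta>" "3 * \<bar>q\<bar> * e \<le> (q - p) * s / 4"
  proof -
    show "e > 0" using s(1) \<delta>(1) \<open>p < q\<close> by (auto simp: e_def)
    show "e \<le> s/2" unfolding e_def by linarith
    show "3 * e \<le> \<delta>" unfolding e_def by linarith
    have "e \<le> (q - p) * s / (12 * (\<bar>q\<bar> + 1))" by (simp add: e_def)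
    then have "e * (12 * (\<bar>q\<bar> + 1)) \<le> (q - p) * s"
      by (subst (asm) pos_le_divide_eq) auto
    moreover have "0 \<le> e" using \<open>e > 0\<close> by simp
    ultimately show "3 * \<bar>q\<bar> * e \<le> (q - p) * s / 4" by (simp add: algebra_simps)
  qed
  obtain U0 where U0: "open U0" "U0 \<in> lmeasurable" "E \<subseteq> U0" "measure lebesgue U0 < s + e"
    using s(3)[OF e(1)] by blast
  define U where "U = U0 \<inter> {a<..<b}"
  have U: "open U" "U \<in> lmeasurable" "E \<subseteq> U" "U \<subseteq> {a<..<b}"
    using U0 E unfolding U_def by (auto intro: fmeasurable_Int_fmeasurable)
  have mU: "measure lebesgue U < s + e"
    using U0(2,4) U(2) measure_mono_fmeasurable[of U U0 lebesgue] by (auto simp: U_def)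
  obtain V T1 where V: "finite V" 
    "\<And>I. I \<in> V \<Longrightarrow> fst I < snd I \<and> {fst I..snd I} \<subseteq> U \<and> f (snd I) - f (fst I) < p * (snd I - fst I)"
    "pairwise (\<lambda>I J. disjnt {fst I..snd I} {fst J..snd J}) V"
    and T1: "T1 \<in> lmeasurable" "measure lebesgue T1 < e" "E \<subseteq> (\<Union>I\<in>V. {fst I..snd I}) \<union> T1"
    using vitali_finite_family[OF U(1,2,3) lo e(1)] by blast
  have noV: "nonoverlapping a b V"
    by (rule nonoverlapping_of_disjoint_closed[of V U]) (use V U in auto)
  \<comment> \<open>the open intervals, so that small intervals around their points stay inside one member of \<open>V\<close>\<close>
  define O' where "O' = (\<Union>I\<in>V. {fst I<..<snd I})"
  have O': "open O'" "O' \<in> lmeasurable" unfolding O'_def using V(1)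
    by (auto intro!: fmeasurable.finite_UN)
  have hi': "\<exists>s t. s \<le> x \<and> x \<le> t \<and> s < t \<and> t - s < d \<and>
      (f t - f s > q * (t - s) \<and> (\<exists>I\<in>V. {s..t} \<subseteq> {fst I..snd I}))"
    if x: "x \<in> E \<inter> O'" and "0 < d" for x d
  proof -
    obtain I where I: "I \<in> V" "fst I < x" "x < snd I" using x by (auto simp: O'_def)
    define d' where "d' = min d (min (x - fst I) (snd I - x))"
    have "d' > 0" using I \<open>0 < d\<close> by (simp add: d'_def)
    then obtain s t where st: "s \<le> x" "x \<le> t" "s < t" "t - s < d'" "f t - f s > q * (t - s)"
      using hi[of x d'] x by auto
    have "{s..t} \<subseteq> {fst I..snd I}" using st by (auto simp: d'_def)
    moreover have "t - s < d" using st by (simp add: d'_def)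
    ultimately show ?thesis using st I(1) by blast
  qed
  obtain W T2 where W: "finite W" 
    "\<And>I. I \<in> W \<Longrightarrow> fst I < snd I \<and> {fst I..snd I} \<subseteq> O' \<and> (f (snd I) - f (fst I) > q * (snd I - fst I) \<and>
        (\<exists>J\<in>V. {fst I..snd I} \<subseteq> {fst J..snd J}))"
    "pairwise (\<lambda>I J. disjnt {fst I..snd I} {fst J..snd J}) W"
    and T2: "T2 \<in> lmeasurable" "measure lebesgue T2 < e" "E \<inter> O' \<subseteq> (\<Union>I\<in>W. {fst I..snd I}) \<union> T2"
    using vitali_finite_family[OF O'(1,2) Int_lower2 hi' e(1)] by blast
  have O'ab: "O' \<subseteq> {a<..<b}"
  proof
    fix x assume "x \<in> O'"
    then obtain I where "I \<in> V" "x \<in> {fst I..snd I}" by (auto simp: O'_def)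
    then show "x \<in> {a<..<b}" using V(2) U(4) by blast
  qed
  have noW: "nonoverlapping a b W"
    by (rule nonoverlapping_of_disjoint_closed[of W O']) (use W O'ab in auto)
  define mV where "mV = incr (\<lambda>x. x) V"
  define mW where "mW = incr (\<lambda>x. x) W"
  have mV: "measure lebesgue (\<Union>I\<in>V. {fst I..snd I}) = mV"
    unfolding mV_def using V by (intro measure_closed_intervals) auto
  have mW: "measure lebesgue (\<Union>I\<in>W. {fst I..snd I}) = mW"
    unfolding mW_def using W by (intro measure_closed_intervals) auto
  have lmV: "(\<Union>I\<in>V. {fst I..snd I}) \<in> lmeasurable" using V(1) by (intro fmeasurable.finite_UN) auto
  have lmW: "(\<Union>I\<in>W. {fst I..snd I}) \<in> lmeasurable" using W(1) by (intro fmeasurable.finite_UN) auto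
  define N where "N = fst ` V \<union> snd ` V"
  have N: "N \<in> lmeasurable" "measure lebesgue N = 0"
  proof -
    have "negligible N" unfolding N_def using V(1) by (intro negligible_finite) auto
    then show "N \<in> lmeasurable" "measure lebesgue N = 0" using negligible_iff_measure by blast+
  qed
  have "mV \<le> measure lebesgue U"
    unfolding mV[symmetric]
  proof (rule measure_mono_fmeasurable)
    show "(\<Union>I\<in>V. {fst I..snd I}) \<subseteq> U" using V(2) by blast
  qed (use lmV U in auto)
  then have mV_upper: "mV < s + e" using mU by linarith
  have "s \<le> measure lebesgue ((\<Union>I\<in>V. {fst I..snd I}) \<union> T1)"
    using lmV T1 by (intro s(2)) auto
  also have "\<dots> \<le> mV + measure lebesgue T1"
    unfolding mV[symmetric] using lmV T1 by (intro measure_Un_le) auto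
  finally have mV_lower: "s - e < mV" using T1(2) by linarith
  have cover: "E \<subseteq> (\<Union>I\<in>W. {fst I..snd I}) \<union> (T2 \<union> (T1 \<union> N))"
  proof
    fix x assume x: "x \<in> E"
    show "x \<in> (\<Union>I\<in>W. {fst I..snd I}) \<union> (T2 \<union> (T1 \<union> N))"
    proof (cases "x \<in> T1 \<union> N")
      case False
      then obtain I where I: "I \<in> V" "x \<in> {fst I..snd I}" using T1(3) x by blast
      then have "x \<noteq> fst I" "x \<noteq> snd I" using False by (auto simp: N_def)
      then have "x \<in> O'" using I by (auto simp: O'_def intro!: bexI[of _ I])
      then show ?thesis using T2(3) x by blast
    qed blast
  qed
  have "s \<le> measure lebesgue ((\<Union>I\<in>W. {fst I..snd I}) \<union> (T2 \<union> (T1 \<union> N)))"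
    using cover lmW T1 T2 N by (intro s(2)) auto
  also have "\<dots> \<le> mW + measure lebesgue (T2 \<union> (T1 \<union> N))"
    unfolding mW[symmetric] using lmW T1 T2 N by (intro measure_Un_le) auto
  also have "measure lebesgue (T2 \<union> (T1 \<union> N)) \<le> measure lebesgue T2 + measure lebesgue (T1 \<union> N)"
    using T1 T2 N by (intro measure_Un_le) auto
  also have "measure lebesgue (T1 \<union> N) \<le> measure lebesgue T1 + measure lebesgue N"
    using T1 N by (intro measure_Un_le) auto
  finally have mW_lower: "s - 2 * e < mW" using T1(2) T2(2) N(2) by linarith
  obtain R where R: "nonoverlapping a b R" "incr (\<lambda>x. x) R = mV - mW" "incr f R = incr f V - incr f W"
    using residual_family[OF noV noW aleb, of f] W(2) unfolding mV_def mW_def by blast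
  have "incr (\<lambda>x. x) R < \<delta>" using R(2) mV_upper mW_lower e(3) by linarith
  then have "norm (incr f R) < \<eta>" using \<delta>(2)[OF R(1)] norm_incr_le[of f R] by linarith
  moreover have "incr f V \<le> p * mV"
    unfolding incr_def mV_def sum_distrib_left using V(2) by (intro sum_mono) (simp add: less_imp_le)
  moreover have "q * mW \<le> incr f W"
    unfolding incr_def mW_def sum_distrib_left using W(2) by (intro sum_mono) (simp add: less_imp_le)
  ultimately have *: "q * mW - \<eta> < p * mV" using R(3) by (auto simp: abs_less_iff)
  have "mV - mW \<ge> 0" using incr_id_nonneg[OF R(1)] R(2) by simp
  then have "q * (mV - mW) \<le> \<bar>q\<bar> * (mV - mW)" by (intro mult_right_mono) auto
  also have "\<dots> \<le> \<bar>q\<bar> * (3 * e)" using mV_upper mW_lower by (intro mult_left_mono) auto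
  finally have "(q - p) * mV < \<eta> + 3 * \<bar>q\<bar> * e" using * by (simp add: algebra_simps)
  moreover have "(q - p) * (s/2) = \<eta> + \<eta>" by (simp add: \<eta>_def)
  ultimately have "(q - p) * mV < (q - p) * (s/2)" using e(4) unfolding \<eta>_def by linarith
  then have "mV < s/2" using \<open>p < q\<close> by simp
  then show False using mV_lower e(2) by linarith
qed

text \<open>
  Negligibility is local, and over families of total length below \<open>\<delta>\<close> the increments of \<open>f\<close> stay
  below \<open>1\<close>; arbitrarily steep intervals covering a set of positive outer measure would exceed
  this bound.
\<close>

lemma infinite_slope_negligible:
  fixes f :: "real \<Rightarrow> real"
  assumes ac: "ac_on a b f" and E: "E \<subseteq> {a<..<b}"
    and hi: "\<And>x d M. x \<in> E \<Longrightarrow> 0 < d \<Longrightarrow>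
       \<exists>s t. s \<le> x \<and> x \<le> t \<and> s < t \<and> t - s < d \<and> f t - f s > M * (t - s)"
  shows "negligible E"
proof -
  obtain \<delta> where \<delta>: "\<delta> > 0" "\<And>D. nonoverlapping a b D \<Longrightarrow> incr (\<lambda>x. x) D < \<delta> \<Longrightarrow>
        (\<Sum>I\<in>D. norm (f (snd I) - f (fst I))) < 1"
    using ac unfolding ac_on_def by (metis zero_less_one)
  \<comment> \<open>an interval of length \<open>\<delta> / 2\<close>, so every family inside it is shorter than \<open>\<delta>\<close>\<close>
  have loc: "negligible (E \<inter> {c-\<delta>/4<..<c+\<delta>/4})" for c
  proof (rule ccontr)
    define U where "U = {a<..<b} \<inter> {c-\<delta>/4<..<c+\<delta>/4}"
    define F where "F = E \<inter> {c-\<delta>/4<..<c+\<delta>/4}"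
    assume "\<not> negligible (E \<inter> {c-\<delta>/4<..<c+\<delta>/4})"
    then have nn: "\<not> negligible F" by (simp add: F_def)
    have U: "open U" "U \<in> lmeasurable" "F \<subseteq> U" "U \<subseteq> {a<..<b}"
      using E unfolding U_def F_def by (auto intro: fmeasurable_Int_fmeasurable)
    obtain s where s: "s > 0" "\<And>T. T \<in> lmeasurable \<Longrightarrow> F \<subseteq> T \<Longrightarrow> s \<le> measure lebesgue T"
      by (rule outer_measure_witness[OF nn U(3,2)]) blast
    \<comment> \<open>slope \<open>2 / s\<close> over length at least \<open>s / 2\<close> forces an increment of at least \<open>1\<close>\<close>
    have hi': "\<exists>s' t. s' \<le> x \<and> x \<le> t \<and> s' < t \<and> t - s' < d \<and> f t - f s' > (2/s) * (t - s')"
      if "x \<in> F" "0 < d" for x d using hi[of x d "2/s"] that by (simp add: F_def)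
    have s2: "0 < s/2" using s(1) by simp
    obtain D T where D: "finite D" 
      "\<And>I. I \<in> D \<Longrightarrow> fst I < snd I \<and> {fst I..snd I} \<subseteq> U \<and> f (snd I) - f (fst I) > (2/s) * (snd I - fst I)"
      "pairwise (\<lambda>I J. disjnt {fst I..snd I} {fst J..snd J}) D"
      and T: "T \<in> lmeasurable" "measure lebesgue T < s/2" "F \<subseteq> (\<Union>I\<in>D. {fst I..snd I}) \<union> T"
      using vitali_finite_family[OF U(1,2,3) hi' s2] by blast
    have noD: "nonoverlapping a b D"
      by (rule nonoverlapping_of_disjoint_closed[of D U]) (use D U in auto)
    define m where "m = incr (\<lambda>x. x) D"
    have m: "measure lebesgue (\<Union>I\<in>D. {fst I..snd I}) = m"
      unfolding m_def using D by (intro measure_closed_intervals) auto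
    have lm: "(\<Union>I\<in>D. {fst I..snd I}) \<in> lmeasurable" using D(1) by (intro fmeasurable.finite_UN) auto
    have "m \<le> measure lebesgue {c-\<delta>/4<..<c+\<delta>/4}"
      unfolding m[symmetric] using lm D(2)
        by (intro measure_mono_fmeasurable) (auto simp: U_def subset_iff)
    also have "\<dots> < \<delta>" using \<delta>(1) by simp
    finally have "m < \<delta>" .
    then have "norm (incr f D) < 1" using \<delta>(2)[OF noD] norm_incr_le[of f D] unfolding m_def by linarith
    moreover have "(2/s) * m \<le> incr f D"
      unfolding incr_def m_def sum_distrib_left using D(2) by (intro sum_mono) (simp add: less_imp_le)
    ultimately have "(2/s) * m < 1" by simp
    then have "m < s/2" using s(1) by (simp add: field_simps)
    moreover have "s \<le> measure lebesgue ((\<Union>I\<in>D. {fst I..snd I}) \<union> T)"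
      using lm T by (intro s(2)) auto
    moreover have "\<dots> \<le> m + measure lebesgue T"
      unfolding m[symmetric] using lm T by (intro measure_Un_le) auto
    ultimately show False using T(2) by linarith
  qed
  show ?thesis
    unfolding locally_negligible_alt[of E]
  proof
    fix x assume "x \<in> E"
    then show "\<exists>U. openin (top_of_set E) U \<and> x \<in> U \<and> negligible U"
      using loc[of x] \<delta>(1)
      by (intro exI[of _ "E \<inter> {x-\<delta>/4<..<x+\<delta>/4}"]) (auto intro: openin_open_Int)
  qed
qed

lemma ac_onD:
  assumes "ac_on a b f" "0 < \<epsilon>"
  obtains \<delta> where "\<delta> > 0" "\<And>D. nonoverlapping a b D \<Longrightarrow> incr (\<lambda>x. x) D < \<delta> \<Longrightarrow>
        (\<Sum>I\<in>D. norm (f (snd I) - f (fst I))) < \<epsilon>"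
  using assms unfolding ac_on_def by auto

text \<open>
  Absolute continuity passes to functions whose increments are dominated up to a Lipschitz term;
  this covers real and imaginary parts, negatives, and differences with \<open>C\<^sup>1\<close> functions.
\<close>

lemma ac_on_norm_le:
  fixes f :: "real \<Rightarrow> 'v::real_normed_vector" and g :: "real \<Rightarrow> 'w::real_normed_vector"
  assumes "ac_on a b f"
    and "\<And>s t. a \<le> s \<Longrightarrow> s < t \<Longrightarrow> t \<le> b \<Longrightarrow> norm (g t - g s) \<le> norm (f t - f s) + L * (t - s)"
  shows "ac_on a b g"
  unfolding ac_on_def
proof (intro allI impI)
  fix \<epsilon> :: real assume "\<epsilon> > 0"
  then have e2: "0 < \<epsilon>/2" by simp
  obtain \<delta> where \<delta>: "\<delta> > 0" "\<And>D. nonoverlapping a b D \<Longrightarrow> incr (\<lambda>x. x) D < \<delta> \<Longrightarrow>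
        (\<Sum>I\<in>D. norm (f (snd I) - f (fst I))) < \<epsilon>/2"
    by (rule ac_onD[OF assms(1) e2]) blast
  define \<delta>' where "\<delta>' = min \<delta> (\<epsilon> / (2 * (\<bar>L\<bar> + 1)))"
  have "\<delta>' > 0" using \<delta>(1) \<open>\<epsilon> > 0\<close> by (auto simp: \<delta>'_def)
  moreover have "(\<Sum>I\<in>D. norm (g (snd I) - g (fst I))) < \<epsilon>"
    if D: "nonoverlapping a b D" "incr (\<lambda>x. x) D < \<delta>'" for D
  proof -
    have "(\<Sum>I\<in>D. norm (g (snd I) - g (fst I))) \<le>
          (\<Sum>I\<in>D. norm (f (snd I) - f (fst I)) + L * (snd I - fst I))"
      using D(1) by (intro sum_mono assms(2)) (auto simp: nonoverlapping_def)
    also have "\<dots> = (\<Sum>I\<in>D. norm (f (snd I) - f (fst I))) + L * incr (\<lambda>x. x) D"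
      by (simp add: sum.distrib incr_def sum_distrib_left)
    also have "(\<Sum>I\<in>D. norm (f (snd I) - f (fst I))) < \<epsilon>/2"
      using \<delta>(2)[OF D(1)] D(2) by (simp add: \<delta>'_def)
    also have "L * incr (\<lambda>x. x) D \<le> (\<bar>L\<bar> + 1) * incr (\<lambda>x. x) D"
      using incr_id_nonneg[OF D(1)] by (intro mult_right_mono) auto
    also have "\<dots> \<le> (\<bar>L\<bar> + 1) * (\<epsilon> / (2 * (\<bar>L\<bar> + 1)))"
      using D(2) by (intro mult_left_mono) (auto simp: \<delta>'_def)
    also have "\<dots> = \<epsilon> / 2" by (simp add: field_simps)
    finally show ?thesis by simp
  qed
  ultimately show "\<exists>\<delta>>0. \<forall>D. nonoverlapping a b D \<and> incr (\<lambda>x. x) D < \<delta> \<longrightarrow>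
        (\<Sum>I\<in>D. norm (g (snd I) - g (fst I))) < \<epsilon>" by blast
qed

text \<open>
  Difference quotients at \<open>x\<close> become slopes over intervals with \<open>x\<close> as an end point, as the
  covering argument requires.
\<close>

lemma slope_intervals:
  fixes f :: "real \<Rightarrow> real"
  assumes "\<exists>\<^sub>F y in at x. P ((f y - f x) / (y - x))" and "0 < d"
  shows "\<exists>s t. s \<le> x \<and> x \<le> t \<and> s < t \<and> t - s < d \<and> P ((f t - f s) / (t - s))"
proof -
  have "\<exists>\<^sub>F y in at x. P ((f y - f x) / (y - x)) \<and> dist y x < d \<and> y \<noteq> x"
    using assms(1)
    by (rule frequently_rev_mp)
       (use assms(2) in \<open>auto simp: eventually_at intro!: exI[of _ d]\<close>)
  then obtain y where y: "P ((f y - f x) / (y - x))" "dist y x < d" "y \<noteq> x"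
    using frequently_ex by blast
  show ?thesis
  proof (cases "y < x")
    case True
    have "(f y - f x) / (y - x) = (f x - f y) / (x - y)"
      by (metis minus_diff_eq minus_divide_divide)
    then show ?thesis using True y
      by (intro exI[of _ y] exI[of _ x]) (auto simp: dist_real_def)
  next
    case False
    then show ?thesis using y
      by (intro exI[of _ x] exI[of _ y]) (auto simp: dist_real_def)
  qed
qed

text \<open>
  The lower and upper limits \<open>l \<le> u\<close> of the difference quotient exist in the extended reals. If
  they differ, rationals separate them; if they agree, their common value is infinite.
\<close>

lemma not_differentiable_cases:
  fixes f :: "real \<Rightarrow> real"
  assumes "\<not> f differentiable (at x)"
  defines "\<sigma> \<equiv> \<lambda>y. (f y - f x) / (y - x)"
  obtains (two) p q :: rat where "p < q" "\<exists>\<^sub>F y in at x. \<sigma> y < of_rat p" "\<exists>\<^sub>F y in at x. \<sigma> y > of_rat q"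
  | (up) "\<And>M. \<exists>\<^sub>F y in at x. \<sigma> y > M"
  | (down) "\<And>M. \<exists>\<^sub>F y in at x. \<sigma> y < M"
proof -
  define l where "l = Liminf (at x) (\<lambda>y. ereal (\<sigma> y))"
  define u where "u = Limsup (at x) (\<lambda>y. ereal (\<sigma> y))"
  have lu: "l \<le> u" unfolding l_def u_def by (intro Liminf_le_Limsup) simp
  have freq_less: "\<exists>\<^sub>F y in at x. \<sigma> y < c" if "l < ereal c" for c
  proof (rule ccontr)
    assume "\<not> ?thesis"
    then have "\<forall>\<^sub>F y in at x. ereal c \<le> ereal (\<sigma> y)" by (simp add: not_frequently not_less)
    then have "ereal c \<le> l" unfolding l_def by (rule Liminf_bounded)
    with that show False by simp
  qed
  have freq_greater: "\<exists>\<^sub>F y in at x. \<sigma> y > c" if "ereal c < u" for c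
  proof (rule ccontr)
    assume "\<not> ?thesis"
    then have "\<forall>\<^sub>F y in at x. ereal (\<sigma> y) \<le> ereal c" by (simp add: not_frequently not_less)
    then have "u \<le> ereal c" unfolding u_def by (rule Limsup_bounded)
    with that show False by simp
  qed
  show thesis
  proof (cases "l < u")
    case True
    obtain p :: rat where p: "l < ereal (of_rat p)" "ereal (of_rat p) < u"
      using ereal_dense3[OF True] by blast
    obtain q :: rat where q: "ereal (of_rat p) < ereal (of_rat q)" "ereal (of_rat q) < u"
      using ereal_dense3[OF p(2)] by blast
    show thesis using two[of p q] freq_less[OF p(1)] freq_greater[OF q(2)] q(1)
      by (simp add: of_rat_less)
  next
    case False
    then have eq: "l = u" using lu by simp
    show thesis
    proof (cases u)
      case (real r)
      have "((\<lambda>y. ereal (\<sigma> y)) \<longlongrightarrow> ereal r) (at x)"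
        using eq real unfolding l_def u_def by (intro Liminf_eq_Limsup) simp_all
      then have "(\<sigma> \<longlongrightarrow> r) (at x)" by simp
      then have "(f has_field_derivative r) (at x)" unfolding \<sigma>_def has_field_derivative_iff .
      then show thesis using assms(1) real_differentiable_def by blast
    next
      case PInf
      then show thesis using up freq_greater by simp
    next
      case MInf
      then show thesis using down freq_less eq by simp
    qed
  qed
qed

text \<open>
  Lebesgue's differentiation theorem for absolutely continuous functions.
\<close>

lemma ac_differentiable_ae:
  fixes f :: "real \<Rightarrow> real"
  assumes ac: "ac_on a b f"
  shows "negligible {x\<in>{a<..<b}. \<not> f differentiable (at x)}"
proof -
  define \<sigma> where "\<sigma> x y = (f y - f x) / (y - x)" for x y
  define A where "A p q = {x\<in>{a<..<b}. (\<exists>\<^sub>F y in at x. \<sigma> x y < p) \<and> (\<exists>\<^sub>F y in at x. \<sigma> x y > q)}" for p q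
  define B where "B = {x\<in>{a<..<b}. \<forall>M. \<exists>\<^sub>F y in at x. \<sigma> x y > M}"
  define C where "C = {x\<in>{a<..<b}. \<forall>M. \<exists>\<^sub>F y in at x. \<sigma> x y < M}"
  have A: "negligible (A p q)" if "p < q" for p q
  proof (rule two_slopes_negligible[OF ac that])
    show "A p q \<subseteq> {a<..<b}" by (auto simp: A_def)
    fix x d :: real assume x: "x \<in> A p q" and d: "0 < d"
    have 1: "\<exists>\<^sub>F y in at x. (f y - f x) / (y - x) < p" and 2: "\<exists>\<^sub>F y in at x. q < (f y - f x) / (y - x)"
      using x by (auto simp: A_def \<sigma>_def)
    obtain s t where "s \<le> x" "x \<le> t" "s < t" "t - s < d" "(f t - f s) / (t - s) < p"
      using slope_intervals[OF 1 d] by blast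
    moreover from this have "f t - f s < p * (t - s)" by (simp add: pos_divide_less_eq)
    ultimately show "\<exists>s t. s \<le> x \<and> x \<le> t \<and> s < t \<and> t - s < d \<and> f t - f s < p * (t - s)"
      by blast
    obtain s t where "s \<le> x" "x \<le> t" "s < t" "t - s < d" "q < (f t - f s) / (t - s)"
      using slope_intervals[of "\<lambda>z. q < z", OF 2 d] by blast
    moreover from this have "f t - f s > q * (t - s)" by (simp add: pos_less_divide_eq)
    ultimately show "\<exists>s t. s \<le> x \<and> x \<le> t \<and> s < t \<and> t - s < d \<and> f t - f s > q * (t - s)"
      by blast
  qed
  have B: "negligible B"
  proof (rule infinite_slope_negligible[OF ac])
    show "B \<subseteq> {a<..<b}" by (auto simp: B_def)
    fix x d M :: real assume x: "x \<in> B" and d: "0 < d"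
    have 1: "\<exists>\<^sub>F y in at x. M < (f y - f x) / (y - x)" using x by (auto simp: B_def \<sigma>_def)
    obtain s t where "s \<le> x" "x \<le> t" "s < t" "t - s < d" "M < (f t - f s) / (t - s)"
      using slope_intervals[of "\<lambda>z. M < z", OF 1 d] by blast
    moreover from this have "f t - f s > M * (t - s)" by (simp add: pos_less_divide_eq)
    ultimately show "\<exists>s t. s \<le> x \<and> x \<le> t \<and> s < t \<and> t - s < d \<and> f t - f s > M * (t - s)"
      by blast
  qed
  have ac': "ac_on a b (\<lambda>x. - f x)"
    by (rule ac_on_norm_le[OF ac, of _ 0]) (simp add: abs_minus_commute)
  have C: "negligible C"
  proof (rule infinite_slope_negligible[OF ac'])
    show "C \<subseteq> {a<..<b}" by (auto simp: C_def)
    fix x d M :: real assume x: "x \<in> C" and d: "0 < d"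
    have 1: "\<exists>\<^sub>F y in at x. (f y - f x) / (y - x) < - M" using x by (auto simp: C_def \<sigma>_def)
    obtain s t where "s \<le> x" "x \<le> t" "s < t" "t - s < d" "(f t - f s) / (t - s) < - M"
      using slope_intervals[OF 1 d] by blast
    moreover from this have "f t - f s < - M * (t - s)" by (simp add: pos_divide_less_eq)
    ultimately show "\<exists>s t. s \<le> x \<and> x \<le> t \<and> s < t \<and> t - s < d \<and> - f t - (- f s) > M * (t - s)"
      by (intro exI[of _ s] exI[of _ t]) auto
  qed
  have "{x\<in>{a<..<b}. \<not> f differentiable (at x)} \<subseteq>
          (\<Union>(p,q)\<in>{(p,q). p < q}. A (of_rat p) (of_rat q)) \<union> (B \<union> C)"
  proof
    fix x assume "x \<in> {x\<in>{a<..<b}. \<not> f differentiable (at x)}"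
    then have x: "x \<in> {a<..<b}" "\<not> f differentiable (at x)" by auto
    from x(2) show "x \<in> (\<Union>(p,q)\<in>{(p,q). p < q}. A (of_rat p) (of_rat q)) \<union> (B \<union> C)"
    proof (cases rule: not_differentiable_cases)
      case (two p q)
      then have "x \<in> A (of_rat p) (of_rat q)" using x(1) by (simp add: A_def \<sigma>_def)
      then show ?thesis using two(1) by blast
    next
      case up
      then have "x \<in> B" using x(1) by (simp add: B_def \<sigma>_def)
      then show ?thesis by blast
    next
      case down
      then have "x \<in> C" using x(1) by (simp add: C_def \<sigma>_def)
      then show ?thesis by blast
    qed
  qed
  moreover have "negligible (\<Union>((\<lambda>(p,q). A (of_rat p) (of_rat q)) ` {(p::rat,q). p < q}))"
  proof (rule negligible_countable_Union)
    show "negligible S" if "S \<in> (\<lambda>(p,q). A (of_rat p) (of_rat q)) ` {(p::rat,q). p < q}" for S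
      using that A by (auto simp: of_rat_less)
  qed auto
  ultimately show ?thesis using B C negligible_Un negligible_subset by meson
qed

text \<open>
  Almost all of \<open>[a, b]\<close> is covered by disjoint intervals over which \<open>f\<close> changes by at most \<open>\<eta>\<close>
  times their length; absolute continuity controls the change of \<open>f\<close> over the remaining gaps.
\<close>

lemma ac_zero_derivative_const:
  fixes f :: "real \<Rightarrow> 'v::real_normed_vector"
  assumes ac: "ac_on a b f" and "a \<le> b" and N: "negligible N"
    and deriv: "\<And>x. x \<in> {a<..<b} - N \<Longrightarrow> (f has_vector_derivative 0) (at x)"
  shows "f b = f a"
proof -
  have bound: "norm (f b - f a) \<le> \<eta> * (b - a + 1)" if \<eta>: "\<eta> > 0" for \<eta>
  proof -
    obtain \<delta> where \<delta>: "\<delta> > 0" "\<And>D. nonoverlapping a b D \<Longrightarrow> incr (\<lambda>x. x) D < \<delta> \<Longrightarrow>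
        (\<Sum>I\<in>D. norm (f (snd I) - f (fst I))) < \<eta>"
      by (rule ac_onD[OF ac \<eta>]) blast
    define U where "U = {a<..<b}"
    have U: "open U" "U \<in> lmeasurable" "U - N \<subseteq> U" by (auto simp: U_def)
    have Q: "\<exists>s t. s \<le> x \<and> x \<le> t \<and> s < t \<and> t - s < d \<and> norm (f t - f s) \<le> \<eta> * (t - s)"
      if x: "x \<in> U - N" "0 < d" for x d
    proof -
      have "(f has_derivative (\<lambda>h. 0)) (at x)"
        using deriv[of x] x(1) by (simp add: U_def has_vector_derivative_def)
      then obtain e where e: "e > 0" "\<And>y. norm (y - x) < e \<Longrightarrow> norm (f y - f x - 0) \<le> \<eta> * norm (y - x)"
        unfolding has_derivative_at_alt using \<open>\<eta> > 0\<close> by blast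
      define t where "t = x + min e d / 2"
      have t: "x < t" "t - x < e" "t - x < d" using e(1) x(2) by (auto simp: t_def)
      then have "norm (f t - f x) \<le> \<eta> * (t - x)" using e(2)[of t] by simp
      then show ?thesis using t by (intro exI[of _ x] exI[of _ t]) auto
    qed
    obtain D T where D: "finite D" 
      "\<And>I. I \<in> D \<Longrightarrow>
        fst I < snd I \<and> {fst I..snd I} \<subseteq> U \<and> norm (f (snd I) - f (fst I)) \<le> \<eta> * (snd I - fst I)"
      "pairwise (\<lambda>I J. disjnt {fst I..snd I} {fst J..snd J}) D"
      and T: "T \<in> lmeasurable" "measure lebesgue T < \<delta>" "U - N \<subseteq> (\<Union>I\<in>D. {fst I..snd I}) \<union> T"
      using vitali_finite_family[OF U Q \<delta>(1)] by blast
    have noD: "nonoverlapping a b D"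
      by (rule nonoverlapping_of_disjoint_closed[of D U]) (use D U_def in auto)
    define m where "m = incr (\<lambda>x. x) D"
    have m: "measure lebesgue (\<Union>I\<in>D. {fst I..snd I}) = m"
      unfolding m_def using D by (intro measure_closed_intervals) auto
    have lm: "(\<Union>I\<in>D. {fst I..snd I}) \<in> lmeasurable" using D(1) by (intro fmeasurable.finite_UN) auto
    have Nm: "N \<in> lmeasurable" "measure lebesgue N = 0" using N negligible_iff_measure by blast+
    have "b - a = measure lebesgue U" using \<open>a \<le> b\<close> by (simp add: U_def)
    also have "\<dots> \<le> measure lebesgue ((\<Union>I\<in>D. {fst I..snd I}) \<union> (T \<union> N))"
      using T lm Nm U by (intro measure_mono_fmeasurable) auto
    also have "\<dots> \<le> m + measure lebesgue (T \<union> N)"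
      unfolding m[symmetric] using lm T Nm by (intro measure_Un_le) auto
    also have "measure lebesgue (T \<union> N) \<le> measure lebesgue T + measure lebesgue N"
      using T Nm by (intro measure_Un_le) auto
    finally have m_lower: "b - a < m + \<delta>" using T(2) Nm(2) by linarith
    have "m \<le> measure lebesgue U"
        unfolding m[symmetric]
    proof (rule measure_mono_fmeasurable)
      show "(\<Union>I\<in>D. {fst I..snd I}) \<subseteq> U" using D(2) by blast
    qed (use lm U in auto)
    then have m_upper: "m \<le> b - a" using \<open>a \<le> b\<close> by (simp add: U_def)
    obtain G where G: "nonoverlapping a b G" "incr (\<lambda>x. x) D + incr (\<lambda>x. x) G = b - a"
       "incr f D + incr f G = f b - f a"
      using gaps_exist[OF noD \<open>a \<le> b\<close>, of f] by blast
    have "norm (incr f G) < \<eta>"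
      using \<delta>(2)[OF G(1)] norm_incr_le[of f G] G(2) m_lower unfolding m_def by linarith
    moreover have "norm (incr f D) \<le> \<eta> * m"
    proof -
      have "norm (incr f D) \<le> (\<Sum>I\<in>D. norm (f (snd I) - f (fst I)))" by (rule norm_incr_le)
      also have "\<dots> \<le> \<eta> * m"
        unfolding incr_def m_def sum_distrib_left using D(2) by (intro sum_mono) simp
      finally show ?thesis .
    qed
    moreover have "\<eta> * m \<le> \<eta> * (b - a)" using m_upper that by (intro mult_left_mono) auto
    moreover have "norm (f b - f a) \<le> norm (incr f D) + norm (incr f G)"
      unfolding G(3)[symmetric] by (rule norm_triangle_ineq)
    ultimately show ?thesis by (simp add: algebra_simps)
  qed
  have "norm (f b - f a) \<le> 0"
  proof (rule field_le_epsilon)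
    fix e :: real assume "e > 0"
    have "e / (b - a + 1) > 0" using \<open>e > 0\<close> \<open>a \<le> b\<close> by simp
    from bound[OF this] show "norm (f b - f a) \<le> 0 + e" using \<open>a \<le> b\<close> by simp
  qed
  then show ?thesis by simp
qed

lemma abs_cont_on_iff_ac_on: "abs_cont_on a b f \<longleftrightarrow> ac_on a b f"
  unfolding abs_cont_on_def ac_on_def nonoverlapping_def incr_def
  by (simp add: case_prod_beta conj_assoc cong: conj_cong)

lemma ac_on_subset:
  assumes "ac_on a b f" "a \<le> a'" "b' \<le> b"
  shows "ac_on a' b' f"
  unfolding ac_on_def
proof (intro allI impI)
  fix \<epsilon> :: real assume "\<epsilon> > 0"
  obtain \<delta> where \<delta>: "\<delta> > 0" "\<And>D. nonoverlapping a b D \<Longrightarrow> incr (\<lambda>x. x) D < \<delta> \<Longrightarrow>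
        (\<Sum>I\<in>D. norm (f (snd I) - f (fst I))) < \<epsilon>"
    by (rule ac_onD[OF assms(1) \<open>\<epsilon> > 0\<close>]) blast
  have "nonoverlapping a b D" if "nonoverlapping a' b' D" for D
    using that assms(2,3) unfolding nonoverlapping_def by force
  then show "\<exists>\<delta>>0. \<forall>D. nonoverlapping a' b' D \<and> incr (\<lambda>x. x) D < \<delta> \<longrightarrow>
        (\<Sum>I\<in>D. norm (f (snd I) - f (fst I))) < \<epsilon>"
    using \<delta> by (intro exI[of _ \<delta>]) simp
qed

lemma AC_loc_iff: "f \<in> AC_loc \<longleftrightarrow> (\<forall>R. ac_on 0 R f)"
  unfolding AC_loc_def abs_cont_on_iff_ac_on mem_Collect_eq
proof (intro iffI allI impI)
  fix R assume "\<forall>R>0. ac_on 0 R f"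
  then have "ac_on 0 (\<bar>R\<bar> + 1) f" by simp
  then show "ac_on 0 R f" by (rule ac_on_subset) auto
qed auto

lemma AC_loc_continuous:
  assumes "f \<in> AC_loc"
  shows "continuous_on {0..} f"
  unfolding continuous_on_iff
proof (intro ballI allI impI)
  fix x \<epsilon> :: real assume x: "x \<in> {0..}" and "\<epsilon> > 0"
  have ac: "ac_on 0 (x+1) f" using assms AC_loc_iff by blast
  obtain \<delta> where \<delta>: "\<delta> > 0" "\<And>D. nonoverlapping 0 (x+1) D \<Longrightarrow> incr (\<lambda>x. x) D < \<delta> \<Longrightarrow>
        (\<Sum>I\<in>D. norm (f (snd I) - f (fst I))) < \<epsilon>"
    by (rule ac_onD[OF ac \<open>\<epsilon> > 0\<close>]) blast
  have one: "norm (f t - f s) < \<epsilon>" if "0 \<le> s" "s < t" "t \<le> x + 1" "t - s < \<delta>" for s t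
    using \<delta>(2)[of "{(s,t)}"] that by (simp add: nonoverlapping_def incr_def)
  show "\<exists>d>0. \<forall>x'\<in>{0..}. dist x' x < d \<longrightarrow> dist (f x') (f x) < \<epsilon>"
  proof (intro exI[of _ "min \<delta> 1"] conjI ballI impI)
    show "0 < min \<delta> 1" using \<delta>(1) by simp
    fix y assume y: "y \<in> {0..}" "dist y x < min \<delta> 1"
    consider "y < x" | "y = x" | "x < y" by linarith
    then show "dist (f y) (f x) < \<epsilon>"
    proof cases
      case 1 then show ?thesis using one[of y x] y x by (auto simp: dist_norm norm_minus_commute)
    next
      case 2 then show ?thesis using \<open>\<epsilon> > 0\<close> by simp
    next
      case 3 then show ?thesis using one[of x y] y x by (auto simp: dist_norm)
    qed
  qed
qed

lemma AE_halfline_iff: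
  "(AE x in lebesgue_on {0..}. P x) \<longleftrightarrow> negligible {x::real. 0 \<le> x \<and> \<not> P x}"
proof -
  have "(AE x in lebesgue_on {0::real..}. P x) \<longleftrightarrow> (AE x in lebesgue. x \<in> {0..} \<longrightarrow> P x)"
    by (subst AE_restrict_space_iff) auto
  also have "\<dots> \<longleftrightarrow> negligible {x. 0 \<le> x \<and> \<not> P x}"
    unfolding negligible_iff_null_sets eventually_ae_filter by (auto intro: completion.complete2)
  finally show ?thesis .
qed

lemma continuous_derivative_lipschitz:
  fixes f f' :: "real \<Rightarrow> 'v::real_normed_vector"
  assumes d: "\<And>x. x \<in> {a..b} \<Longrightarrow> (f has_vector_derivative f' x) (at x within {a..b})"
    and c: "continuous_on {a..b} f'"
  obtains L where "\<And>s t. a \<le> s \<Longrightarrow> s < t \<Longrightarrow> t \<le> b \<Longrightarrow> norm (f t - f s) \<le> L * (t - s)"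
proof -
  have "bounded (f' ` {a..b})" using c by (intro compact_imp_bounded compact_continuous_image) auto
  then obtain L where "\<forall>z\<in>f' ` {a..b}. norm z \<le> L" unfolding bounded_iff by blast
  then have L: "\<And>y. y \<in> {a..b} \<Longrightarrow> norm (f' y) \<le> L" by blast
  have "norm (f t - f s) \<le> L * (t - s)" if "a \<le> s" "s < t" "t \<le> b" for s t
  proof -
    have "norm (f t - f s) \<le> L * norm (t - s)"
    proof (rule differentiable_bound[of "{a..b}" f "\<lambda>y h. h *\<^sub>R f' y"])
      show "(f has_derivative (\<lambda>h. h *\<^sub>R f' y)) (at y within {a..b})" if "y \<in> {a..b}" for y
        using d[OF that] by (simp add: has_vector_derivative_def)
      show "onorm (\<lambda>h. h *\<^sub>R f' y) \<le> L" if "y \<in> {a..b}" for y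
        using L[OF that] by (intro onorm_le) (simp add: mult.commute[of L] mult_left_mono)
    qed (use that in auto)
    then show ?thesis using that by simp
  qed
  then show thesis by (rule that)
qed

text \<open>
  \<open>C\<^sup>1\<close> functions are Lipschitz on compact intervals.
\<close>

lemma AC_loc_of_derivative:
  assumes d: "\<And>x. 0 \<le> x \<Longrightarrow> (f has_vector_derivative f' x) (at x within {0..})"
    and c: "continuous_on {0..} f'"
  shows "f \<in> AC_loc"
  unfolding AC_loc_iff
proof
  fix R :: real
  have dR: "(f has_vector_derivative f' x) (at x within {0..R})" if "x \<in> {0..R}" for x
    using d[of x] that by (auto intro: has_vector_derivative_within_subset)
  have cR: "continuous_on {0..R} f'" using c by (rule continuous_on_subset) auto
  obtain L where L: "\<And>s t. 0 \<le> s \<Longrightarrow> s < t \<Longrightarrow> t \<le> R \<Longrightarrow> norm (f t - f s) \<le> L * (t - s)"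
    by (rule continuous_derivative_lipschitz[OF dR cR]) (assumption, rule that)
  have "ac_on 0 R (\<lambda>_. 0 :: real)" by (auto simp: ac_on_def intro: exI[of _ 1])
  then show "ac_on 0 R f" by (rule ac_on_norm_le[of _ _ _ _ L]) (use L in auto)
qed

lemma at_halfline_neq_bot:
  assumes "0 \<le> (x::real)"
  shows "at x within {0..} \<noteq> bot"
proof -
  have "at_right x \<le> at x within {0..}" using assms by (intro at_le) auto
  then show ?thesis using trivial_limit_at_right_real[of x] by (metis bot.extremum_uniqueI)
qed

text \<open>
  The derivative in \<open>hderiv\<close> is arbitrary where it does not exist, so a hypothesis about it is
  informative only because \<open>f\<close> is differentiable almost everywhere. Then \<open>f\<close> minus the integral of
  \<open>g\<close> is absolutely continuous with derivative zero almost everywhere, hence constant.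
\<close>

lemma AC_loc_has_derivative:
  fixes f g :: "real \<Rightarrow> complex"
  assumes f: "f \<in> AC_loc" and g: "continuous_on {0..} g"
    and ae: "AE x in lebesgue_on {0..}. hderiv f x = g x" and "0 \<le> x"
  shows "(f has_vector_derivative g x) (at x within {0..})"
proof -
  define P where "P x = integral {0..x} g" for x
  have gc: "continuous_on {0..R} g" for R using g by (rule continuous_on_subset) auto
  have P: "(P has_vector_derivative g y) (at y within {0..R})" if "0 \<le> y" "y \<le> R" for y R
    unfolding P_def using integral_has_vector_derivative[OF gc] that by simp
  define N1 where "N1 = {x. 0 \<le> x \<and> hderiv f x \<noteq> g x}"
  have N1: "negligible N1" using ae unfolding AE_halfline_iff N1_def .
  have const: "f R - P R = f 0" if R: "0 \<le> R" for R
  proof -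
    have fR: "ac_on 0 R f" using f AC_loc_iff by blast
    have Re: "ac_on 0 R (\<lambda>x. Re (f x))"
      by (rule ac_on_norm_le[OF fR, of _ 0]) (use abs_Re_le_cmod in \<open>simp flip: minus_complex.sel\<close>)
    have Im: "ac_on 0 R (\<lambda>x. Im (f x))"
      by (rule ac_on_norm_le[OF fR, of _ 0]) (use abs_Im_le_cmod in \<open>simp flip: minus_complex.sel\<close>)
    define N where "N = N1 \<union> ({x\<in>{0<..<R}. \<not> (\<lambda>x. Re (f x)) differentiable (at x)} \<union>
        {x\<in>{0<..<R}. \<not> (\<lambda>x. Im (f x)) differentiable (at x)})"
    have N: "negligible N" unfolding N_def
      using N1 ac_differentiable_ae[OF Re] ac_differentiable_ae[OF Im] by simp
    obtain L where L: "\<And>s t. 0 \<le> s \<Longrightarrow> s < t \<Longrightarrow> t \<le> R \<Longrightarrow> norm (P t - P s) \<le> L * (t - s)"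
      by (rule continuous_derivative_lipschitz[of 0 R P g]) (use P gc in auto)
    have ach: "ac_on 0 R (\<lambda>x. f x - P x)"
    proof (rule ac_on_norm_le[OF fR, of _ L])
      fix s t :: real assume st: "0 \<le> s" "s < t" "t \<le> R"
      have "norm ((f t - P t) - (f s - P s)) = norm ((f t - f s) - (P t - P s))"
        by (simp add: algebra_simps)
      also have "\<dots> \<le> norm (f t - f s) + norm (P t - P s)" by (rule norm_triangle_ineq4)
      finally show "norm ((f t - P t) - (f s - P s)) \<le> norm (f t - f s) + L * (t - s)"
        using L[OF st] by linarith
    qed
    have "f R - P R = f 0 - P 0"
    proof (rule ac_zero_derivative_const[OF ach R N])
      fix x assume x: "x \<in> {0<..<R} - N"
      then have "(\<lambda>x. Re (f x)) differentiable (at x)" "(\<lambda>x. Im (f x)) differentiable (at x)"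
        by (auto simp: N_def)
      then obtain u v where uv: "((\<lambda>x. Re (f x)) has_real_derivative u) (at x)"
        "((\<lambda>x. Im (f x)) has_real_derivative v) (at x)"
        using real_differentiable_def by blast
      have "((\<lambda>x. Complex (Re (f x)) (Im (f x))) has_vector_derivative Complex u v) (at x)"
        using uv by (simp add: has_vector_derivative_complex_iff has_real_derivative_iff_has_vector_derivative)
      then have fd: "(f has_vector_derivative Complex u v) (at x)" by simp
      have "hderiv f x = Complex u v"
        unfolding hderiv_def
      proof (rule vector_derivative_within)
        show "at x within {0..} \<noteq> bot" using x by (intro at_halfline_neq_bot) auto
        show "(f has_vector_derivative Complex u v) (at x within {0..})"
          using fd by (rule has_vector_derivative_at_within)
      qed
      moreover have "hderiv f x = g x" using x by (auto simp: N_def N1_def)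
      ultimately have fg: "(f has_vector_derivative g x) (at x)" using fd by simp
      have "(P has_vector_derivative g x) (at x within {0..R})" using P x by simp
      then have "(P has_vector_derivative g x) (at x)"
        using x by (simp add: at_within_Icc_at)
      from has_vector_derivative_diff[OF fg this]
      show "((\<lambda>x. f x - P x) has_vector_derivative 0) (at x)" by simp
    qed
    then show ?thesis by (simp add: P_def)
  qed
  have eq: "f y = f 0 + P y" if "0 \<le> y" for y using const[OF that] by (simp add: algebra_simps)
  have "(P has_vector_derivative g x) (at x within {0..x+1})" using P \<open>0 \<le> x\<close> by simp
  moreover have "at x within {0..x+1} = at x within {0..}"
    by (rule at_within_nhd[of x "{..<x+1}"]) auto
  ultimately have "(P has_vector_derivative g x) (at x within {0..})" by simp
  from has_vector_derivative_add[OF has_vector_derivative_const[of "f 0"] this]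
  have D: "((\<lambda>y. f 0 + P y) has_vector_derivative g x) (at x within {0..})"
    unfolding add_0_left .
  show ?thesis
  proof (rule has_vector_derivative_transform[OF _ _ D])
    show "x \<in> {0..}" using \<open>0 \<le> x\<close> by simp
    show "f y = f 0 + P y" if "y \<in> {0..}" for y using that by (intro eq) simp
  qed
qed

section \<open>The Airy series\<close>

text \<open>
  The Taylor coefficients at \<open>0\<close>, up to factorials, of the solution of \<open>y'' + y' + y = 0\<close> with
  \<open>y(0) = 1\<close> and \<open>y'(0) = -1\<close>.
\<close>

definition airy_sign :: "nat \<Rightarrow> real" where
  "airy_sign n = (if n mod 3 = 0 then 1 else if n mod 3 = 1 then -1 else 0)"

text \<open>
  The value of \<open>\<integral> t\<^sup>n exp(-t\<^sup>3/3) dt\<close> over the positive half-line.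
\<close>

definition airy_moment :: "nat \<Rightarrow> real" where
  "airy_moment n = 3 powr ((real n - 2) / 3) * Gamma ((real n + 1) / 3)"

text \<open>
  The Taylor coefficients of \<open>Ai\<close>, written so that \<open>\<Gamma>(1/3) \<Gamma>(2/3) Ai(x) = \<integral> y(x t) exp(-t\<^sup>3/3) dt\<close>
  holds term by term, where \<open>y\<close> is the function with Taylor coefficients \<open>airy_sign n / n!\<close>.
\<close>

definition airy_coeff :: "nat \<Rightarrow> real" where
  "airy_coeff n = airy_sign n * airy_moment n / (fact n * (Gamma (1/3) * Gamma (2/3)))"

lemma abs_airy_sign_le: "\<bar>airy_sign n\<bar> \<le> 1"
  by (simp add: airy_sign_def)

lemma airy_sign_sum: "airy_sign n + airy_sign (Suc n) + airy_sign (Suc (Suc n)) = 0"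
proof -
  consider "n mod 3 = 0" | "n mod 3 = 1" | "n mod 3 = 2" by fastforce
  then show ?thesis by cases (simp_all add: airy_sign_def mod_Suc)
qed

lemma airy_sign_period: "airy_sign (n + 3) = airy_sign n"
  by (simp add: airy_sign_def)

lemma airy_moment_pos: "0 < airy_moment n"
  unfolding airy_moment_def by (intro mult_pos_pos Gamma_real_pos) auto

lemma airy_moment_rec: "airy_moment (n + 3) = (real n + 1) * airy_moment n"
proof -
  have nz: "(real n + 1) / 3 \<notin> \<int>\<^sub>\<le>\<^sub>0"
    by (auto elim!: nonpos_Ints_cases simp: field_simps dest: arg_cong[of _ _ "\<lambda>x. x > 0"])
  have "(real (n + 3) - 2) / 3 = (real n - 2) / 3 + 1" "(real (n + 3) + 1) / 3 = (real n + 1) / 3 + 1"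
    by (simp_all add: field_simps)
  then show ?thesis unfolding airy_moment_def by (simp only: powr_add Gamma_plus1[OF nz]) simp
qed

text \<open>
  The differential equation \<open>Ai'' = x Ai\<close> on the level of coefficients.
\<close>

lemma airy_coeff_rec: "airy_coeff (n + 3) * (real n + 2) * (real n + 3) = airy_coeff n"
proof -
  have f: "fact (n + 3) = (real n + 3) * (real n + 2) * (real n + 1) * (fact n :: real)"
    by (simp add: eval_nat_numeral algebra_simps)
  have g: "Gamma (1/3) * Gamma (2/3) > (0::real)" by (intro mult_pos_pos Gamma_real_pos) auto
  have "airy_coeff (n + 3) = airy_sign n * ((real n + 1) * airy_moment n) /
     ((real n + 3) * (real n + 2) * (real n + 1) * fact n * (Gamma (1/3) * Gamma (2/3)))"
    unfolding airy_coeff_def airy_sign_period airy_moment_rec f ..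
  also have "\<dots> = airy_coeff n / ((real n + 3) * (real n + 2))"
    unfolding airy_coeff_def using g by (simp add: divide_simps) 
  finally have eq: "airy_coeff (n + 3) = airy_coeff n / ((real n + 3) * (real n + 2))" .
  define p where "p = (real n + 3) * (real n + 2)"
  have "p \<noteq> 0" unfolding p_def by (intro no_zero_divisors) linarith+
  then have "airy_coeff (n + 3) * p = airy_coeff n" using eq by (simp add: p_def)
  then show ?thesis by (simp add: p_def mult_ac)
qed

text \<open>
  Together with \<open>pochhammer_fact_bound2\<close> this dominates the two series in the definition of \<open>Ai\<close>
  by the exponential series at \<open>|x|\<^sup>3\<close>, the second one up to the factor \<open>|x|\<close>.
\<close>

lemma pochhammer_fact_bound1: "3 ^ k * pochhammer (1/3) k * fact k \<le> (fact (3 * k) :: real)"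
proof (induction k)
  case (Suc k)
  have "3 ^ Suc k * pochhammer (1/3) (Suc k) * fact (Suc k) =
      (3 ^ k * pochhammer (1/3) k * fact k) * ((3 * real k + 1) * (real k + 1))"
    by (simp add: pochhammer_Suc algebra_simps)
  also have "\<dots> \<le> fact (3 * k) * ((3 * real k + 1) * ((3 * real k + 2) * (3 * real k + 3)))"
    by (intro mult_mono Suc.IH) (auto simp: algebra_simps)
  also have "\<dots> = fact (3 * Suc k)" by (simp add: eval_nat_numeral algebra_simps)
  finally show ?case .
qed simp

lemma pochhammer_fact_bound2: "3 ^ k * pochhammer (2/3) k * fact k \<le> (fact (3 * k + 1) :: real)"
proof (induction k)
  case (Suc k)
  have "3 ^ Suc k * pochhammer (2/3) (Suc k) * fact (Suc k) =
      (3 ^ k * pochhammer (2/3) k * fact k) * ((3 * real k + 2) * (real k + 1))"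
    by (simp add: pochhammer_Suc algebra_simps)
  also have "\<dots> \<le> fact (3 * k + 1) * ((3 * real k + 2) * ((3 * real k + 3) * (3 * real k + 4)))"
    by (intro mult_mono Suc.IH) (auto simp: algebra_simps)
  also have "\<dots> = fact (3 * Suc k + 1)" by (simp add: eval_nat_numeral algebra_simps)
  finally show ?case .
qed simp

lemma summable_cubic_series:
  fixes x :: real
  assumes "\<And>k. 0 \<le> c k" "\<And>k. c k * fact k \<le> fact (m k)"
  shows "summable (\<lambda>k. c k / fact (m k) * x ^ (3 * k))"
proof (rule summable_comparison_test')
  show "summable (\<lambda>k. (\<bar>x\<bar> ^ 3) ^ k /\<^sub>R fact k)" by (rule summable_exp_generic)
  fix k
  have "c k / fact (m k) \<le> 1 / fact k" using assms(2)[of k] by (simp add: field_simps)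
  then have "c k / fact (m k) * \<bar>x\<bar> ^ (3 * k) \<le> 1 / fact k * \<bar>x\<bar> ^ (3 * k)"
    by (intro mult_right_mono) auto
  also have "\<dots> = (\<bar>x\<bar> ^ 3) ^ k /\<^sub>R fact k" by (simp add: power_mult divide_inverse)
  finally show "norm (c k / fact (m k) * x ^ (3 * k)) \<le> (\<bar>x\<bar> ^ 3) ^ k /\<^sub>R fact k"
    using assms(1)[of k] by (simp add: abs_mult power_abs)
qed

lemma summable_Ai1: "summable (\<lambda>k. (3 ^ k * pochhammer (1/3) k / fact (3 * k)) * (x::real) ^ (3 * k))"
proof (rule summable_cubic_series)
  show "0 \<le> 3 ^ k * pochhammer (1/3::real) k" for k
    using pochhammer_pos[of "1/3::real" k] by simp
qed (rule pochhammer_fact_bound1)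

lemma summable_Ai2: "summable (\<lambda>k. (3 ^ k * pochhammer (2/3) k / fact (3 * k + 1)) * (x::real) ^ (3 * k + 1))"
proof -
  have "summable (\<lambda>k. (3 ^ k * pochhammer (2/3) k / fact (3 * k + 1)) * x ^ (3 * k))"
  proof (rule summable_cubic_series)
    show "0 \<le> 3 ^ k * pochhammer (2/3::real) k" for k
      using pochhammer_pos[of "2/3::real" k] by simp
  qed (rule pochhammer_fact_bound2)
  from summable_mult2[OF this, of x] show ?thesis by (simp add: mult_ac)
qed

lemma airy_coeff_3k:
  "airy_coeff (3 * k) = 3 powr (-2/3) / Gamma (2/3) * (3 ^ k * pochhammer (1/3) k / fact (3 * k))"
proof -
  have nz: "(1/3::real) \<notin> \<int>\<^sub>\<le>\<^sub>0" by (auto elim!: nonpos_Ints_cases)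
  have "(0::real) < Gamma (1/3)" by (intro Gamma_real_pos) simp
  then have g: "Gamma (1/3) \<noteq> (0::real)" by (rule less_imp_neq[THEN not_sym])
  have e: "(real (3 * k) - 2) / 3 = real k + (-2/3)" "(real (3 * k) + 1) / 3 = 1/3 + real k" by simp_all
  have "airy_moment (3 * k) = 3 ^ k * 3 powr (-2/3) * (pochhammer (1/3) k * Gamma (1/3))"
    unfolding airy_moment_def e powr_add pochhammer_Gamma[OF nz] using g by (simp add: powr_realpow)
  then show ?thesis using g by (simp add: airy_coeff_def airy_sign_def mult_ac)
qed

lemma airy_coeff_3k1:
  "airy_coeff (3 * k + 1) =
    - (3 powr (-1/3) / Gamma (1/3) * (3 ^ k * pochhammer (2/3) k / fact (3 * k + 1)))"
proof -
  have nz: "(2/3::real) \<notin> \<int>\<^sub>\<le>\<^sub>0" by (auto elim!: nonpos_Ints_cases)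
  have "(0::real) < Gamma (2/3)" by (intro Gamma_real_pos) simp
  then have g: "Gamma (2/3) \<noteq> (0::real)" by (rule less_imp_neq[THEN not_sym])
  have e: "(real (3 * k + 1) - 2) / 3 = real k + (-1/3)" "(real (3 * k + 1) + 1) / 3 = 2/3 + real k"
    by (simp_all add: field_simps)
  have "airy_moment (3 * k + 1) = 3 ^ k * 3 powr (-1/3) * (pochhammer (2/3) k * Gamma (2/3))"
    unfolding airy_moment_def e powr_add pochhammer_Gamma[OF nz] using g by (simp add: powr_realpow)
  moreover have "airy_sign (3 * k + 1) = -1" by (simp add: airy_sign_def mod_Suc)
  ultimately show ?thesis using g by (simp add: airy_coeff_def mult_ac)
qed

text \<open>
  The two defining series occupy the residue classes \<open>0\<close> and \<open>1\<close> modulo \<open>3\<close> of a single power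
  series; the class \<open>2\<close> is empty.
\<close>

lemma Ai_sums: "(\<lambda>n. airy_coeff n * x ^ n) sums (Ai x :: real)"
proof -
  define f0 where "f0 n = (if n mod 3 = 0 then airy_coeff n * x ^ n else 0)" for n
  define f1 where "f1 n = (if n mod 3 = 1 then airy_coeff n * x ^ n else 0)" for n
  define S0 where "S0 = (\<Sum>k. (3 ^ k * pochhammer (1/3) k / fact (3 * k)) * x ^ (3 * k))"
  define S1 where "S1 = (\<Sum>k. (3 ^ k * pochhammer (2/3) k / fact (3 * k + 1)) * x ^ (3 * k + 1))"
  have Ai: "Ai x = 3 powr (-2/3) / Gamma (2/3) * S0 - 3 powr (-1/3) / Gamma (1/3) * S1"
    unfolding Ai_def S0_def S1_def by simp
  have "(\<lambda>k. f0 (3 * k)) sums (3 powr (-2/3) / Gamma (2/3) * S0)"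
    using sums_mult[OF summable_sums[OF summable_Ai1[of x]], of "3 powr (-2/3) / Gamma (2/3)"]
    unfolding S0_def f0_def airy_coeff_3k by (simp add: mult.assoc)
  then have f0: "f0 sums (3 powr (-2/3) / Gamma (2/3) * S0)"
    by (subst (asm) sums_mono_reindex) (auto simp: f0_def strict_mono_def elim!: dvdE)
  have m1: "(3 * k + 1) mod 3 = 1" for k :: nat by (simp add: mod_Suc)
  have "(\<lambda>k. f1 (3 * k + 1)) sums (- (3 powr (-1/3) / Gamma (1/3)) * S1)"
    using sums_mult[OF summable_sums[OF summable_Ai2[of x]], of "- (3 powr (-1/3) / Gamma (1/3))"]
    unfolding S1_def f1_def airy_coeff_3k1 m1 by (simp add: mult.assoc)
  then have f1: "f1 sums (- (3 powr (-1/3) / Gamma (1/3)) * S1)"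
  proof (subst (asm) sums_mono_reindex)
    fix n assume n: "n \<notin> range (\<lambda>k::nat. 3 * k + 1)"
    have "n mod 3 \<noteq> 1"
    proof
      assume "n mod 3 = 1"
      then have "n = 3 * (n div 3) + 1" by presburger
      with n show False by blast
    qed
    then show "f1 n = 0" by (simp add: f1_def)
  qed (auto simp: strict_mono_def)
  have "f0 n + f1 n = airy_coeff n * x ^ n" for n
  proof -
    consider "n mod 3 = 0" | "n mod 3 = 1" | "n mod 3 = 2" by fastforce
    then show ?thesis by cases (simp_all add: f0_def f1_def airy_coeff_def airy_sign_def)
  qed
  then show ?thesis using sums_add[OF f0 f1] by (simp add: Ai)
qed

lemma Ai_of_real: "Ai (of_real x) = (of_real (Ai x) :: complex)"
proof -
  have "of_real (\<Sum>k. (3 ^ k * pochhammer (1/3) k / fact (3 * k)) * x ^ (3 * k)) =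
      (\<Sum>k. complex_of_real (3 ^ k * pochhammer (1/3) k / fact (3 * k)) * of_real x ^ (3 * k))"
    using suminf_of_real[OF summable_Ai1[of x]] by (simp only: of_real_mult of_real_power)
  moreover have "of_real (\<Sum>k. (3 ^ k * pochhammer (2/3) k / fact (3 * k + 1)) * x ^ (3 * k + 1)) =
      (\<Sum>k. complex_of_real (3 ^ k * pochhammer (2/3) k / fact (3 * k + 1)) * of_real x ^ (3 * k + 1))"
    using suminf_of_real[OF summable_Ai2[of x]] by (simp only: of_real_mult of_real_power)
  ultimately show ?thesis unfolding Ai_def by simp
qed

text \<open>
  The derivative of \<open>Ai\<close>, see \<open>deriv_Ai\<close>.
\<close>

definition Ai' :: "real \<Rightarrow> real" where "Ai' x = (\<Sum>n. diffs airy_coeff n * x ^ n)"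

lemma Ai_eq_suminf: "Ai = (\<lambda>x::real. \<Sum>n. airy_coeff n * x ^ n)"
  using Ai_sums by (auto simp: sums_iff)

lemma summable_airy: "summable (\<lambda>n. airy_coeff n * (x::real) ^ n)"
  using Ai_sums sums_summable by blast

lemma Ai_deriv: "(Ai has_real_derivative Ai' x) (at x)"
  unfolding Ai_eq_suminf Ai'_def by (rule termdiffs_strong_converges_everywhere[OF summable_airy])

lemma deriv_Ai: "deriv Ai x = Ai' x"
  by (rule DERIV_imp_deriv[OF Ai_deriv])

lemma Ai'_deriv: "(Ai' has_real_derivative x * Ai x) (at x)"
proof -
  have s: "summable (\<lambda>n. diffs airy_coeff n * y ^ n)" for y
    by (rule termdiff_converges_all[OF summable_airy])
  have s2: "summable (\<lambda>n. diffs (diffs airy_coeff) n * y ^ n)" for y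
    by (rule termdiff_converges_all[OF s])
  have d0: "diffs (diffs airy_coeff) 0 = 0"
    by (simp add: diffs_def airy_coeff_def airy_sign_def)
  have dS: "diffs (diffs airy_coeff) (Suc n) = airy_coeff n" for n
    using airy_coeff_rec[of n] by (simp add: diffs_def eval_nat_numeral algebra_simps)
  have "(Ai' has_real_derivative (\<Sum>n. diffs (diffs airy_coeff) n * x ^ n)) (at x)"
    unfolding Ai'_def[abs_def] by (rule termdiffs_strong_converges_everywhere[OF s])
  also have "(\<Sum>n. diffs (diffs airy_coeff) n * x ^ n) = Ai x * x"
    unfolding powser_split_head(1)[OF s2] d0 dS Ai_eq_suminf by simp
  finally show ?thesis by (simp add: mult.commute)
qed

section \<open>Boundedness of the Airy function on the positive half-line\<close>

text \<open>
  The \<open>j\<close>-th derivative of the solution of \<open>y'' + y' + y = 0\<close> with \<open>y(0) = 1\<close> and \<open>y'(0) = -1\<close>.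
\<close>

definition airy_kernel :: "nat \<Rightarrow> real \<Rightarrow> real" where
  "airy_kernel j s = (\<Sum>n. airy_sign (n + j) / fact n * s ^ n)"

lemma summable_airy_kernel: "summable (\<lambda>n. airy_sign (n + j) / fact n * (s::real) ^ n)"
proof (rule summable_comparison_test')
  show "summable (\<lambda>n. \<bar>s\<bar> ^ n /\<^sub>R fact n)" by (rule summable_exp_generic)
  fix n
  have "\<bar>airy_sign (n + j)\<bar> * (\<bar>s\<bar> ^ n / fact n) \<le> 1 * (\<bar>s\<bar> ^ n / fact n)"
    by (intro mult_right_mono abs_airy_sign_le) auto
  then show "norm (airy_sign (n + j) / fact n * s ^ n) \<le> \<bar>s\<bar> ^ n /\<^sub>R fact n"
    by (simp add: abs_mult power_abs divide_inverse mult_ac)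
qed

lemma airy_kernel_deriv: "(airy_kernel j has_real_derivative airy_kernel (Suc j) s) (at s)"
proof -
  have "diffs (\<lambda>n. airy_sign (n + j) / fact n) = (\<lambda>n. airy_sign (n + Suc j) / fact n)"
    by (rule ext) (simp add: diffs_def fact_Suc divide_simps del: of_nat_Suc)
  then show ?thesis
    using termdiffs_strong_converges_everywhere[OF summable_airy_kernel[of j], of s]
    by (simp add: airy_kernel_def[abs_def])
qed

lemma airy_kernel_sum: "airy_kernel j s + airy_kernel (Suc j) s + airy_kernel (Suc (Suc j)) s = 0"
proof -
  have "(\<lambda>n. airy_sign (n + j) / fact n * s ^ n + airy_sign (n + Suc j) / fact n * s ^ n
        + airy_sign (n + Suc (Suc j)) / fact n * s ^ n) sums
     (airy_kernel j s + airy_kernel (Suc j) s + airy_kernel (Suc (Suc j)) s)"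
    unfolding airy_kernel_def by (intro sums_add summable_sums summable_airy_kernel)
  moreover have "airy_sign (n + j) / fact n * s ^ n + airy_sign (n + Suc j) / fact n * s ^ n
        + airy_sign (n + Suc (Suc j)) / fact n * s ^ n =
      (airy_sign (n + j) + airy_sign (Suc (n + j)) + airy_sign (Suc (Suc (n + j)))) * (s ^ n / fact n)" for n
    by (simp add: algebra_simps)
  ultimately show ?thesis by (simp add: airy_sign_sum sums_iff)
qed

lemma airy_kernel_0: "airy_kernel j 0 = airy_sign j"
  unfolding airy_kernel_def by (subst powser_zero) simp

text \<open>
  The quadratic form \<open>E = y'\<^sup>2 + y y' + y\<^sup>2\<close> is a Lyapunov function: \<open>y'' + y' + y = 0\<close> implies
  \<open>E' = -E\<close>.
\<close>

lemma abs_airy_kernel_le: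
  assumes "0 \<le> s"
  shows "\<bar>airy_kernel 0 s\<bar> \<le> 2"
proof -
  define y z where "y = airy_kernel 0" and "z = airy_kernel 1"
  have dy: "(y has_real_derivative z x) (at x)" for x
    using airy_kernel_deriv[of 0 x] by (simp add: y_def z_def)
  have dz: "(z has_real_derivative - y x - z x) (at x)" for x
  proof -
    have "airy_kernel (Suc (Suc 0)) x = - y x - z x"
      using airy_kernel_sum[of 0 x] by (simp add: y_def z_def)
    then show ?thesis using airy_kernel_deriv[of 1 x] by (simp add: z_def)
  qed
  define E where "E x = (z x)\<^sup>2 + y x * z x + (y x)\<^sup>2" for x
  have E: "E x = (z x + y x / 2)\<^sup>2 + 3/4 * (y x)\<^sup>2" for x
    by (simp add: E_def algebra_simps power2_eq_square)
  then have E_nonneg: "E x \<ge> 0" for x by simp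
  have "E s \<le> E 0"
  proof (rule DERIV_nonpos_imp_nonincreasing[OF assms])
    fix x :: real
    have "(E has_real_derivative - E x) (at x)"
      unfolding E_def[abs_def]
      by (auto intro!: derivative_eq_intros dy dz simp: algebra_simps power2_eq_square)
    then show "\<exists>y. (E has_real_derivative y) (at x) \<and> y \<le> 0"
      using E_nonneg[of x] by (intro exI[of _ "- E x"]) simp
  qed
  moreover have "E 0 = 1" by (simp add: E_def y_def z_def airy_kernel_0 airy_sign_def)
  ultimately have "3/4 * (y s)\<^sup>2 \<le> 1" using E[of s] zero_le_power2[of "z s + y s / 2"] by linarith
  then have "(y s)\<^sup>2 \<le> 2\<^sup>2" by simp
  then show ?thesis using abs_le_square_iff[of "y s" 2] by (simp add: y_def)
qed

text \<open>
  The integral representation \<open>\<Gamma>(1/3) \<Gamma>(2/3) Ai(x) = \<integral> y(x t) exp(-t\<^sup>3/3) dt\<close> with the bounded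
  kernel \<open>y = airy_kernel 0\<close>. This is where the Gamma factors in the definition of \<open>Ai\<close> matter:
  any other ratio of the two coefficients would add a multiple of a solution that grows. The proof
  uses the variable \<open>u = t\<^sup>3/3\<close>, so that the moments are Gamma integrals.
\<close>

lemma Ai_bounded_halfline: "\<exists>C. \<forall>x\<ge>0. \<bar>Ai x :: real\<bar> \<le> C"
proof -
  define M where "M = (lebesgue_on {0::real..})"
  \<comment> \<open>with \<open>t = (3 u)\<^sup>1\<^sup>/\<^sup>3\<close> one has \<open>dt = w(u) exp(u) du\<close>, so \<open>w(u) du\<close> is \<open>exp(-t\<^sup>3/3) dt\<close>\<close>
  define w where "w u = 3 powr (-2/3) * (u powr (1/3 - 1) / exp u)" for u :: real
  define t where "t u = (3 * u) powr (1/3)" for u :: real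
  define G where "G = Gamma (1/3) * Gamma (2/3 :: real)"
  have G: "G > 0" unfolding G_def by (intro mult_pos_pos Gamma_real_pos) auto
  have gam: "integrable M (\<lambda>u. u powr (a - 1) / exp u)" "integral\<^sup>L M (\<lambda>u. u powr (a - 1) / exp u) =
    Gamma a"
    if "a > 0" for a :: real
  proof -
    have hi: "((\<lambda>u. u powr (a - 1) / exp u) has_integral Gamma a) {0..}"
      by (rule Gamma_integral_real[OF that])
    then have "(\<lambda>u. u powr (a - 1) / exp u) absolutely_integrable_on {0..}"
      by (intro nonnegative_absolutely_integrable_1) auto
    then show i: "integrable M (\<lambda>u. u powr (a - 1) / exp u)"
      unfolding M_def by (rule absolutely_integrable_imp_integrable) simp
    show "integral\<^sup>L M (\<lambda>u. u powr (a - 1) / exp u) = Gamma a"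
      using lebesgue_integral_eq_integral[OF i[unfolded M_def]] hi unfolding M_def
      by (simp add: integral_unique)
  qed
  have tw: "t u ^ n * w u = 3 powr ((real n - 2) / 3) * (u powr ((real n + 1) / 3 - 1) / exp u)"
    if "0 \<le> u" for u n
  proof (cases "u = 0")
    case False
    then have u: "u > 0" using that by simp
    have "t u ^ n = (3 * u) powr (real n / 3)"
      unfolding t_def using u by (simp add: powr_powr flip: powr_realpow)
    then have "t u ^ n * w u =
      (3 powr (real n / 3) * 3 powr (-2/3)) * ((u powr (real n / 3) * u powr (1/3 - 1)) / exp u)"
      unfolding w_def using u by (simp add: powr_mult)
    also have "\<dots> = 3 powr (real n / 3 + -2/3) * (u powr (real n / 3 + (1/3 - 1)) / exp u)"
      by (simp only: powr_add)
    also have "real n / 3 + -2/3 = (real n - 2) / 3" by (simp add: field_simps)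
    also have "real n / 3 + (1/3 - 1) = (real n + 1) / 3 - 1" by (simp add: field_simps)
    finally show ?thesis .
  qed (simp add: w_def)
  have tw_int: "integrable M (\<lambda>u. t u ^ n * w u)" and tw_val: "integral\<^sup>L M (\<lambda>u. t u ^ n * w u) =
    airy_moment n" for n
  proof -
    have eq: "integrable M (\<lambda>u. t u ^ n * w u) \<longleftrightarrow>
      integrable M (\<lambda>u. 3 powr ((real n - 2) / 3) * (u powr ((real n + 1) / 3 - 1) / exp u))"
      by (intro Bochner_Integration.integrable_cong) (auto simp: M_def tw)
    show "integrable M (\<lambda>u. t u ^ n * w u)"
      unfolding eq by (intro integrable_mult_right gam(1)) simp
    have "integral\<^sup>L M (\<lambda>u. t u ^ n * w u) =
      integral\<^sup>L M (\<lambda>u. 3 powr ((real n - 2) / 3) * (u powr ((real n + 1) / 3 - 1) / exp u))"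
      by (intro Bochner_Integration.integral_cong) (auto simp: M_def tw)
    also have "\<dots> = airy_moment n"
      unfolding integral_mult_right_zero airy_moment_def by (subst gam(2)) auto
    finally show "integral\<^sup>L M (\<lambda>u. t u ^ n * w u) = airy_moment n" .
  qed
  have t0: "0 \<le> t u" and w0: "0 \<le> w u" for u by (auto simp: t_def w_def)
  have w_int: "integrable M w" "integral\<^sup>L M w = airy_moment 0" using tw_int[of 0] tw_val[of 0]
    by simp_all
  have "\<bar>Ai x\<bar> \<le> 2 * airy_moment 0 / G" if x: "0 \<le> x" for x :: real
  proof -
    define f where "f n u = airy_sign n / fact n * x ^ n * (t u ^ n * w u)" for n u
    have f_int: "integrable M (f n)" for n unfolding f_def using tw_int by simp
    have f_val: "integral\<^sup>L M (f n) = G * (airy_coeff n * x ^ n)" for n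
      unfolding f_def airy_coeff_def G_def[symmetric] using tw_val[of n] G by simp
    have nf: "norm (f n u) = \<bar>airy_sign n\<bar> / fact n * x ^ n * (t u ^ n * w u)" for n u
      unfolding f_def using t0[of u] w0[of u] x by (simp add: abs_mult)
    have nf_val: "integral\<^sup>L M (\<lambda>u. norm (f n u)) = G * norm (airy_coeff n * x ^ n)" for n
    proof -
      have "integral\<^sup>L M (\<lambda>u. norm (f n u)) = \<bar>airy_sign n\<bar> / fact n * x ^ n * airy_moment n"
        unfolding nf using tw_val[of n] by simp
      also have "\<dots> = G * norm (airy_coeff n * x ^ n)"
        using G x airy_moment_pos[of n] unfolding airy_coeff_def G_def[symmetric]
          by (simp add: abs_mult)
      finally show ?thesis .
    qed
    have fk: "f n u = (airy_sign (n + 0) / fact n * (x * t u) ^ n) * w u" for n u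
      by (simp add: f_def power_mult_distrib)
    have sumf: "(\<lambda>n. f n u) sums (airy_kernel 0 (x * t u) * w u)" for u
      unfolding fk airy_kernel_def by (intro sums_mult2 summable_sums summable_airy_kernel)
    have s1: "AE u in M. summable (\<lambda>n. norm (f n u))"
    proof (intro AE_I2)
      fix u
      have "summable (\<lambda>n. (x * t u) ^ n /\<^sub>R fact n * w u)"
        by (intro summable_mult2 summable_exp_generic)
      then show "summable (\<lambda>n. norm (f n u))"
      proof (rule summable_comparison_test')
        fix n
        have "\<bar>airy_sign n\<bar> * (x ^ n / fact n * (t u ^ n * w u)) \<le>
          1 * (x ^ n / fact n * (t u ^ n * w u))"
          using x t0[of u] w0[of u] by (intro mult_right_mono abs_airy_sign_le) auto
        then show "norm (norm (f n u)) \<le> (x * t u) ^ n /\<^sub>R fact n * w u"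
          unfolding nf using x t0[of u] w0[of u]
            by (simp add: power_mult_distrib divide_inverse mult_ac abs_mult)
      qed
    qed
    have s2: "summable (\<lambda>n. integral\<^sup>L M (\<lambda>u. norm (f n u)))"
      unfolding nf_val
      by (intro summable_mult powser_insidea[OF summable_airy[of "\<bar>x\<bar> + 1"]]) simp
    have "integral\<^sup>L M (\<lambda>u. \<Sum>n. f n u) = (\<Sum>n. G * (airy_coeff n * x ^ n))"
      using integral_suminf[OF f_int s1 s2] by (simp add: f_val)
    also have "\<dots> = G * Ai x"
      using sums_mult[OF Ai_sums[of x], of G] by (simp add: sums_iff)
    finally have eq: "integral\<^sup>L M (\<lambda>u. airy_kernel 0 (x * t u) * w u) = G * Ai x"
      using sumf by (simp add: sums_iff)
    have int: "integrable M (\<lambda>u. airy_kernel 0 (x * t u) * w u)"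
      using integrable_suminf[OF f_int s1 s2] sumf by (simp add: sums_iff)
    have "norm (integral\<^sup>L M (\<lambda>u. airy_kernel 0 (x * t u) * w u)) \<le> integral\<^sup>L M (\<lambda>u. 2 * w u)"
    proof (rule Bochner_Integration.integral_norm_bound_integral[OF int])
      show "integrable M (\<lambda>u. 2 * w u)" using w_int by simp
      show "norm (airy_kernel 0 (x * t u) * w u) \<le> 2 * w u" for u
        using abs_airy_kernel_le[of "x * t u"] x t0[of u] w0[of u]
          by (auto simp: abs_mult intro!: mult_right_mono)
    qed
    then have "\<bar>G * Ai x\<bar> \<le> 2 * airy_moment 0" unfolding eq using w_int by simp
    then show ?thesis using G by (simp add: abs_mult field_simps)
  qed
  then show ?thesis by blast
qed

section \<open>Decay of the Airy function\<close>

text \<open>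
  Gronwall's inequality run backwards: \<open>exp(K x) E(x)\<close> is nondecreasing.
\<close>

lemma backward_zero_propagation:
  fixes E E' :: "real \<Rightarrow> real"
  assumes "a \<le> b" "continuous_on {a..b} E" "\<And>x. x \<in> {a..b} \<Longrightarrow> 0 \<le> E x"
    and "\<And>x. a < x \<Longrightarrow> x < b \<Longrightarrow> (E has_real_derivative E' x) (at x)"
    and "\<And>x. a < x \<Longrightarrow> x < b \<Longrightarrow> - (K * E x) \<le> E' x" and "E b = 0"
  shows "E a = 0"
proof -
  have "exp (K * a) * E a \<le> exp (K * b) * E b"
  proof (rule DERIV_nonneg_imp_increasing_open[OF assms(1)])
    show "\<exists>y. ((\<lambda>x. exp (K * x) * E x) has_real_derivative y) (at x) \<and> 0 \<le> y" if "a < x" "x < b" for x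
    proof (intro exI conjI)
      show "((\<lambda>x. exp (K * x) * E x) has_real_derivative exp (K * x) * (K * E x + E' x)) (at x)"
        by (auto intro!: derivative_eq_intros assms(4) that simp: algebra_simps)
      show "0 \<le> exp (K * x) * (K * E x + E' x)" using assms(5)[OF that] by simp
    qed
    show "continuous_on {a..b} (\<lambda>x. exp (K * x) * E x)"
      by (intro continuous_intros assms(2))
  qed
  then have "E a \<le> 0" using assms(6) by (simp add: mult_le_0_iff)
  then show ?thesis using assms(3)[of a] assms(1) by simp
qed

text \<open>
  A convex function that increases somewhere grows at least linearly.
\<close>

lemma convex_sublinear_nonincreasing:
  fixes h h' :: "real \<Rightarrow> real"
  assumes d: "\<And>x. a \<le> x \<Longrightarrow> (h has_real_derivative h' x) (at x)"
    and mono: "\<And>x y. a \<le> x \<Longrightarrow> x \<le> y \<Longrightarrow> h' x \<le> h' y"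
    and "\<And>x. 0 \<le> h x"
    and sub: "\<And>c x0. 0 < c \<Longrightarrow> a \<le> x0 \<Longrightarrow> \<exists>x\<ge>x0. h x < c * (x - x0)"
    and "a \<le> x0"
  shows "h' x0 \<le> 0"
proof (rule ccontr)
  assume "\<not> ?thesis"
  then have c: "h' x0 > 0" by simp
  obtain x where x: "x0 \<le> x" "h x < h' x0 * (x - x0)" using sub[OF c assms(5)] by blast
  have "x \<noteq> x0" using x(2) assms(3)[of x0] by auto
  then have "x0 < x" using x by simp
  then obtain z where z: "x0 < z" "z < x" "h x - h x0 = (x - x0) * h' z"
    using MVT2[of x0 x h h'] d assms(5) by auto
  have "(x - x0) * h' x0 \<le> (x - x0) * h' z"
    using mono[of x0 z] z assms(5) by (intro mult_left_mono) auto
  then have "(x - x0) * h' x0 \<le> h x - h x0" using z(3) by simp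
  moreover have "(x - x0) * h' x0 = h' x0 * (x - x0)" by (rule mult.commute)
  ultimately show False using x(2) assms(3)[of x0] by linarith
qed

lemma continuous_on_Ai: "continuous_on S (Ai :: real \<Rightarrow> real)"
  using Ai_deriv by (meson DERIV_isCont continuous_at_imp_continuous_on)

lemma continuous_on_Ai': "continuous_on S Ai'"
  using Ai'_deriv by (meson DERIV_isCont continuous_at_imp_continuous_on)

lemma Ai_0_pos: "Ai 0 > (0::real)" and Ai'_0_neg: "Ai' 0 < 0"
proof -
  have G: "Gamma (1/3) * Gamma (2/3) > (0::real)" by (intro mult_pos_pos Gamma_real_pos) auto
  have "Ai 0 = airy_coeff 0" unfolding Ai_eq_suminf by (subst powser_zero) simp
  then show "Ai 0 > (0::real)"
    using G airy_moment_pos[of 0] by (simp add: airy_coeff_def airy_sign_def)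
  have "Ai' 0 = diffs airy_coeff 0" unfolding Ai'_def by (subst powser_zero) simp
  also have "\<dots> = - (airy_moment 1 / (Gamma (1/3) * Gamma (2/3)))"
    by (simp add: diffs_def airy_coeff_def airy_sign_def)
  finally show "Ai' 0 < 0" using G airy_moment_pos[of 1] by simp
qed

text \<open>
  Uniqueness for the initial value problem, by the energy \<open>Ai\<^sup>2 + Ai'\<^sup>2\<close>, since \<open>Ai(0) \<noteq> 0\<close>.
\<close>

lemma Ai_Ai'_no_common_zero:
  assumes "0 \<le> x"
  shows "Ai x \<noteq> 0 \<or> Ai' x \<noteq> 0"
proof (rule ccontr)
  assume z: "\<not> ?thesis"
  define E where "E y = (Ai y)\<^sup>2 + (Ai' y)\<^sup>2" for y :: real
  have "E 0 = 0"
  proof (rule backward_zero_propagation[OF assms,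
        where E' = "\<lambda>y. 2 * (1 + y) * (Ai y * Ai' y)" and K = "1 + x"])
    show "continuous_on {0..x} E" unfolding E_def
      by (intro continuous_intros continuous_on_Ai continuous_on_Ai')
    show "0 \<le> E y" for y by (simp add: E_def)
    show "E x = 0" using z by (simp add: E_def)
    fix y assume y: "0 < y" "y < x"
    show "(E has_real_derivative 2 * (1 + y) * (Ai y * Ai' y)) (at y)"
      unfolding E_def[abs_def]
      by (auto intro!: derivative_eq_intros Ai_deriv Ai'_deriv simp: algebra_simps)
    have "- E y \<le> 2 * (Ai y * Ai' y)"
      using zero_le_power2[of "Ai y + Ai' y"] by (simp add: E_def power2_sum algebra_simps)
    then have "(1 + y) * (- E y) \<le> (1 + y) * (2 * (Ai y * Ai' y))"
      using y by (intro mult_left_mono) auto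
    moreover have "(1 + y) * E y \<le> (1 + x) * E y"
      using y by (intro mult_right_mono) (auto simp: E_def)
    ultimately show "- ((1 + x) * E y) \<le> 2 * (1 + y) * (Ai y * Ai' y)" by (simp add: mult_ac)
  qed
  then show False using Ai_0_pos by (simp add: E_def)
qed

lemma Ai_Ai'_mono:
  assumes "0 \<le> x" "x \<le> y"
  shows "Ai x * Ai' x \<le> Ai y * Ai' y"
proof (rule DERIV_nonneg_imp_nondecreasing[OF assms(2)])
  fix z assume z: "x \<le> z" "z \<le> y"
  have "((\<lambda>x. Ai x * Ai' x) has_real_derivative (Ai' z)\<^sup>2 + z * (Ai z)\<^sup>2) (at z)"
    by (auto intro!: derivative_eq_intros Ai_deriv Ai'_deriv simp: power2_eq_square)
  then show "\<exists>w. ((\<lambda>x. Ai x * Ai' x) has_real_derivative w) (at z) \<and> 0 \<le> w"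
    using z assms by (intro exI[of _ "(Ai' z)\<^sup>2 + z * (Ai z)\<^sup>2"] conjI) auto
qed

lemma Ai_sq_deriv: "((\<lambda>x::real. (Ai x)\<^sup>2) has_real_derivative 2 * (Ai x * Ai' x)) (at x)"
  by (auto intro!: derivative_eq_intros Ai_deriv)

text \<open>
  \<open>Ai\<^sup>2\<close> is convex on the positive half-line and bounded, hence nonincreasing.
\<close>

lemma Ai_Ai'_nonpos:
  assumes "0 \<le> x"
  shows "Ai x * Ai' x \<le> 0"
proof -
  obtain C where C: "\<And>x::real. 0 \<le> x \<Longrightarrow> \<bar>Ai x\<bar> \<le> C" using Ai_bounded_halfline by blast
  have "2 * (Ai x * Ai' x) \<le> 0"
  proof (rule convex_sublinear_nonincreasing[where a = 0 and h = "\<lambda>x. (Ai x)\<^sup>2"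
        and h' = "\<lambda>x. 2 * (Ai x * Ai' x)"])
    show "((\<lambda>x. (Ai x)\<^sup>2) has_real_derivative 2 * (Ai x * Ai' x)) (at x)" for x by (rule Ai_sq_deriv)
    show "2 * (Ai x * Ai' x) \<le> 2 * (Ai y * Ai' y)" if "0 \<le> x" "x \<le> y" for x y
      using Ai_Ai'_mono[OF that] by simp
    show "\<exists>x\<ge>x0. (Ai x)\<^sup>2 < c * (x - x0)" if c: "0 < c" and x0: "0 \<le> x0" for c x0 :: real
    \<comment> \<open>at this point the linear function has the value \<open>C\<^sup>2 + 1\<close>\<close>
    proof (intro exI[of _ "x0 + (C\<^sup>2 + 1) / c"] conjI)
      show "x0 \<le> x0 + (C\<^sup>2 + 1) / c" using c by simp
      then have "\<bar>Ai (x0 + (C\<^sup>2 + 1) / c)\<bar> \<le> C" using C x0 by simp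
      then have "(Ai (x0 + (C\<^sup>2 + 1) / c))\<^sup>2 \<le> C\<^sup>2"
        by (metis abs_ge_zero power2_abs power_mono)
      then show "(Ai (x0 + (C\<^sup>2 + 1) / c))\<^sup>2 < c * (x0 + (C\<^sup>2 + 1) / c - x0)" using c by simp
    qed
  qed (use assms in auto)
  then show ?thesis by linarith
qed

text \<open>
  After a zero \<open>x\<close> the nonpositive nondecreasing function \<open>Ai Ai'\<close> vanishes identically, and so
  does its derivative \<open>Ai'\<^sup>2 + y Ai\<^sup>2\<close>; then \<open>Ai\<close> and \<open>Ai'\<close> have a common zero.
\<close>

lemma Ai_neq_0:
  assumes "0 \<le> x"
  shows "Ai x \<noteq> (0::real)"
proof
  assume z: "Ai x = 0"
  have const: "Ai y * Ai' y = 0" if "x \<le> y" for y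
    using Ai_Ai'_mono[OF assms that] Ai_Ai'_nonpos[of y] assms that z by simp
  define y where "y = x + 1"
  have "((\<lambda>x. Ai x * Ai' x) has_real_derivative (Ai' y)\<^sup>2 + y * (Ai y)\<^sup>2) (at y)"
    by (auto intro!: derivative_eq_intros Ai_deriv Ai'_deriv simp: power2_eq_square)
  moreover have "((\<lambda>x. Ai x * Ai' x) has_real_derivative 0) (at y)"
  proof (rule has_field_derivative_transform_within_open[of "\<lambda>_. 0" _ _ "{x<..}"])
    show "0 = Ai z * Ai' z" if "z \<in> {x<..}" for z using const[of z] that by simp
  qed (auto simp: y_def)
  ultimately have "(Ai' y)\<^sup>2 + y * (Ai y)\<^sup>2 = 0" by (rule DERIV_unique)
  moreover have "0 < y" using assms by (simp add: y_def)
  ultimately have "Ai y = 0" "Ai' y = 0"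
    by (smt (verit) mult_nonneg_nonneg zero_le_power2 power_eq_0_iff zero_eq_power2 no_zero_divisors)+
  then show False using Ai_Ai'_no_common_zero[of y] \<open>0 < y\<close> by simp
qed

lemma Ai_pos:
  assumes "0 \<le> x"
  shows "Ai x > (0::real)"
proof (rule ccontr)
  assume "\<not> ?thesis"
  then have "Ai x \<le> 0" by simp
  then obtain y where "0 \<le> y" "y \<le> x" "Ai y = 0"
    using IVT2'[of Ai x 0 0] Ai_0_pos assms continuous_on_Ai by (auto simp: less_imp_le)
  then show False using Ai_neq_0 by blast
qed

lemma Ai'_strict_mono:
  assumes "0 \<le> x" "x < y"
  shows "Ai' x < Ai' y"
proof (rule DERIV_pos_imp_increasing_open[OF assms(2)])
  fix z assume z: "x < z" "z < y"
  then show "\<exists>w. (Ai' has_real_derivative w) (at z) \<and> 0 < w"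
    using Ai'_deriv[of z] Ai_pos[of z] assms by (intro exI[of _ "z * Ai z"] conjI) auto
qed (rule continuous_on_Ai')

text \<open>
  \<open>Ai'\<close> is strictly increasing since \<open>Ai'' = x Ai > 0\<close>, so a zero would make it positive later.
\<close>

lemma Ai'_neg:
  assumes "0 \<le> x"
  shows "Ai' x < 0"
proof -
  have "Ai' (x + 1) \<le> 0"
    using Ai_Ai'_nonpos[of "x + 1"] Ai_pos[of "x + 1"] assms by (simp add: mult_le_0_iff)
  then show ?thesis using Ai'_strict_mono[of x "x + 1"] assms by simp
qed

lemma Ai_antimono:
  assumes "0 \<le> x" "x \<le> y"
  shows "Ai y \<le> (Ai x :: real)"
proof (rule DERIV_nonpos_imp_nonincreasing[OF assms(2)])
  fix z assume "x \<le> z" "z \<le> y"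
  then show "\<exists>w. (Ai has_real_derivative w) (at z) \<and> w \<le> 0"
    using Ai_deriv[of z] Ai'_neg[of z] assms by (intro exI[of _ "Ai' z"] conjI) auto
qed

text \<open>
  \<open>Ai'\<close> grows by at least \<open>(x/2) (x/2) Ai(x)\<close> over \<open>[x/2, x]\<close>, but it stays between \<open>Ai'(0)\<close> and
  \<open>0\<close>.
\<close>

lemma Ai_decay:
  assumes "0 < x"
  shows "Ai x \<le> 4 * \<bar>Ai' 0\<bar> / x\<^sup>2"
proof -
  obtain z where z: "x/2 < z" "z < x" "Ai' x - Ai' (x/2) = (x - x/2) * (z * Ai z)"
    using MVT2[of "x/2" x Ai' "\<lambda>z. z * Ai z"] Ai'_deriv assms by auto
  have "x/2 * Ai x \<le> z * Ai z"
    using z assms Ai_antimono[of z x] Ai_pos[of x] by (intro mult_mono) auto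
  then have "(x/2) * (x/2 * Ai x) \<le> (x/2) * (z * Ai z)" using assms by (intro mult_left_mono) auto
  also have "\<dots> = Ai' x - Ai' (x/2)" using z(3) by simp
  also have "\<dots> \<le> - Ai' 0"
    using Ai'_neg[of x] Ai'_strict_mono[of 0 "x/2"] assms by simp
  finally have "x\<^sup>2 * Ai x \<le> 4 * \<bar>Ai' 0\<bar>" by (simp add: power2_eq_square)
  then show ?thesis using assms by (simp add: field_simps)
qed

lemma abs_Ai'_le:
  assumes "1 \<le> x"
  shows "\<bar>Ai' x\<bar> \<le> Ai (x - 1)"
proof -
  obtain z where z: "x - 1 < z" "z < x" "Ai x - Ai (x - 1) = (x - (x - 1)) * Ai' z"
    using MVT2[of "x - 1" x Ai Ai'] Ai_deriv assms by auto
  then have "Ai x - Ai (x - 1) \<le> Ai' x" using Ai'_strict_mono[of z x] assms by simp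
  then show ?thesis using Ai'_neg[of x] Ai_pos[of x] assms by simp
qed

text \<open>
  The integral of \<open>Ai\<^sup>2\<close> over \<open>[y, \<infinity>)\<close>, in closed form.
\<close>

definition airy_tail :: "real \<Rightarrow> real" where
  "airy_tail y = (Ai' y)\<^sup>2 - y * (Ai y)\<^sup>2"

lemma airy_tail_deriv: "(airy_tail has_real_derivative - (Ai y)\<^sup>2) (at y)"
  unfolding airy_tail_def[abs_def]
  by (auto intro!: derivative_eq_intros Ai_deriv Ai'_deriv simp: power2_eq_square)

lemma airy_tail_tendsto: "(airy_tail \<longlongrightarrow> 0) at_top"
proof -
  define K where "K = 4 * \<bar>Ai' 0\<bar>"
  have Ai0: "((\<lambda>x::real. Ai x) \<longlongrightarrow> 0) at_top"
  proof (rule tendsto_sandwich[of "\<lambda>_. 0" _ _ "\<lambda>x. K * (inverse x * inverse x)"])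
    show "\<forall>\<^sub>F x::real in at_top. 0 \<le> Ai x"
      using eventually_ge_at_top[of "0::real"] by eventually_elim (simp add: Ai_pos less_imp_le)
    show "\<forall>\<^sub>F x in at_top. Ai x \<le> K * (inverse x * inverse x)"
      using eventually_gt_at_top[of "0::real"]
      by eventually_elim (use Ai_decay in \<open>simp add: K_def power2_eq_square divide_inverse\<close>)
    have "((\<lambda>x::real. K * (inverse x * inverse x)) \<longlongrightarrow> K * (0 * 0)) at_top"
      by (intro tendsto_intros tendsto_inverse_0_at_top filterlim_ident)
    then show "((\<lambda>x::real. K * (inverse x * inverse x)) \<longlongrightarrow> 0) at_top" by simp
  qed simp
  have sh: "filterlim (\<lambda>x::real. x - 1) at_top at_top"
    using filterlim_tendsto_add_at_top[OF tendsto_const[of "-1::real"] filterlim_ident] by simp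
  have Ai1: "((\<lambda>x::real. Ai (x - 1)) \<longlongrightarrow> 0) at_top"
    by (rule filterlim_compose[OF Ai0 sh])
  have "((\<lambda>x. \<bar>Ai' x\<bar>) \<longlongrightarrow> 0) at_top"
  proof (rule tendsto_sandwich[OF _ _ tendsto_const Ai1])
    show "\<forall>\<^sub>F x in at_top. \<bar>Ai' x\<bar> \<le> Ai (x - 1)"
      using eventually_ge_at_top[of 1] by eventually_elim (rule abs_Ai'_le)
  qed simp
  then have Ai'0: "(Ai' \<longlongrightarrow> 0) at_top" by (rule tendsto_rabs_zero_cancel)
  have xA: "((\<lambda>x::real. x * (Ai x)\<^sup>2) \<longlongrightarrow> 0) at_top"
  proof (rule tendsto_sandwich[where f = "\<lambda>_. 0" and h = "\<lambda>x. K * inverse x * Ai x"])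
    show "\<forall>\<^sub>F x::real in at_top. 0 \<le> x * (Ai x)\<^sup>2"
      using eventually_ge_at_top[of "0::real"] by eventually_elim simp
    show "\<forall>\<^sub>F x in at_top. x * (Ai x)\<^sup>2 \<le> K * inverse x * Ai x"
      using eventually_gt_at_top[of "0::real"]
    proof eventually_elim
      case (elim x)
      have "x * Ai x \<le> x * (K / x\<^sup>2)" using Ai_decay[OF elim] elim
        by (intro mult_left_mono) (auto simp: K_def)
      also have "\<dots> = K * inverse x" using elim by (simp add: power2_eq_square divide_inverse)
      finally have "(x * Ai x) * Ai x \<le> (K * inverse x) * Ai x"
        using Ai_pos[of x] elim by (intro mult_right_mono) auto
      then show ?case by (simp add: power2_eq_square mult_ac)
    qed
    have "((\<lambda>x::real. K * inverse x * Ai x) \<longlongrightarrow> K * 0 * 0) at_top"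
      by (intro tendsto_intros tendsto_inverse_0_at_top filterlim_ident Ai0)
    then show "((\<lambda>x::real. K * inverse x * Ai x) \<longlongrightarrow> 0) at_top" by simp
  qed simp
  have "((\<lambda>x. (Ai' x)\<^sup>2 - x * (Ai x)\<^sup>2) \<longlongrightarrow> 0\<^sup>2 - 0) at_top"
    by (intro tendsto_intros Ai'0 xA)
  then show ?thesis by (simp add: airy_tail_def[abs_def])
qed

lemma airy_tail_antimono:
  assumes "x \<le> y"
  shows "airy_tail y \<le> airy_tail x"
proof (rule DERIV_nonpos_imp_nonincreasing[OF assms])
  show "\<exists>w. (airy_tail has_real_derivative w) (at z) \<and> w \<le> 0" for z
    using airy_tail_deriv[of z] by (intro exI[of _ "- (Ai z)\<^sup>2"] conjI) auto
qed

text \<open>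
  The function is nonincreasing with limit \<open>0\<close>, and strictly decreasing where \<open>Ai > 0\<close>.
\<close>

lemma airy_tail_pos: "0 < airy_tail y"
proof -
  define x where "x = max y 0"
  have "airy_tail (x + 1) < airy_tail x"
  proof (rule DERIV_neg_imp_decreasing[where f = airy_tail])
    show "\<exists>w. (airy_tail has_real_derivative w) (at z) \<and> w < 0" if "x \<le> z" for z
      using airy_tail_deriv[of z] Ai_pos[of z] that
        by (intro exI[of _ "- (Ai z)\<^sup>2"] conjI) (auto simp: x_def)
  qed simp
  moreover have "0 \<le> airy_tail (x + 1)"
  proof (rule tendsto_upperbound[OF airy_tail_tendsto])
    show "\<forall>\<^sub>F z in at_top. airy_tail z \<le> airy_tail (x + 1)"
      using eventually_ge_at_top[of "x + 1"] by eventually_elim (rule airy_tail_antimono)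
  qed simp
  moreover have "airy_tail x \<le> airy_tail y" by (rule airy_tail_antimono) (simp add: x_def)
  ultimately show ?thesis by linarith
qed

lemma Ai_Ai'_nonzero: "Ai x \<noteq> 0 \<or> Ai' x \<noteq> 0"
  using airy_tail_pos[of x] by (auto simp: airy_tail_def)

section \<open>The polar angle of the Airy function\<close>

text \<open>
  An integral over a reversed interval counts as zero, whence the difference of two integrals.
\<close>

lemma continuous_antiderivative:
  fixes f :: "real \<Rightarrow> real"
  assumes "continuous_on UNIV f"
  shows "\<exists>F. F 0 = 0 \<and> (\<forall>x. (F has_real_derivative f x) (at x))"
proof -
  define F where "F x = integral {0..x} f - integral {x..0} f" for x
  have int: "f integrable_on {a..b}" for a b
    using assms by (intro integrable_continuous_real) (rule continuous_on_subset, auto)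
  have "(F has_real_derivative f x) (at x)" for x
  proof -
    define N where "N = \<bar>x\<bar> + 1"
    have eq: "F y = integral {-N..y} f - integral {-N..0} f" if "y \<in> {-N<..<N}" for y
    proof (cases "0 \<le> y")
      case True
      have "integral {y..0} f = 0" using True by (cases "y = 0") auto
      moreover have "integral {-N..0} f + integral {0..y} f = integral {-N..y} f"
        using True that by (intro Henstock_Kurzweil_Integration.integral_combine int) auto
      ultimately show ?thesis by (simp add: F_def)
    next
      case False
      then have "integral {-N..y} f + integral {y..0} f = integral {-N..0} f"
        using that by (intro Henstock_Kurzweil_Integration.integral_combine int) auto
      then show ?thesis using False by (simp add: F_def)
    qed
    have x: "x \<in> {-N<..<N}" by (auto simp: N_def)
    have "((\<lambda>y. integral {-N..y} f) has_vector_derivative f x) (at x within {-N..N})"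
      using x by (intro integral_has_vector_derivative continuous_on_subset[OF assms]) auto
    then have "((\<lambda>y. integral {-N..y} f) has_vector_derivative f x) (at x)"
      using x by (simp add: at_within_Icc_at)
    then have "((\<lambda>y. integral {-N..y} f - integral {-N..0} f) has_real_derivative f x) (at x)"
      by (auto simp: has_real_derivative_iff_has_vector_derivative intro: derivative_eq_intros)
    then show ?thesis
      by (rule has_field_derivative_transform_within_open[of _ _ _ "{-N<..<N}"]) (use x eq in auto)
  qed
  moreover have "F 0 = 0" by (simp add: F_def)
  ultimately show ?thesis by blast
qed

text \<open>
  The angle is the integral of \<open>(p q' - q p') / (p\<^sup>2 + q\<^sup>2)\<close>. Rotating \<open>(p, q)\<close> back by it gives a
  vector \<open>(C, S)\<close> of the same length \<open>sqrt R\<close> for which \<open>S\<^sup>2 / R\<close> is constant, hence zero; so \<open>C\<close>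
  has no zero and stays positive.
\<close>

lemma continuous_angle:
  fixes p q p' q' :: "real \<Rightarrow> real"
  assumes dp: "\<And>x. (p has_real_derivative p' x) (at x)"
    and dq: "\<And>x. (q has_real_derivative q' x) (at x)"
    and cp: "continuous_on UNIV p'" and cq: "continuous_on UNIV q'"
    and nz: "\<And>x. p x \<noteq> 0 \<or> q x \<noteq> 0"
    and p0: "0 < p 0"
  obtains \<theta> where "\<theta> 0 = arctan (q 0 / p 0)"
    "\<And>x. (\<theta> has_real_derivative (p x * q' x - q x * p' x) / ((p x)\<^sup>2 + (q x)\<^sup>2)) (at x)"
    "\<And>x. p x = sqrt ((p x)\<^sup>2 + (q x)\<^sup>2) * cos (\<theta> x)"
    "\<And>x. q x = sqrt ((p x)\<^sup>2 + (q x)\<^sup>2) * sin (\<theta> x)"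
proof -
  define R where "R x = (p x)\<^sup>2 + (q x)\<^sup>2" for x
  have R: "R x > 0" for x using nz[of x] by (auto simp: R_def sum_power2_gt_zero_iff)
  have cont: "continuous_on UNIV p" "continuous_on UNIV q"
    using dp dq by (meson DERIV_isCont continuous_at_imp_continuous_on)+
  have "continuous_on UNIV (\<lambda>x. (p x * q' x - q x * p' x) / R x)"
    using R unfolding R_def
    by (intro continuous_intros cont cp cq) (metis less_irrefl)
  then obtain F where F: "F 0 = 0" "\<And>x. (F has_real_derivative (p x * q' x - q x * p' x) / R x) (at x)"
    using continuous_antiderivative by blast
  define \<theta> where "\<theta> x = arctan (q 0 / p 0) + F x" for x
  have \<theta>0: "\<theta> 0 = arctan (q 0 / p 0)" by (simp add: \<theta>_def F)
  have d\<theta>: "(\<theta> has_real_derivative (p x * q' x - q x * p' x) / R x) (at x)" for x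
    unfolding \<theta>_def[abs_def] by (auto intro!: derivative_eq_intros F(2))
  define C where "C x = p x * cos (\<theta> x) + q x * sin (\<theta> x)" for x
  define S where "S x = q x * cos (\<theta> x) - p x * sin (\<theta> x)" for x
  have pC: "p x = C x * cos (\<theta> x) - S x * sin (\<theta> x)" for x
  proof -
    have "C x * cos (\<theta> x) - S x * sin (\<theta> x) = p x * ((cos (\<theta> x))\<^sup>2 + (sin (\<theta> x))\<^sup>2)"
      unfolding C_def S_def by (simp add: power2_eq_square algebra_simps del: sin_cos_squared_add3)
    then show ?thesis by simp
  qed
  have qC: "q x = C x * sin (\<theta> x) + S x * cos (\<theta> x)" for x
  proof -
    have "C x * sin (\<theta> x) + S x * cos (\<theta> x) = q x * ((cos (\<theta> x))\<^sup>2 + (sin (\<theta> x))\<^sup>2)"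
      unfolding C_def S_def by (simp add: power2_eq_square algebra_simps del: sin_cos_squared_add3)
    then show ?thesis by simp
  qed
  have CS: "(C x)\<^sup>2 + (S x)\<^sup>2 = R x" for x
  proof -
    have "(C x)\<^sup>2 + (S x)\<^sup>2 = R x * ((cos (\<theta> x))\<^sup>2 + (sin (\<theta> x))\<^sup>2)"
      unfolding C_def S_def R_def
        by (simp add: power2_eq_square algebra_simps del: sin_cos_squared_add3)
    then show ?thesis by simp
  qed
  have dS: "(S has_real_derivative S x * (p x * p' x + q x * q' x) / R x) (at x)" for x
  proof -
    let ?c = "cos (\<theta> x)" and ?s = "sin (\<theta> x)"
    define T where "T = (p x * q' x - q x * p' x) / R x"
    have dT: "(\<theta> has_real_derivative T) (at x)" using d\<theta>[of x] by (simp add: T_def)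
    have "(S has_real_derivative q' x * ?c - p' x * ?s - T * C x) (at x)"
      unfolding S_def[abs_def] C_def by (auto intro!: derivative_eq_intros dp dq dT simp: algebra_simps)
    also have "q' x * ?c - p' x * ?s - T * C x = S x * (p x * p' x + q x * q' x) / R x"
    proof -
      have "(q' x * ?c - p' x * ?s) * R x - (p x * q' x - q x * p' x) * C x =
        S x * (p x * p' x + q x * q' x)"
        unfolding C_def S_def R_def by (simp add: power2_eq_square algebra_simps)
      then show ?thesis using R[of x] by (simp add: T_def field_simps)
    qed
    finally show ?thesis .
  qed
  have dR: "(R has_real_derivative 2 * (p x * p' x + q x * q' x)) (at x)" for x
    unfolding R_def[abs_def] by (auto intro!: derivative_eq_intros dp dq)
  have const0: "((\<lambda>x. (S x)\<^sup>2 / R x) has_real_derivative 0) (at x)" for x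
  proof -
    have "((\<lambda>x. (S x)\<^sup>2 / R x) has_real_derivative
        ((2 * S x * (S x * (p x * p' x + q x * q' x) / R x)) * R x - (S x)\<^sup>2 * (2 * (p x * p' x + q x * q' x))) / (R x * R x)) (at x)"
      using R[of x] by (auto intro!: derivative_eq_intros dS dR)
    moreover have "(2 * S x * (S x * (p x * p' x + q x * q' x) / R x)) * R x - (S x)\<^sup>2 * (2 * (p x * p' x + q x * q' x)) = 0"
      using R[of x] by (simp add: power2_eq_square)
    ultimately show ?thesis by simp
  qed
  have const: "(S x)\<^sup>2 / R x = (S 0)\<^sup>2 / R 0" for x
    by (rule DERIV_isconst_all[of "\<lambda>x. (S x)\<^sup>2 / R x"]) (use const0 in blast)
  have q0: "q 0 = p 0 * tan (\<theta> 0)" using p0 by (simp add: \<theta>0 tan_arctan)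
  have c0: "cos (\<theta> 0) > 0" unfolding \<theta>0
    using arctan_lbound[of "q 0 / p 0"] arctan_ubound[of "q 0 / p 0"] by (intro cos_gt_zero_pi) simp_all
  have "S 0 = 0" using q0 c0 by (simp add: S_def tan_def)
  then have S0: "S x = 0" for x using const[of x] R[of x] by simp
  have C0: "C 0 > 0"
  proof -
    have "p 0 = C 0 * cos (\<theta> 0)" using pC[of 0] \<open>S 0 = 0\<close> by simp
    then show ?thesis using p0 c0 by (metis zero_less_mult_pos2)
  qed
  have "continuous_on UNIV \<theta>" by (rule DERIV_continuous_on) (use d\<theta> in simp)
  then have contC: "continuous_on UNIV C" unfolding C_def by (intro continuous_intros cont)
  have Cnz: "C x \<noteq> 0" for x using CS[of x] R[of x] S0[of x] by auto
  have Cpos: "C x > 0" for x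
  proof (rule ccontr)
    assume "\<not> ?thesis"
    then have "C x \<le> 0" by simp
    have "connected (C ` UNIV)" using contC by (intro connected_continuous_image) auto
    then have "\<And>z. C x \<le> z \<Longrightarrow> z \<le> C 0 \<Longrightarrow> z \<in> C ` UNIV" unfolding connected_iff_interval by blast
    then have "0 \<in> C ` UNIV" using \<open>C x \<le> 0\<close> less_imp_le[OF C0] by blast
    then show False using Cnz by auto
  qed
  have CR: "C x = sqrt (R x)" for x
    using CS[of x] S0[of x] Cpos[of x] by (simp add: real_sqrt_unique)
  show thesis
  proof (rule that[of \<theta>])
    show "\<theta> 0 = arctan (q 0 / p 0)" by (rule \<theta>0)
    show "(\<theta> has_real_derivative (p x * q' x - q x * p' x) / ((p x)\<^sup>2 + (q x)\<^sup>2)) (at x)" for x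
      using d\<theta>[of x] by (simp add: R_def)
    show "p x = sqrt ((p x)\<^sup>2 + (q x)\<^sup>2) * cos (\<theta> x)" for x
      using pC[of x] S0[of x] CR[of x] by (simp add: R_def)
    show "q x = sqrt ((p x)\<^sup>2 + (q x)\<^sup>2) * sin (\<theta> x)" for x
      using qC[of x] S0[of x] CR[of x] by (simp add: R_def)
  qed
qed

lemma Ai_neg_deriv: "((\<lambda>l. Ai (- l)) has_real_derivative - Ai' (- l)) (at l)"
  using DERIV_chain2[OF Ai_deriv[of "- l"] DERIV_minus[OF DERIV_ident]] by simp

lemma Ai'_neg_deriv: "((\<lambda>l. Ai' (- l)) has_real_derivative l * Ai (- l)) (at l)"
  using DERIV_chain2[OF Ai'_deriv[of "- l"] DERIV_minus[OF DERIV_ident]] by simp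

text \<open>
  The scale factor \<open>c\<close> does not move the points where the angle is a multiple of \<open>\<pi>/2\<close>; it is used
  to bound the angular velocity in \<open>robin_root_0_spacing\<close>.
\<close>

lemma airy_angle_exists:
  assumes "0 < c"
  shows "\<exists>\<theta>. (- pi / 2 < \<theta> 0 \<and> \<theta> 0 < 0) \<and>
    (\<forall>l. (\<theta> has_real_derivative c * airy_tail (- l) / ((c * Ai (- l))\<^sup>2 + (Ai' (- l))\<^sup>2)) (at l)) \<and>
    (\<forall>l. c * Ai (- l) = sqrt ((c * Ai (- l))\<^sup>2 + (Ai' (- l))\<^sup>2) * cos (\<theta> l)) \<and>
    (\<forall>l. Ai' (- l) = sqrt ((c * Ai (- l))\<^sup>2 + (Ai' (- l))\<^sup>2) * sin (\<theta> l))"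
proof -
  have d: "((\<lambda>l. c * Ai (- l)) has_real_derivative c * (- Ai' (- l))) (at l)" for l
    by (intro DERIV_cmult Ai_neg_deriv)
  have cA: "continuous_on UNIV (\<lambda>l. Ai (- l) :: real)"
    by (rule continuous_on_compose2[OF continuous_on_Ai[of UNIV]]) (auto intro!: continuous_intros)
  have cA': "continuous_on UNIV (\<lambda>l. Ai' (- l))"
    by (rule continuous_on_compose2[OF continuous_on_Ai'[of UNIV]]) (auto intro!: continuous_intros)
  have cc: "continuous_on UNIV (\<lambda>l. c * (- Ai' (- l)))" "continuous_on UNIV (\<lambda>l::real. l * Ai (- l))"
    by (intro continuous_intros cA cA')+
  have nz: "c * Ai (- l) \<noteq> 0 \<or> Ai' (- l) \<noteq> 0" for l using Ai_Ai'_nonzero[of "- l"] assms by simp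
  have p0: "0 < c * Ai (- 0)" using Ai_0_pos assms by simp
  obtain \<theta> where \<theta>: "\<theta> 0 = arctan (Ai' (- 0) / (c * Ai (- 0)))"
    "\<And>l. (\<theta> has_real_derivative (c * Ai (- l) * (l * Ai (- l)) - Ai' (- l) * (c * (- Ai' (- l)))) /
        ((c * Ai (- l))\<^sup>2 + (Ai' (- l))\<^sup>2)) (at l)"
    "\<And>l. c * Ai (- l) = sqrt ((c * Ai (- l))\<^sup>2 + (Ai' (- l))\<^sup>2) * cos (\<theta> l)"
    "\<And>l. Ai' (- l) = sqrt ((c * Ai (- l))\<^sup>2 + (Ai' (- l))\<^sup>2) * sin (\<theta> l)"
    using continuous_angle[OF d Ai'_neg_deriv cc nz p0] by blast
  have "c * Ai (- l) * (l * Ai (- l)) - Ai' (- l) * (c * (- Ai' (- l))) = c * airy_tail (- l)" for l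
    by (simp add: airy_tail_def power2_eq_square algebra_simps)
  moreover have "- pi / 2 < \<theta> 0" unfolding \<theta>(1) using arctan_lbound by simp
  moreover have "\<theta> 0 < 0" unfolding \<theta>(1) using Ai'_0_neg p0 by (simp add: divide_less_0_iff)
  ultimately show ?thesis using \<theta>(2,3,4) by (intro exI[of _ \<theta>]) auto
qed

text \<open>
  A polar angle of the point \<open>(c Ai(-l), Ai'(-l))\<close> that depends smoothly on \<open>l\<close>.
\<close>

definition airy_angle :: "real \<Rightarrow> real \<Rightarrow> real" where
  "airy_angle c = (SOME \<theta>. (- pi / 2 < \<theta> 0 \<and> \<theta> 0 < 0) \<and>
    (\<forall>l. (\<theta> has_real_derivative c * airy_tail (- l) / ((c * Ai (- l))\<^sup>2 + (Ai' (- l))\<^sup>2)) (at l)) \<and>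
    (\<forall>l. c * Ai (- l) = sqrt ((c * Ai (- l))\<^sup>2 + (Ai' (- l))\<^sup>2) * cos (\<theta> l)) \<and>
    (\<forall>l. Ai' (- l) = sqrt ((c * Ai (- l))\<^sup>2 + (Ai' (- l))\<^sup>2) * sin (\<theta> l)))"

definition airy_radius :: "real \<Rightarrow> real \<Rightarrow> real" where
  "airy_radius c l = sqrt ((c * Ai (- l))\<^sup>2 + (Ai' (- l))\<^sup>2)"

lemma airy_radius_pos:
  assumes "0 < c"
  shows "0 < airy_radius c l"
  using Ai_Ai'_nonzero[of "- l"] assms unfolding airy_radius_def
  by (auto simp: sum_power2_gt_zero_iff)

lemma airy_angle:
  assumes "0 < c"
  shows airy_angle_0: "- pi / 2 < airy_angle c 0" "airy_angle c 0 < 0"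
    and airy_angle_deriv: "(airy_angle c has_real_derivative c * airy_tail (- l) / (airy_radius c l)\<^sup>2) (at l)"
    and Ai_polar: "c * Ai (- l) = airy_radius c l * cos (airy_angle c l)"
    and Ai'_polar: "Ai' (- l) = airy_radius c l * sin (airy_angle c l)"
  using someI_ex[OF airy_angle_exists[OF assms]] unfolding airy_angle_def[symmetric]
  by (auto simp: airy_radius_def)

lemma airy_angle_strict_mono:
  assumes "0 < c" "x < y"
  shows "airy_angle c x < airy_angle c y"
proof (rule DERIV_pos_imp_increasing[OF assms(2)])
  fix z
  show "\<exists>w. (airy_angle c has_real_derivative w) (at z) \<and> 0 < w"
    by (intro exI[of _ "c * airy_tail (- z) / (airy_radius c z)\<^sup>2"] conjI airy_angle_deriv
          divide_pos_pos mult_pos_pos zero_less_power airy_tail_pos airy_radius_pos assms(1))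
qed

lemma airy_angle_less_iff: "0 < c \<Longrightarrow> airy_angle c x < airy_angle c y \<longleftrightarrow> x < y"
  using airy_angle_strict_mono[of c] by (metis less_asym' linorder_neqE_linordered_idom)

lemma airy_angle_le_iff: "0 < c \<Longrightarrow> airy_angle c x \<le> airy_angle c y \<longleftrightarrow> x \<le> y"
  using airy_angle_less_iff[of c] by (metis not_less)

lemma continuous_on_airy_angle: "0 < c \<Longrightarrow> continuous_on S (airy_angle c)"
  using airy_angle_deriv by (meson DERIV_isCont continuous_at_imp_continuous_on)

text \<open>
  The angle can reach \<open>-\<pi>/2\<close> only at a zero of \<open>Ai(-l)\<close> with \<open>l \<le> 0\<close>, and there is none.
\<close>

lemma airy_angle_gt:
  assumes "0 < c"
  shows "- pi / 2 < airy_angle c l"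
proof (rule ccontr)
  assume "\<not> ?thesis"
  then have le: "airy_angle c l \<le> - pi / 2" by simp
  have "l \<le> 0" using airy_angle_0(1)[OF assms] le airy_angle_strict_mono[OF assms, of 0 l] by linarith
  then obtain x where x: "l \<le> x" "x \<le> 0" "airy_angle c x = - pi / 2"
    using IVT'[of "airy_angle c" l "- pi / 2" 0] airy_angle_0(1)[OF assms] le
      continuous_on_airy_angle[OF assms] by auto
  have "c * Ai (- x) = 0" using Ai_polar[OF assms, of x] x(3) by simp
  then show False using Ai_neq_0[of "- x"] x assms by simp
qed

text \<open>
  For \<open>l \<ge> 1\<close> the angular velocity \<open>(l Ai\<^sup>2 + Ai'\<^sup>2) / (Ai\<^sup>2 + Ai'\<^sup>2)\<close> is at least \<open>1\<close>.
\<close>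

lemma airy_angle_unbounded: "\<exists>l\<ge>0. \<beta> \<le> airy_angle 1 l"
proof -
  define d where "d = max 0 (\<beta> - airy_angle 1 1)"
  have "airy_angle 1 1 + d \<le> airy_angle 1 (1 + d)"
  proof (cases "d = 0")
    case False
    then have "1 < 1 + d" by (simp add: d_def)
    then obtain z where z: "1 < z" "z < 1 + d"
      "airy_angle 1 (1 + d) - airy_angle 1 1 =
        (1 + d - 1) * (1 * airy_tail (- z) / (airy_radius 1 z)\<^sup>2)"
      using MVT2[of 1 "1 + d" "airy_angle 1" "\<lambda>z. 1 * airy_tail (- z) / (airy_radius 1 z)\<^sup>2"]
        airy_angle_deriv[OF zero_less_one] by blast
    have "1 * (Ai (- z))\<^sup>2 \<le> z * (Ai (- z))\<^sup>2" using z(1) by (intro mult_right_mono) auto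
    then have "(airy_radius 1 z)\<^sup>2 \<le> airy_tail (- z)"
      by (simp add: airy_radius_def airy_tail_def)
    then have "1 \<le> airy_tail (- z) / (airy_radius 1 z)\<^sup>2"
      using airy_radius_pos[of 1 z] by (simp add: field_simps)
    then have "d * 1 \<le> d * (airy_tail (- z) / (airy_radius 1 z)\<^sup>2)"
      by (intro mult_left_mono) (auto simp: d_def)
    then show ?thesis using z(3) by simp
  qed simp
  then show ?thesis by (intro exI[of _ "1 + d"]) (auto simp: d_def)
qed

text \<open>
  Positivity of \<open>Ai'\<^sup>2 - y Ai\<^sup>2\<close> says that \<open>tan \<theta>(-y)\<close> is below \<open>- sqrt y\<close>.
\<close>

lemma airy_angle_small:
  assumes "- pi / 2 < \<beta>" "\<beta> \<le> 0"
  shows "\<exists>l\<le>0. airy_angle 1 l \<le> \<beta>"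
proof -
  \<comment> \<open>chosen so that \<open>sqrt y = |tan \<beta>|\<close>\<close>
  define y where "y = (tan \<beta>)\<^sup>2"
  define \<theta> where "\<theta> = airy_angle 1 (- y)"
  have y: "0 \<le> y" by (simp add: y_def)
  have lo: "- pi / 2 < \<theta>" unfolding \<theta>_def by (rule airy_angle_gt) simp
  have hi: "\<theta> < 0" using airy_angle_0(2)[of 1] airy_angle_le_iff[of 1 "- y" 0] y by (simp add: \<theta>_def)
  have A: "Ai y > 0" using Ai_pos y by simp
  have c: "cos \<theta> > 0" using lo hi by (intro cos_gt_zero_pi) auto
  have "Ai y = airy_radius 1 (- y) * cos \<theta>" "Ai' y = airy_radius 1 (- y) * sin \<theta>"
    using Ai_polar[of 1 "- y"] Ai'_polar[of 1 "- y"] by (simp_all add: \<theta>_def)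
  then have m: "Ai' y = tan \<theta> * Ai y" using c by (simp add: tan_def)
  have "y * (Ai y)\<^sup>2 < (tan \<theta>)\<^sup>2 * (Ai y)\<^sup>2"
    using airy_tail_pos[of y] unfolding airy_tail_def m by (simp add: power_mult_distrib)
  then have "(tan \<beta>)\<^sup>2 < (tan \<theta>)\<^sup>2" using A by (simp add: y_def)
  then have "\<bar>tan \<beta>\<bar> < \<bar>tan \<theta>\<bar>" using abs_le_square_iff[of "tan \<theta>" "tan \<beta>"] by (meson not_le)
  moreover have "tan \<theta> < 0" using lo hi by (intro tan_less_zero) auto
  moreover have "tan \<beta> \<le> 0"
  proof (cases "\<beta> = 0")
    case False
    then show ?thesis using assms tan_less_zero[of \<beta>] by simp
  qed simp
  ultimately have "tan \<theta> < tan \<beta>" by simp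
  then have "\<theta> \<le> \<beta>"
    using tan_mono_le[of \<beta> \<theta>] lo hi assms by (cases "\<theta> \<le> \<beta>") auto
  then show ?thesis using y by (intro exI[of _ "- y"]) (simp add: \<theta>_def)
qed

lemma airy_angle_attains:
  assumes "- pi / 2 < \<beta>"
  shows "\<exists>l. airy_angle 1 l = \<beta>"
proof -
  obtain a where a: "a \<le> 0" "airy_angle 1 a \<le> \<beta>"
    using airy_angle_small[of "min \<beta> 0"] assms by auto
  obtain b where b: "b \<ge> 0" "\<beta> \<le> airy_angle 1 b" using airy_angle_unbounded by blast
  show ?thesis
    using IVT'[of "airy_angle 1" a \<beta> b] a b continuous_on_airy_angle[OF zero_less_one] by auto
qed

text \<open>
  The inverse of the angle with \<open>c = 1\<close>, on the range \<open>(-\<pi>/2, \<infinity>)\<close>.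
\<close>

definition airy_phase_inv :: "real \<Rightarrow> real" where
  "airy_phase_inv \<beta> = (THE l. airy_angle 1 l = \<beta>)"

lemma airy_angle_phase_inv:
  assumes "- pi / 2 < \<beta>"
  shows "airy_angle 1 (airy_phase_inv \<beta>) = \<beta>"
  unfolding airy_phase_inv_def
proof (rule theI')
  show "\<exists>!l. airy_angle 1 l = \<beta>"
    using airy_angle_attains[OF assms] airy_angle_less_iff[of 1]
    by (metis less_irrefl linorder_neqE_linordered_idom zero_less_one)
qed

lemma airy_phase_inv_eq_iff:
  assumes "- pi / 2 < \<beta>"
  shows "l = airy_phase_inv \<beta> \<longleftrightarrow> airy_angle 1 l = \<beta>"
  using airy_angle_phase_inv[OF assms] airy_angle_less_iff[of 1]
  by (metis less_irrefl linorder_neqE_linordered_idom zero_less_one)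

lemma airy_phase_inv_less_iff:
  assumes "- pi / 2 < \<beta>" "- pi / 2 < \<gamma>"
  shows "airy_phase_inv \<beta> < airy_phase_inv \<gamma> \<longleftrightarrow> \<beta> < \<gamma>"
  using airy_angle_less_iff[of 1 "airy_phase_inv \<beta>" "airy_phase_inv \<gamma>"]
    airy_angle_phase_inv[OF assms(1)] airy_angle_phase_inv[OF assms(2)] by simp

text \<open>
  Indices start at \<open>0\<close> here: \<open>robin_root b k\<close> is the \<open>(k + 1)\<close>-st solution of
  \<open>Ai'(-l) = b Ai(-l)\<close>.
\<close>

definition robin_root :: "real \<Rightarrow> nat \<Rightarrow> real" where
  "robin_root b k = airy_phase_inv (arctan b + real k * pi)"

lemma robin_phase_gt: "- pi / 2 < arctan b + real k * pi"
proof -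
  have "0 \<le> real k * pi" by simp
  then show ?thesis using arctan_lbound[of b] by linarith
qed

lemma airy_angle_robin_root: "airy_angle 1 (robin_root b k) = arctan b + real k * pi"
  unfolding robin_root_def by (rule airy_angle_phase_inv[OF robin_phase_gt])

lemma robin_root_strict_mono: "strict_mono (robin_root b)"
  unfolding strict_mono_def robin_root_def
  by (intro allI impI airy_phase_inv_less_iff[THEN iffD2] robin_phase_gt) simp

text \<open>
  In polar coordinates the equation reads \<open>sin (\<theta>(l) - arctan b) = 0\<close>; negative multiples of \<open>\<pi>\<close>
  are excluded by \<open>\<theta> > -\<pi>/2\<close>.
\<close>

lemma robin_equation_iff: "Ai' (- l) = b * Ai (- l) \<longleftrightarrow> (\<exists>k. l = robin_root b k)"
proof -
  define r \<theta> where "r = airy_radius 1 l" and "\<theta> = airy_angle 1 l"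
  have r: "r > 0" by (simp add: r_def airy_radius_pos)
  have A: "Ai (- l) = r * cos \<theta>" "Ai' (- l) = r * sin \<theta>"
    using Ai_polar[of 1 l] Ai'_polar[of 1 l] by (simp_all add: r_def \<theta>_def)
  have c: "cos (arctan b) > 0" by (intro cos_gt_zero_pi arctan_ubound) (use arctan_lbound in auto)
  have b: "b * cos (arctan b) = sin (arctan b)"
    using tan_arctan[of b] c by (simp add: tan_def field_simps)
  have "Ai' (- l) = b * Ai (- l) \<longleftrightarrow> sin \<theta> = b * cos \<theta>" using r by (simp add: A)
  also have "\<dots> \<longleftrightarrow> sin \<theta> * cos (arctan b) = (b * cos (arctan b)) * cos \<theta>"
    using c by auto
  also have "\<dots> \<longleftrightarrow> sin (\<theta> - arctan b) = 0" by (simp add: sin_diff b mult_ac)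
  also have "\<dots> \<longleftrightarrow> (\<exists>i::int. \<theta> - arctan b = of_int i * pi)" by (simp add: sin_zero_iff_int2)
  also have "\<dots> \<longleftrightarrow> (\<exists>k::nat. \<theta> = arctan b + real k * pi)"
  proof
    assume "\<exists>i::int. \<theta> - arctan b = of_int i * pi"
    then obtain i :: int where i: "\<theta> - arctan b = of_int i * pi" by blast
    have "- pi / 2 < \<theta>" unfolding \<theta>_def by (rule airy_angle_gt) simp
    then have "- pi < of_int i * pi" using i arctan_ubound[of b] by simp
    then have "(-1) * pi < of_int i * pi" by simp
    then have "(-1::real) < of_int i" by (subst (asm) mult_less_cancel_right_pos) auto
    then have "0 \<le> i" by linarith
    then show "\<exists>k::nat. \<theta> = arctan b + real k * pi" using i by (intro exI[of _ "nat i"]) simp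
  next
    assume "\<exists>k::nat. \<theta> = arctan b + real k * pi"
    then obtain k :: nat where "\<theta> = arctan b + real k * pi" by blast
    then show "\<exists>i::int. \<theta> - arctan b = of_int i * pi" by (intro exI[of _ "int k"]) simp
  qed
  also have "\<dots> \<longleftrightarrow> (\<exists>k. l = robin_root b k)"
    unfolding robin_root_def \<theta>_def by (simp add: airy_phase_inv_eq_iff[OF robin_phase_gt])
  finally show ?thesis .
qed

text \<open>
  Both \<open>airy_deriv_zero\<close> and \<open>lam\<close> pick an element by the number of its predecessors.
\<close>

lemma nth_smallest_iff:
  fixes x :: "nat \<Rightarrow> real"
  assumes x: "strict_mono x" and P: "\<And>l. P l \<longleftrightarrow> (\<exists>k. l = x k)"
  shows "P l \<and> finite {y. y < l \<and> P y} \<and> card {y. y < l \<and> P y} + 1 = Suc n \<longleftrightarrow> l = x n"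
proof -
  have below: "{y. y < x k \<and> P y} = x ` {..<k}" for k
    using strict_mono_less[OF x] by (auto simp: P)
  have card: "card {y. y < x k \<and> P y} = k" for k
    unfolding below using strict_mono_imp_inj_on[OF x] by (simp add: card_image inj_on_subset)
  have fin: "finite {y. y < x k \<and> P y}" for k unfolding below by simp
  show ?thesis
  proof
    assume l: "P l \<and> finite {y. y < l \<and> P y} \<and> card {y. y < l \<and> P y} + 1 = Suc n"
    then obtain k where "l = x k" using P by blast
    then show "l = x n" using l card[of k] by simp
  next
    assume l: "l = x n"
    have "P (x n)" using P by blast
    then show "P l \<and> finite {y. y < l \<and> P y} \<and> card {y. y < l \<and> P y} + 1 = Suc n"
      unfolding l using card[of n] fin[of n] by simp
  qed
qed

lemma airy_deriv_zero_eq: "airy_deriv_zero (Suc k) = - robin_root 0 k"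
proof -
  have P: "deriv Ai (- l) = 0 \<longleftrightarrow> (\<exists>k. l = robin_root 0 k)" for l
    using robin_equation_iff[of l 0] by (simp add: deriv_Ai)
  have "deriv Ai a = 0 \<and> finite {y. a < y \<and> deriv Ai y = 0} \<and>
             card {y. a < y \<and> deriv Ai y = 0} + 1 = Suc k \<longleftrightarrow> a = - robin_root 0 k" for a :: real
  proof -
    define S where "S = {y. a < y \<and> deriv Ai y = 0}"
    have img: "{y. y < - a \<and> deriv Ai (- y) = 0} = uminus ` S"
    proof (intro equalityI subsetI)
      fix y assume "y \<in> {y. y < - a \<and> deriv Ai (- y) = 0}"
      then have "- y \<in> S" by (auto simp: S_def)
      then show "y \<in> uminus ` S" by (rule rev_image_eqI) simp
    qed (auto simp: S_def)
    have "finite {y. y < - a \<and> deriv Ai (- y) = 0} \<longleftrightarrow> finite S"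
      unfolding img by (simp add: finite_image_iff)
    moreover have "card {y. y < - a \<and> deriv Ai (- y) = 0} = card S"
      unfolding img by (simp add: card_image)
    moreover have "deriv Ai a = 0 \<longleftrightarrow> deriv Ai (- (- a)) = 0" by simp
    ultimately have "deriv Ai a = 0 \<and> finite S \<and> card S + 1 = Suc k \<longleftrightarrow> - a = robin_root 0 k"
      using nth_smallest_iff[OF robin_root_strict_mono P, of "- a" k] by simp
    then show ?thesis unfolding S_def by auto
  qed
  then show ?thesis unfolding airy_deriv_zero_def by simp
qed

lemma robin_root_0_pos: "0 < robin_root 0 k"
proof -
  have "0 \<le> real k * pi" by simp
  moreover have "airy_angle 1 (robin_root 0 k) = real k * pi" by (simp add: airy_angle_robin_root)
  ultimately have "airy_angle 1 0 < airy_angle 1 (robin_root 0 k)"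
    using airy_angle_0(2)[OF zero_less_one] by linarith
  then show ?thesis using airy_angle_less_iff[of 1] by simp
qed

text \<open>
  Sturm comparison. With \<open>c\<^sup>2\<close> the larger of the two roots, the angle of \<open>(c Ai(-l), Ai'(-l))\<close> has
  velocity \<open>c (l Ai\<^sup>2 + Ai'\<^sup>2) / (c\<^sup>2 Ai\<^sup>2 + Ai'\<^sup>2) \<le> c\<close> between them, while it advances by at
  least \<open>\<pi>\<close>.
\<close>

lemma robin_root_0_spacing:
  "pi \<le> sqrt (robin_root 0 (Suc k)) * (robin_root 0 (Suc k) - robin_root 0 k)"
proof -
  define a b where "a = robin_root 0 k" and "b = robin_root 0 (Suc k)"
  define c where "c = sqrt b"
  have ab: "0 < a" "a < b" unfolding a_def b_def
    using robin_root_0_pos robin_root_strict_mono by (auto simp: strict_mono_def)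
  have c: "0 < c" "c\<^sup>2 = b" using ab by (auto simp: c_def)
  have zero: "\<exists>i::int. airy_angle c (robin_root 0 j) = of_int i * pi" for j
  proof -
    have "Ai' (- robin_root 0 j) = 0" using robin_equation_iff[of "robin_root 0 j" 0] by auto
    then have "sin (airy_angle c (robin_root 0 j)) = 0"
      using Ai'_polar[OF c(1), of "robin_root 0 j"] airy_radius_pos[OF c(1), of "robin_root 0 j"]
        by simp
    then show ?thesis by (simp add: sin_zero_iff_int2)
  qed
  obtain i j :: int where ij: "airy_angle c a = of_int i * pi" "airy_angle c b = of_int j * pi"
    using zero unfolding a_def b_def by metis
  have "airy_angle c a < airy_angle c b" using ab c by (intro airy_angle_strict_mono)
  then have "of_int i * pi < of_int j * pi" using ij by simp
  then have "i < j" by (subst (asm) mult_less_cancel_right_pos) auto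
  then have "(1::real) * pi \<le> (of_int j - of_int i) * pi" by (intro mult_right_mono) auto
  then have "pi \<le> airy_angle c b - airy_angle c a" using ij by (simp add: algebra_simps)
  also obtain z where z: "a < z" "z < b"
      "airy_angle c b - airy_angle c a = (b - a) * (c * airy_tail (- z) / (airy_radius c z)\<^sup>2)"
    using MVT2[OF ab(2), of "airy_angle c" "\<lambda>z. c * airy_tail (- z) / (airy_radius c z)\<^sup>2"]
      airy_angle_deriv[OF c(1)] by blast
  note z(3)
  also have "(b - a) * (c * airy_tail (- z) / (airy_radius c z)\<^sup>2) \<le> (b - a) * c"
  proof (rule mult_left_mono)
    have "z * (Ai (- z))\<^sup>2 \<le> c\<^sup>2 * (Ai (- z))\<^sup>2" using z c by (intro mult_right_mono) auto
    then have "airy_tail (- z) \<le> (airy_radius c z)\<^sup>2"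
      by (simp add: airy_radius_def airy_tail_def power_mult_distrib)
    then have "c * airy_tail (- z) \<le> c * (airy_radius c z)\<^sup>2" using c by (intro mult_left_mono) auto
    then show "c * airy_tail (- z) / (airy_radius c z)\<^sup>2 \<le> c"
      using airy_radius_pos[OF c(1), of z] by (simp add: field_simps)
  qed (use ab in simp)
  finally show ?thesis by (simp add: a_def b_def c_def mult.commute)
qed

text \<open>
  With \<open>a < b\<close> consecutive roots, \<open>b sqrt b - a sqrt a \<ge> (b - a) sqrt b \<ge> \<pi>\<close>; these bounds add up.
\<close>

lemma robin_root_0_growth: "real k * pi \<le> robin_root 0 k * sqrt (robin_root 0 k)"
proof (induction k)
  case 0 then show ?case using robin_root_0_pos[of 0] by simp
next
  case (Suc k)
  define a b where "a = robin_root 0 k" and "b = robin_root 0 (Suc k)"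
  have ab: "0 < a" "a < b" unfolding a_def b_def
    using robin_root_0_pos robin_root_strict_mono by (auto simp: strict_mono_def)
  have "a * sqrt a \<le> a * sqrt b" using ab by (intro mult_left_mono) auto
  moreover have "pi \<le> sqrt b * (b - a)" using robin_root_0_spacing[of k] by (simp add: a_def b_def)
  ultimately have "real k * pi + pi \<le> b * sqrt b" using Suc.IH by (simp add: a_def b_def algebra_simps)
  then show ?case by (simp add: b_def algebra_simps)
qed

lemma robin_root_0_lower: "(real k) powr (2/3) \<le> robin_root 0 k"
proof -
  define a where "a = robin_root 0 k"
  have a: "0 < a" unfolding a_def by (rule robin_root_0_pos)
  have "real k \<le> real k * pi" using pi_ge_two mult_left_mono[of 1 pi "real k"] by simp
  also have "\<dots> \<le> a * sqrt a" using robin_root_0_growth by (simp add: a_def)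
  also have "\<dots> = a powr (3/2)" using a by (simp add: powr_half_sqrt[symmetric] powr_mult_base)
  finally have "(real k) powr (2/3) \<le> (a powr (3/2)) powr (2/3)" by (intro powr_mono2) auto
  also have "\<dots> = a" using a by (simp add: powr_powr)
  finally show ?thesis by (simp add: a_def)
qed

section \<open>Eigenvalues and eigenfunctions\<close>

text \<open>
  The eigenfunction for the eigenvalue \<open>l\<close>, up to a constant factor.
\<close>

definition airy_fun :: "real \<Rightarrow> real \<Rightarrow> complex" where
  "airy_fun l x = of_real (Ai (x - l))"

definition airy_fun' :: "real \<Rightarrow> real \<Rightarrow> complex" where
  "airy_fun' l x = of_real (Ai' (x - l))"

lemma has_real_derivative_shift:
  assumes "(f has_real_derivative d) (at (x - l))"
  shows "((\<lambda>x. f (x - l)) has_real_derivative d) (at x within S)"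
proof -
  have s: "((\<lambda>x. x - l) has_real_derivative 1) (at x within S)" by (auto intro!: derivative_eq_intros)
  show ?thesis using DERIV_chain2[where f = f and g = "\<lambda>x. x - l", OF assms s] by simp
qed

lemma airy_fun_deriv: "(airy_fun l has_vector_derivative airy_fun' l x) (at x within S)"
proof -
  have "((\<lambda>x. Ai (x - l)) has_real_derivative Ai' (x - l)) (at x within S)"
    by (rule has_real_derivative_shift[OF Ai_deriv])
  then show ?thesis unfolding airy_fun_def[abs_def] airy_fun'_def
    by (intro has_vector_derivative_of_real) (simp add: has_real_derivative_iff_has_vector_derivative)
qed

lemma airy_fun'_deriv:
  "(airy_fun' l has_vector_derivative of_real (x - l) * airy_fun l x) (at x within S)"
proof -
  have "((\<lambda>x. Ai' (x - l)) has_real_derivative (x - l) * Ai (x - l)) (at x within S)"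
    by (rule has_real_derivative_shift[OF Ai'_deriv])
  then have "((\<lambda>x. complex_of_real (Ai' (x - l))) has_vector_derivative of_real ((x - l) * Ai (x - l))) (at x within S)"
    by (intro has_vector_derivative_of_real) (simp add: has_real_derivative_iff_has_vector_derivative)
  then show ?thesis unfolding airy_fun_def airy_fun'_def[abs_def] by simp
qed

lemma continuous_on_airy_fun: "continuous_on S (airy_fun l)"
  by (rule continuous_on_vector_derivative[OF airy_fun_deriv])

lemma continuous_on_airy_fun': "continuous_on S (airy_fun' l)"
  by (rule continuous_on_vector_derivative[OF airy_fun'_deriv])

lemma hderiv_eq:
  assumes "0 \<le> x" "(f has_vector_derivative d) (at x within {0..})"
  shows "hderiv f x = d"
  unfolding hderiv_def by (rule vector_derivative_within[OF at_halfline_neq_bot[OF assms(1)] assms(2)])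

lemma hderiv_airy_fun: "0 \<le> x \<Longrightarrow> hderiv (airy_fun l) x = airy_fun' l x"
  by (rule hderiv_eq[OF _ airy_fun_deriv])

lemma hderiv_airy_fun_deriv:
  assumes "0 \<le> x"
  shows "(hderiv (airy_fun l) has_vector_derivative of_real (x - l) * airy_fun l x) (at x within {0..})"
  by (rule has_vector_derivative_transform[OF _ _ airy_fun'_deriv[of l]])
     (use assms in \<open>auto simp: hderiv_airy_fun\<close>)

lemma stark_op_airy_fun: "0 \<le> x \<Longrightarrow> stark_op (airy_fun l) x = of_real l * airy_fun l x"
  unfolding stark_op_def by (simp add: hderiv_eq[OF _ hderiv_airy_fun_deriv] algebra_simps)

text \<open>
  The primitive \<open>- airy_tail (x - l)\<close> of \<open>Ai(x - l)\<^sup>2\<close> tends to \<open>0\<close> at infinity.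
\<close>

lemma airy_sq_integral:
  "integrable (lebesgue_on {0..}) (\<lambda>x. (Ai (x - l))\<^sup>2)"
  "integral\<^sup>L (lebesgue_on {0..}) (\<lambda>x. (Ai (x - l))\<^sup>2) = airy_tail (- l)"
proof -
  have cont: "continuous_on UNIV (\<lambda>x::real. (Ai (x - l))\<^sup>2)"
    by (intro continuous_intros continuous_on_compose2[OF continuous_on_Ai[of UNIV]]) auto
  then have m: "(\<lambda>x::real. (Ai (x - l))\<^sup>2) \<in> borel_measurable borel"
    by (rule borel_measurable_continuous_onI)
  have "filterlim (\<lambda>x::real. x - l) at_top at_top"
    using filterlim_tendsto_add_at_top[OF tendsto_const[of "- l"] filterlim_ident] by simp
  from tendsto_minus[OF filterlim_compose[OF airy_tail_tendsto this]]
  have lim: "((\<lambda>x. - airy_tail (x - l)) \<longlongrightarrow> 0) at_top" by simp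
  have d: "((\<lambda>x. - airy_tail (x - l)) has_real_derivative (Ai (x - l))\<^sup>2) (at x)" for x
    using DERIV_minus[OF has_real_derivative_shift[OF airy_tail_deriv[of "x - l"], of UNIV]] by simp
  have nn: "(\<integral>\<^sup>+x. ennreal ((Ai (x - l))\<^sup>2) * indicator {0..} x \<partial>lborel) = ennreal (airy_tail (- l))"
    using nn_integral_FTC_atLeast[OF m d _ lim, of 0] by simp
  have hb: "has_bochner_integral lborel (\<lambda>x. indicator {0..} x *\<^sub>R (Ai (x - l))\<^sup>2) (airy_tail (- l))"
  proof (rule has_bochner_integral_nn_integral)
    show "(\<lambda>x. indicator {0..} x *\<^sub>R (Ai (x - l))\<^sup>2) \<in> borel_measurable lborel" using m by measurable
    show "(\<integral>\<^sup>+x. ennreal (indicator {0..} x *\<^sub>R (Ai (x - l))\<^sup>2) \<partial>lborel) = ennreal (airy_tail (- l))"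
      unfolding nn[symmetric] by (intro nn_integral_cong) (auto simp: indicator_def)
  qed (auto simp: airy_tail_pos less_imp_le)
  have "has_bochner_integral lebesgue (\<lambda>x. indicator {0..} x *\<^sub>R (Ai (x - l))\<^sup>2) (airy_tail (- l))"
    using hb by (auto simp: has_bochner_integral_iff integrable_completion integral_completion)
  then show "integrable (lebesgue_on {0..}) (\<lambda>x. (Ai (x - l))\<^sup>2)"
    "integral\<^sup>L (lebesgue_on {0..}) (\<lambda>x. (Ai (x - l))\<^sup>2) = airy_tail (- l)"
    by (auto simp: has_bochner_integral_iff integrable_restrict_space integral_restrict_space)
qed

lemma borel_measurable_halfline:
  fixes f :: "real \<Rightarrow> 'v::euclidean_space"
  assumes "continuous_on {0..} f"
  shows "f \<in> borel_measurable (lebesgue_on {0..})"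
  by (rule continuous_imp_measurable_on_sets_lebesgue[OF assms]) simp

lemma L2_halfline_cong:
  assumes "\<And>x. 0 \<le> x \<Longrightarrow> f x = g x"
  shows "f \<in> L2_halfline \<longleftrightarrow> g \<in> L2_halfline"
proof -
  have "f \<in> borel_measurable (lebesgue_on {0..}) \<longleftrightarrow> g \<in> borel_measurable (lebesgue_on {0..})"
    using assms by (intro measurable_cong) auto
  moreover have "integrable (lebesgue_on {0..}) (\<lambda>x. (cmod (f x))\<^sup>2) \<longleftrightarrow>
    integrable (lebesgue_on {0..}) (\<lambda>x. (cmod (g x))\<^sup>2)"
    using assms by (intro Bochner_Integration.integrable_cong) auto
  ultimately show ?thesis by (simp add: L2_halfline_def)
qed

lemma airy_fun_L2: "(\<lambda>x. c * airy_fun l x) \<in> L2_halfline"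
proof -
  have "(cmod (c * airy_fun l x))\<^sup>2 = (cmod c)\<^sup>2 * (Ai (x - l))\<^sup>2" for x
    by (simp add: airy_fun_def norm_mult power_mult_distrib)
  moreover have "(\<lambda>x. c * airy_fun l x) \<in> borel_measurable (lebesgue_on {0..})"
    by (intro borel_measurable_halfline continuous_intros continuous_on_airy_fun)
  ultimately show ?thesis unfolding L2_halfline_def using airy_sq_integral(1)[of l] by simp
qed

lemma robin_root_imp_eigenvalue:
  assumes "Ai' (- l) = b * Ai (- l)"
  shows "stark_eigenvalue b (of_real l)"
  unfolding stark_eigenvalue_def
proof (intro bexI[of _ "airy_fun l"] conjI)
  have "airy_fun l \<in> L2_halfline" using airy_fun_L2[of 1 l] by simp
  moreover have "airy_fun l \<in> AC_loc"
    by (rule AC_loc_of_derivative[OF airy_fun_deriv continuous_on_airy_fun'])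
  moreover have "hderiv (airy_fun l) \<in> AC_loc"
    by (rule AC_loc_of_derivative[OF hderiv_airy_fun_deriv])
       (auto intro!: continuous_intros continuous_on_airy_fun)
  moreover have "stark_op (airy_fun l) \<in> L2_halfline"
    using L2_halfline_cong[of "stark_op (airy_fun l)" "\<lambda>x. of_real l * airy_fun l x"]
    by (simp add: stark_op_airy_fun airy_fun_L2)
  moreover have "hderiv (airy_fun l) 0 - of_real b * airy_fun l 0 = 0"
    using assms by (simp add: hderiv_airy_fun airy_fun_def airy_fun'_def)
  ultimately show "airy_fun l \<in> stark_domain b" by (simp add: stark_domain_def)
  show "\<not> (AE x in lebesgue_on {0..}. airy_fun l x = 0)"
  proof
    assume "AE x in lebesgue_on {0..}. airy_fun l x = 0"
    then have "AE x in lebesgue_on {0..}. (Ai (x - l))\<^sup>2 = 0" by (auto simp: airy_fun_def)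
    then have "integral\<^sup>L (lebesgue_on {0..}) (\<lambda>x. (Ai (x - l))\<^sup>2) = 0" by (rule integral_eq_zero_AE)
    then show False using airy_sq_integral(2)[of l] airy_tail_pos[of "- l"] by simp
  qed
  show "AE x in lebesgue_on {0..}. stark_op (airy_fun l) x = of_real l * airy_fun l x"
    by (intro AE_I2) (simp add: stark_op_airy_fun)
qed

text \<open>
  Otherwise \<open>h \<ge> c\<close> on \<open>[x0 + 1, \<infinity>)\<close>.
\<close>

lemma integrable_halfline_sublinear:
  fixes h :: "real \<Rightarrow> real"
  assumes h: "integrable (lebesgue_on {0..}) h" and nonneg: "\<And>x. 0 \<le> x \<Longrightarrow> 0 \<le> h x"
    and "0 < c" "0 \<le> x0"
  shows "\<exists>x\<ge>x0. h x < c * (x - x0)"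
proof (rule ccontr)
  assume "\<not> ?thesis"
  then have ge: "c * (x - x0) \<le> h x" if "x0 \<le> x" for x using that by (meson not_le)
  define I where "I = integral\<^sup>L (lebesgue_on {0..}) h"
  obtain n :: nat where n: "I / c < real n" using reals_Archimedean2 by blast
  define S where "S = {x0 + 1..x0 + 1 + real n}"
  have S: "S \<in> lmeasurable" "measure lebesgue S = real n" by (simp_all add: S_def)
  have hi: "integrable lebesgue (\<lambda>x. indicator {0..} x *\<^sub>R h x)" and
    I: "I = integral\<^sup>L lebesgue (\<lambda>x. indicator {0..} x *\<^sub>R h x)"
    using h by (simp_all add: I_def integrable_restrict_space integral_restrict_space)
  have "c * real n = integral\<^sup>L lebesgue (\<lambda>x. c * indicator S x)"
    using S by simp
  also have "\<dots> \<le> I" unfolding I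
  proof (rule integral_mono[OF _ hi])
    show "integrable lebesgue (\<lambda>x. c * indicator S x)" using S by (auto simp: fmeasurable_def)
    fix x :: real
    show "c * indicator S x \<le> indicator {0..} x *\<^sub>R h x"
    proof (cases "x \<in> S")
      case True
      then have x: "x0 + 1 \<le> x" by (simp add: S_def)
      have "c * 1 \<le> c * (x - x0)" using x \<open>0 < c\<close> by (intro mult_left_mono) auto
      also have "\<dots> \<le> h x" using x by (intro ge) simp
      finally show ?thesis using True x \<open>0 \<le> x0\<close> by simp
    next
      case False
      then show ?thesis using nonneg[of x] by (simp add: indicator_def)
    qed
  qed
  finally show False using n \<open>0 < c\<close> by (simp add: field_simps)
qed

lemma L2_diff:
  assumes "f \<in> L2_halfline" "g \<in> L2_halfline"
  shows "integrable (lebesgue_on {0..}) (\<lambda>x. (cmod (f x - g x))\<^sup>2)"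
proof (rule Bochner_Integration.integrable_bound)
  show "integrable (lebesgue_on {0..}) (\<lambda>x. 2 * (cmod (f x))\<^sup>2 + 2 * (cmod (g x))\<^sup>2)"
    using assms by (simp add: L2_halfline_def)
  have "f \<in> borel_measurable (lebesgue_on {0..})" "g \<in> borel_measurable (lebesgue_on {0..})"
    using assms by (simp_all add: L2_halfline_def)
  then show "(\<lambda>x. (cmod (f x - g x))\<^sup>2) \<in> borel_measurable (lebesgue_on {0..})" by measurable
  show "AE x in lebesgue_on {0..}. norm ((cmod (f x - g x))\<^sup>2) \<le>
    norm (2 * (cmod (f x))\<^sup>2 + 2 * (cmod (g x))\<^sup>2)"
  proof (intro AE_I2)
    fix x
    have "(cmod (f x - g x))\<^sup>2 \<le> (cmod (f x) + cmod (g x))\<^sup>2"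
      by (intro power_mono norm_triangle_ineq4) simp
    also have "\<dots> \<le> 2 * (cmod (f x))\<^sup>2 + 2 * (cmod (g x))\<^sup>2"
      using zero_le_power2[of "cmod (f x) - cmod (g x)"] by (simp add: power2_sum power2_diff)
    finally show "norm ((cmod (f x - g x))\<^sup>2) \<le> norm (2 * (cmod (f x))\<^sup>2 + 2 * (cmod (g x))\<^sup>2)" by simp
  qed
qed

text \<open>
  Beyond \<open>x0\<close> the function \<open>|w|\<^sup>2\<close> is convex; being integrable it is nonincreasing, so it stays
  \<open>0\<close> once it vanishes. The zero then propagates back to \<open>0\<close> along the energy \<open>|w|\<^sup>2 + |w'|\<^sup>2\<close>.
\<close>

lemma airy_ode_unique_L2:
  fixes w w' :: "real \<Rightarrow> complex"
  assumes dw: "\<And>x. 0 \<le> x \<Longrightarrow> (w has_vector_derivative w' x) (at x within {0..})"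
    and dw': "\<And>x. 0 \<le> x \<Longrightarrow> (w' has_vector_derivative of_real (x - l) * w x) (at x within {0..})"
    and int: "integrable (lebesgue_on {0..}) (\<lambda>x. (cmod (w x))\<^sup>2)"
    and x0: "0 < x0" "l \<le> x0" and zero: "w x0 = 0" and "0 \<le> a"
  shows "w a = 0 \<and> w' a = 0"
proof -
  have at: "at x within {0..} = at x" if "0 < x" for x :: real
    using that by (intro at_within_interior) simp
  have d1: "(w has_vector_derivative w' x) (at x)" if "0 < x" for x using dw[of x] at[OF that] that
    by simp
  have d2: "(w' has_vector_derivative of_real (x - l) * w x) (at x)" if "0 < x" for x
    using dw'[of x] at[OF that] that by simp
  have sc: "u \<bullet> (of_real r * v) = r * (u \<bullet> v)" for u v :: complex and r :: real
    by (simp flip: scaleR_conv_of_real)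
  have dww: "((\<lambda>x. w x \<bullet> w x) has_real_derivative 2 * (w x \<bullet> w' x)) (at x)" if "0 < x" for x
    using bounded_bilinear.has_vector_derivative[OF bounded_bilinear_inner d1[OF that] d1[OF that]]
    by (simp add: has_real_derivative_iff_has_vector_derivative inner_commute)
  have dww': "((\<lambda>x. w x \<bullet> w' x) has_real_derivative (w' x \<bullet> w' x) + (x - l) * (w x \<bullet> w x)) (at x)" if "0 < x" for x
    using bounded_bilinear.has_vector_derivative[OF bounded_bilinear_inner d1[OF that] d2[OF that]]
    unfolding sc by (simp add: has_real_derivative_iff_has_vector_derivative add.commute)
  have dw'w': "((\<lambda>x. w' x \<bullet> w' x) has_real_derivative 2 * ((x - l) * (w x \<bullet> w' x))) (at x)" if "0 < x" for x
    using bounded_bilinear.has_vector_derivative[OF bounded_bilinear_inner d2[OF that] d2[OF that]]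
    unfolding sc inner_commute[of "of_real (x - l) * w x"]
    by (simp add: has_real_derivative_iff_has_vector_derivative inner_commute)
  have int': "integrable (lebesgue_on {0..}) (\<lambda>x. w x \<bullet> w x)" using int
    by (simp add: power2_norm_eq_inner)
  have mono: "w x \<bullet> w' x \<le> w y \<bullet> w' y" if "x0 \<le> x" "x \<le> y" for x y
  proof (rule DERIV_nonneg_imp_nondecreasing[OF that(2)])
    fix z assume z: "x \<le> z" "z \<le> y"
    have "0 \<le> (w' z \<bullet> w' z) + (z - l) * (w z \<bullet> w z)" using z that x0 by simp
    then show "\<exists>d. ((\<lambda>x. w x \<bullet> w' x) has_real_derivative d) (at z) \<and> 0 \<le> d"
      using dww'[of z] z that x0 by auto
  qed
  have nonpos: "2 * (w x \<bullet> w' x) \<le> 0" if "x0 \<le> x" for x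
  proof (rule convex_sublinear_nonincreasing[where a = x0 and h = "\<lambda>x. w x \<bullet> w x" and h' =
    "\<lambda>x. 2 * (w x \<bullet> w' x)"])
    show "((\<lambda>x. w x \<bullet> w x) has_real_derivative 2 * (w x \<bullet> w' x)) (at x)" if "x0 \<le> x" for x
      using dww[of x] that x0 by simp
    show "\<exists>x\<ge>y. w x \<bullet> w x < c * (x - y)" if "0 < c" "x0 \<le> y" for c y
      by (rule integrable_halfline_sublinear[OF int']) (use that x0 in auto)
  qed (use mono that in auto)
  have w0: "w x = 0" if "x0 \<le> x" for x
  proof -
    have "w x \<bullet> w x \<le> w x0 \<bullet> w x0"
    proof (rule DERIV_nonpos_imp_nonincreasing[OF that])
      fix z assume z: "x0 \<le> z" "z \<le> x"
      then show "\<exists>d. ((\<lambda>x. w x \<bullet> w x) has_real_derivative d) (at z) \<and> d \<le> 0"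
        using dww[of z] nonpos[of z] x0 by auto
    qed
    then show ?thesis using zero
      by (metis inner_eq_zero_iff inner_ge_zero inner_zero_left order_antisym)
  qed
  have w'0: "w' x = 0" if "x0 < x" for x
  proof -
    have "(w has_vector_derivative 0) (at x)"
      by (rule has_vector_derivative_transform_within_open[of "\<lambda>_. 0" _ _ "{x0<..}"])
         (use that w0 in auto)
    then show ?thesis using vector_derivative_unique_at[OF d1] that x0 by fastforce
  qed
  show ?thesis
  proof (cases "x0 < a")
    case True
    then show ?thesis using w0 w'0 by simp
  next
    case False
    \<comment> \<open>a point beyond \<open>x0\<close>, where \<open>w\<close> and \<open>w'\<close> both vanish\<close>
    define X where "X = x0 + 1"
    define E where "E x = w x \<bullet> w x + w' x \<bullet> w' x" for x
    have aX: "a \<le> X" using False by (simp add: X_def)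
    have "E a = 0"
    proof (rule backward_zero_propagation[OF aX, where E' =
      "\<lambda>x. 2 * ((1 + x - l) * (w x \<bullet> w' x))" and K = "1 + X + \<bar>l\<bar>"])
      have "continuous_on {0..} w" by (rule continuous_on_vector_derivative, rule dw) simp
      moreover have "continuous_on {0..} w'" by (rule continuous_on_vector_derivative, rule dw') simp
      ultimately have "continuous_on {a..X} w" "continuous_on {a..X} w'"
        using \<open>0 \<le> a\<close> by (auto elim: continuous_on_subset)
      then show "continuous_on {a..X} E" unfolding E_def by (intro continuous_intros)
      show "0 \<le> E x" for x by (simp add: E_def)
      show "E X = 0" using w0[of X] w'0[of X] by (simp add: E_def X_def)
      fix x assume x: "a < x" "x < X"
      then have "0 < x" using \<open>0 \<le> a\<close> by simp
      show "(E has_real_derivative 2 * ((1 + x - l) * (w x \<bullet> w' x))) (at x)"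
        unfolding E_def[abs_def]
        using DERIV_add[OF dww[OF \<open>0 < x\<close>] dw'w'[OF \<open>0 < x\<close>]] by (simp add: algebra_simps)
      have "2 * \<bar>w x \<bullet> w' x\<bar> \<le> E x"
        using inner_ge_zero[of "w x + w' x"] inner_ge_zero[of "w x - w' x"]
        by (auto simp: E_def inner_add inner_diff inner_commute abs_le_iff)
      moreover have "\<bar>1 + x - l\<bar> \<le> 1 + X + \<bar>l\<bar>" using x \<open>0 < x\<close> by linarith
      ultimately have "\<bar>1 + x - l\<bar> * (2 * \<bar>w x \<bullet> w' x\<bar>) \<le> (1 + X + \<bar>l\<bar>) * E x"
        by (intro mult_mono) auto
      then have "\<bar>2 * ((1 + x - l) * (w x \<bullet> w' x))\<bar> \<le> (1 + X + \<bar>l\<bar>) * E x"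
        by (simp add: abs_mult mult_ac)
      then show "- ((1 + X + \<bar>l\<bar>) * E x) \<le> 2 * ((1 + x - l) * (w x \<bullet> w' x))" by (simp add: abs_le_iff)
    qed
    then have "w a \<bullet> w a = 0" "w' a \<bullet> w' a = 0"
      unfolding E_def using inner_ge_zero[of "w a"] inner_ge_zero[of "w' a"] by linarith+
    then show ?thesis by simp
  qed
qed

text \<open>
  Subtracting from an eigenfunction the multiple of \<open>Ai(x - l)\<close> with the same value at a point
  \<open>x0\<close> leaves a square integrable solution with a zero there, which is \<open>0\<close>. So the eigenfunction
  is this multiple.
\<close>

lemma eigenvalue_imp_robin_root:
  assumes "stark_eigenvalue b (of_real l)"
  shows "Ai' (- l) = b * Ai (- l)"
proof -
  obtain \<phi> where \<phi>: "\<phi> \<in> stark_domain b" "\<not> (AE x in lebesgue_on {0..}. \<phi> x = 0)"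
    "AE x in lebesgue_on {0..}. stark_op \<phi> x = of_real l * \<phi> x"
    using assms unfolding stark_eigenvalue_def by blast
  define g where "g = hderiv \<phi>"
  have dom: "\<phi> \<in> L2_halfline" "\<phi> \<in> AC_loc" "g \<in> AC_loc" "g 0 = of_real b * \<phi> 0"
    using \<phi>(1) by (auto simp: stark_domain_def g_def)
  have d\<phi>: "(\<phi> has_vector_derivative g x) (at x within {0..})" if "0 \<le> x" for x
    by (rule AC_loc_has_derivative[OF dom(2) AC_loc_continuous[OF dom(3)] _ that]) (simp add: g_def)
  have ae: "AE x in lebesgue_on {0..}. hderiv g x = of_real (x - l) * \<phi> x"
    using \<phi>(3)
  proof (rule AE_mp, intro AE_I2 impI)
    fix x assume "stark_op \<phi> x = of_real l * \<phi> x"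
    then show "hderiv g x = of_real (x - l) * \<phi> x"
      unfolding stark_op_def g_def of_real_diff left_diff_distrib
        by (metis add.commute add_diff_cancel diff_add_cancel minus_diff_eq uminus_add_conv_diff)
  qed
  have dg: "(g has_vector_derivative of_real (x - l) * \<phi> x) (at x within {0..})" if "0 \<le> x" for x
    by (rule AC_loc_has_derivative[OF dom(3) _ ae that])
       (intro continuous_intros AC_loc_continuous[OF dom(2)])
  define x0 where "x0 = \<bar>l\<bar> + 1"
  have x0: "0 < x0" "l \<le> x0" by (auto simp: x0_def)
  have A0: "airy_fun l x0 \<noteq> 0" using Ai_neq_0[of "x0 - l"] x0 by (simp add: airy_fun_def)
  define c where "c = \<phi> x0 / airy_fun l x0"
  define w where "w x = \<phi> x - c * airy_fun l x" for x
  define w' where "w' x = g x - c * airy_fun' l x" for x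
  have dw: "(w has_vector_derivative w' x) (at x within {0..})" if "0 \<le> x" for x
    unfolding w_def[abs_def] w'_def
    by (intro has_vector_derivative_diff d\<phi>[OF that] has_vector_derivative_mult_right airy_fun_deriv)
  have dw': "(w' has_vector_derivative of_real (x - l) * w x) (at x within {0..})" if "0 \<le> x" for x
  proof -
    have "(w' has_vector_derivative of_real (x - l) * \<phi> x - c * (of_real (x - l) * airy_fun l x)) (at x within {0..})"
      unfolding w'_def[abs_def]
      by (intro has_vector_derivative_diff dg[OF that] has_vector_derivative_mult_right airy_fun'_deriv)
    then show ?thesis by (simp add: w_def algebra_simps)
  qed
  have int: "integrable (lebesgue_on {0..}) (\<lambda>x. (cmod (w x))\<^sup>2)"
    unfolding w_def by (rule L2_diff[OF dom(1) airy_fun_L2])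
  have wx0: "w x0 = 0" using A0 by (simp add: w_def c_def)
  have zero: "w a = 0 \<and> w' a = 0" if "0 \<le> a" for a
    by (rule airy_ode_unique_L2[OF _ _ int x0 wx0 that]) (use dw dw' in blast)+
  have "c \<noteq> 0"
  proof
    assume "c = 0"
    then have "\<phi> x = 0" if "0 \<le> x" for x using zero[OF that] by (simp add: w_def)
    then have "AE x in lebesgue_on {0..}. \<phi> x = 0" by (intro AE_I2) simp
    with \<phi>(2) show False by blast
  qed
  moreover have "\<phi> 0 = c * airy_fun l 0" "g 0 = c * airy_fun' l 0"
    using zero[of 0] by (simp_all add: w_def w'_def)
  ultimately have "airy_fun' l 0 = of_real b * airy_fun l 0" using dom(4) by simp
  then have "complex_of_real (Ai' (- l)) = of_real (b * Ai (- l))"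
    by (simp add: airy_fun_def airy_fun'_def)
  then show ?thesis using of_real_eq_iff by blast
qed

lemma stark_eigenvalue_iff: "stark_eigenvalue b (of_real l) \<longleftrightarrow> Ai' (- l) = b * Ai (- l)"
  using eigenvalue_imp_robin_root robin_root_imp_eigenvalue by blast

lemma psi0_of_real: "psi0 (of_real l) x = of_real (sqrt pi) * airy_fun l x"
  unfolding psi0_def airy_fun_def using Ai_of_real[of "x - l"] by simp

lemma psi0_norm: "(L2_norm_halfline (psi0 (of_real l)))\<^sup>2 = pi * airy_tail (- l)"
proof -
  have eq: "(cmod (psi0 (of_real l) x))\<^sup>2 = pi * (Ai (x - l))\<^sup>2" for x
    by (simp add: psi0_of_real airy_fun_def norm_mult power_mult_distrib)
  have "(LINT x|lebesgue_on {0..}. (cmod (psi0 (of_real l) x))\<^sup>2) = pi * airy_tail (- l)"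
    unfolding eq using airy_sq_integral(2)[of l] by simp
  then show ?thesis unfolding L2_norm_halfline_def using airy_tail_pos[of "- l"] by simp
qed

section \<open>Asymptotic expansions\<close>

lemma lam_eq_robin_root: "lam (Suc k) b = robin_root b k"
proof -
  have "stark_eigenvalue b (of_real l) \<longleftrightarrow> (\<exists>k. l = robin_root b k)" for l
    unfolding stark_eigenvalue_iff robin_equation_iff ..
  from nth_smallest_iff[OF robin_root_strict_mono[of b] this]
  show ?thesis unfolding lam_def by simp
qed

lemma Ai_robin_root: "Ai' (- robin_root b k) = b * Ai (- robin_root b k)"
  using robin_equation_iff by blast

text \<open>
  At an eigenvalue \<open>l\<close> one has \<open>Ai'(-l) = b Ai(-l)\<close>, so the squared norm is \<open>\<pi> (Ai'(-l)\<^sup>2 + l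
  Ai(-l)\<^sup>2) = \<pi> (l + b\<^sup>2) Ai(-l)\<^sup>2\<close>.
\<close>

lemma kappa_eq: "kappa (Suc k) b = - ln (robin_root b k + b\<^sup>2)"
proof -
  define l where "l = robin_root b k"
  have A': "Ai' (- l) = b * Ai (- l)" unfolding l_def by (rule Ai_robin_root)
  then have A: "Ai (- l) \<noteq> 0" using Ai_Ai'_nonzero[of "- l"] by auto
  have tail: "airy_tail (- l) = (l + b\<^sup>2) * (Ai (- l))\<^sup>2"
    unfolding airy_tail_def A' by (simp add: power_mult_distrib algebra_simps)
  have num: "(cmod (psi0 (of_real l) 0))\<^sup>2 = pi * (Ai (- l))\<^sup>2"
    by (simp add: psi0_of_real airy_fun_def norm_mult power_mult_distrib)
  have "kappa (Suc k) b = ln (pi * (Ai (- l))\<^sup>2 / (pi * ((l + b\<^sup>2) * (Ai (- l))\<^sup>2)))"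
    unfolding kappa_def lam_eq_robin_root l_def[symmetric] psi0_norm num tail ..
  also have "pi * (Ai (- l))\<^sup>2 / (pi * ((l + b\<^sup>2) * (Ai (- l))\<^sup>2)) = inverse (l + b\<^sup>2)"
  proof -
    have "p * a / (p * (s * a)) = inverse s" if "p \<noteq> 0" "a \<noteq> 0" for p a s :: real
      using that by (simp add: inverse_eq_divide)
    then show ?thesis using A by simp
  qed
  also have "ln \<dots> = - ln (l + b\<^sup>2)"
    by (rule ln_inverse)
  finally show ?thesis by (simp add: l_def)
qed

text \<open>
  Between the two roots the angle stays within \<open>|arctan b|\<close> of \<open>k \<pi>\<close>, so that
  \<open>m(x) = Ai'(-x) / Ai(-x)\<close>, the tangent of the angle, has no pole there and satisfies
  \<open>|m| \<le> |b|\<close>. The mean value theorem is applied to \<open>m\<close>, with \<open>m' = x + m\<^sup>2\<close> and \<open>\<mu> = m(\<xi>)\<^sup>2\<close>.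
\<close>

lemma robin_root_mean_value:
  "\<exists>\<xi> \<mu>. min (robin_root 0 k) (robin_root b k) \<le> \<xi> \<and> \<xi> \<le> max (robin_root 0 k) (robin_root b k) \<and>
     0 \<le> \<mu> \<and> \<mu> \<le> b\<^sup>2 \<and> b = (robin_root b k - robin_root 0 k) * (\<xi> + \<mu>)"
proof -
  define \<alpha> l where "\<alpha> = robin_root 0 k" and "l = robin_root b k"
  define m where "m x = Ai' (- x) / Ai (- x)" for x
  have \<theta>: "airy_angle 1 \<alpha> = real k * pi" "airy_angle 1 l = arctan b + real k * pi"
    unfolding \<alpha>_def l_def by (simp_all add: airy_angle_robin_root)
  have key: "Ai (- x) \<noteq> 0 \<and> (m x)\<^sup>2 \<le> b\<^sup>2" if x: "min \<alpha> l \<le> x" "x \<le> max \<alpha> l" for x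
  proof -
    define t where "t = airy_angle 1 x - real k * pi"
    have "airy_angle 1 (min \<alpha> l) \<le> airy_angle 1 x" "airy_angle 1 x \<le> airy_angle 1 (max \<alpha> l)"
      using x airy_angle_le_iff[of 1] by simp_all
    then have "\<bar>t\<bar> \<le> \<bar>arctan b\<bar>" using \<theta> unfolding t_def min_def max_def by (auto split: if_splits)
    also have "\<bar>arctan b\<bar> = arctan \<bar>b\<bar>" by (simp add: abs_if arctan_minus)
    finally have t: "\<bar>t\<bar> \<le> arctan \<bar>b\<bar>" .
    then have t2: "\<bar>t\<bar> < pi / 2" using arctan_ubound[of "\<bar>b\<bar>"] by linarith
    have ang: "airy_angle 1 x = t + real k * pi" by (simp add: t_def)
    have ct: "cos t > 0" using t2 by (intro cos_gt_zero_pi) auto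
    have "cos (t + real k * pi) = cos t * (-1) ^ k" by (simp add: cos_add)
    then have "cos (airy_angle 1 x) \<noteq> 0" unfolding ang using ct by simp
    then have A: "Ai (- x) \<noteq> 0" using Ai_polar[of 1 x] airy_radius_pos[of 1 x] by simp
    have "m x = tan (airy_angle 1 x)"
      unfolding m_def tan_def using Ai_polar[of 1 x] Ai'_polar[of 1 x] airy_radius_pos[of 1 x] by simp
    also have "\<dots> = tan t" unfolding ang by (rule tan_periodic_nat)
    finally have "\<bar>m x\<bar> = tan \<bar>t\<bar>" using tan_pos_pi2_le[of "\<bar>t\<bar>"] t2
      by (auto simp: abs_if split: if_splits)
    also have "\<dots> \<le> tan (arctan \<bar>b\<bar>)" using t t2 arctan_ubound by (intro tan_mono_le) auto
    also have "\<dots> = \<bar>b\<bar>" by (rule tan_arctan)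
    finally have "(m x)\<^sup>2 \<le> b\<^sup>2" by (simp add: abs_le_square_iff)
    with A show ?thesis by blast
  qed
  have dm: "(m has_real_derivative x + (m x)\<^sup>2) (at x)" if "min \<alpha> l \<le> x" "x \<le> max \<alpha> l" for x
  proof -
    have A: "Ai (- x) \<noteq> 0" using key[OF that] by blast
    have "(m has_real_derivative (x * Ai (- x) * Ai (- x) - Ai' (- x) * (- Ai' (- x))) / (Ai (- x) * Ai (- x))) (at x)"
      unfolding m_def[abs_def] by (rule DERIV_divide[OF Ai'_neg_deriv Ai_neg_deriv A])
    moreover have "(x * Ai (- x) * Ai (- x) - Ai' (- x) * (- Ai' (- x))) / (Ai (- x) * Ai (- x)) =
      x + (m x)\<^sup>2"
      using A by (simp add: m_def field_simps power2_eq_square)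
    ultimately show ?thesis by simp
  qed
  have m\<alpha>: "m \<alpha> = 0" unfolding m_def \<alpha>_def Ai_robin_root by simp
  have ml: "m l = b" unfolding m_def using Ai_robin_root[of b k] key[of l] by (simp add: l_def)
  have "\<exists>\<xi>. min \<alpha> l \<le> \<xi> \<and> \<xi> \<le> max \<alpha> l \<and> b = (l - \<alpha>) * (\<xi> + (m \<xi>)\<^sup>2)"
  proof -
    consider "\<alpha> < l" | "l < \<alpha>" | "l = \<alpha>" by linarith
    then show ?thesis
    proof cases
      case 1
      then obtain z where "\<alpha> < z" "z < l" "m l - m \<alpha> = (l - \<alpha>) * (z + (m z)\<^sup>2)"
        using MVT2[of \<alpha> l m "\<lambda>z. z + (m z)\<^sup>2"] dm by auto
      then show ?thesis using m\<alpha> ml by (intro exI[of _ z]) auto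
    next
      case 2
      then obtain z where "l < z" "z < \<alpha>" "m \<alpha> - m l = (\<alpha> - l) * (z + (m z)\<^sup>2)"
        using MVT2[of l \<alpha> m "\<lambda>z. z + (m z)\<^sup>2"] dm by auto
      then show ?thesis using m\<alpha> ml by (intro exI[of _ z]) (auto simp: algebra_simps)
    next
      case 3
      then show ?thesis using m\<alpha> ml by (intro exI[of _ \<alpha>]) auto
    qed
  qed
  then obtain \<xi> where \<xi>: "min \<alpha> l \<le> \<xi>" "\<xi> \<le> max \<alpha> l" "b = (l - \<alpha>) * (\<xi> + (m \<xi>)\<^sup>2)" by blast
  show ?thesis
    using \<xi> key[OF \<xi>(1,2)] unfolding \<alpha>_def[symmetric] l_def[symmetric]
    by (intro exI[of _ \<xi>] exI[of _ "(m \<xi>)\<^sup>2"]) simp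
qed

text \<open>
  With \<open>\<mu>\<close> bounded and \<open>\<xi>\<close> near \<open>\<alpha>\<close>, solving \<open>b = (l - \<alpha>) (\<xi> + \<mu>)\<close> for \<open>l\<close> gives \<open>l \<approx> \<alpha> + b / \<alpha>\<close>.
  The preceding root \<open>robin_root 0 k\<close> is a lower bound for \<open>\<xi>\<close> that does not depend on \<open>b\<close>.
\<close>

lemma robin_root_expansion:
  assumes b: "\<bar>b\<bar> \<le> M" and big: "1 + 2 * M + 2 * M\<^sup>2 \<le> robin_root 0 k"
  defines "\<alpha> \<equiv> robin_root 0 (Suc k)" and "l \<equiv> robin_root b (Suc k)"
  shows "\<bar>l - \<alpha>\<bar> \<le> M" "\<bar>l - \<alpha>\<bar> \<le> 2 * M / \<alpha>"
    "\<bar>l - (\<alpha> + b / \<alpha>)\<bar> \<le> 2 * M * (M + M\<^sup>2) / \<alpha>\<^sup>2"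
proof -
  have M: "0 \<le> M" using b by linarith
  have b2: "b\<^sup>2 \<le> M\<^sup>2" using b by (simp add: abs_le_square_iff[symmetric])
  obtain \<xi> \<mu> where \<xi>: "min \<alpha> l \<le> \<xi>" "\<xi> \<le> max \<alpha> l" "0 \<le> \<mu>" "\<mu> \<le> b\<^sup>2" "b = (l - \<alpha>) * (\<xi> + \<mu>)"
    using robin_root_mean_value[of "Suc k" b] unfolding \<alpha>_def l_def by blast
  have "robin_root 0 k < \<alpha>" unfolding \<alpha>_def using robin_root_strict_mono by (simp add: strict_mono_def)
  moreover have "robin_root 0 k < l"
  proof -
    have "airy_angle 1 (robin_root 0 k) = real k * pi" "airy_angle 1 l = arctan b + (real k * pi + pi)"
      by (simp_all add: l_def airy_angle_robin_root distrib_right)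
    then have "airy_angle 1 (robin_root 0 k) < airy_angle 1 l"
      using arctan_lbound[of b] pi_gt_zero by linarith
    then show ?thesis using airy_angle_less_iff[of 1] by simp
  qed
  ultimately have lower: "1 + 2 * M + 2 * M\<^sup>2 \<le> \<xi>" and \<alpha>_big: "1 + 2 * M + 2 * M\<^sup>2 \<le> \<alpha>"
    using big \<xi>(1) by linarith+
  have M2: "0 \<le> M\<^sup>2" by simp
  have \<xi>1: "1 \<le> \<xi> + \<mu>" using lower \<xi>(3) M M2 by linarith
  have abs_b: "\<bar>b\<bar> = \<bar>l - \<alpha>\<bar> * (\<xi> + \<mu>)" using \<xi>1 by (subst \<xi>(5)) (simp add: abs_mult)
  have "\<bar>l - \<alpha>\<bar> * 1 \<le> \<bar>b\<bar>" unfolding abs_b using \<xi>1 by (intro mult_left_mono) auto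
  then show d: "\<bar>l - \<alpha>\<bar> \<le> M" using b by simp
  have \<alpha>_pos: "0 < \<alpha>" using \<alpha>_big M M2 by linarith
  have "\<alpha> - M \<le> \<xi>" using \<xi>(1) d by linarith
  then have half: "\<alpha> / 2 \<le> \<xi> + \<mu>" using \<alpha>_big \<xi>(3) M2 by linarith
  have "\<bar>l - \<alpha>\<bar> * (\<alpha> / 2) \<le> \<bar>b\<bar>" unfolding abs_b using half by (intro mult_left_mono) auto
  then have d2: "\<bar>l - \<alpha>\<bar> * \<alpha> \<le> 2 * M" using b by simp
  then show "\<bar>l - \<alpha>\<bar> \<le> 2 * M / \<alpha>" using \<alpha>_pos by (simp add: field_simps)
  have "(l - (\<alpha> + b / \<alpha>)) * \<alpha> = (l - \<alpha>) * \<alpha> - b" using \<alpha>_pos by (simp add: field_simps)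
  also have "\<dots> = (l - \<alpha>) * (\<alpha> - \<xi> - \<mu>)" by (subst \<xi>(5)) (simp add: algebra_simps)
  finally have "\<bar>l - (\<alpha> + b / \<alpha>)\<bar> * \<alpha> = \<bar>l - \<alpha>\<bar> * \<bar>\<alpha> - \<xi> - \<mu>\<bar>"
    using \<alpha>_pos by (metis abs_mult abs_of_pos)
  also have "\<dots> \<le> \<bar>l - \<alpha>\<bar> * (M + M\<^sup>2)"
    using \<xi> d b2 by (intro mult_left_mono) auto
  finally have "\<bar>l - (\<alpha> + b / \<alpha>)\<bar> * \<alpha> * \<alpha> \<le> \<bar>l - \<alpha>\<bar> * (M + M\<^sup>2) * \<alpha>"
    using \<alpha>_pos by (intro mult_right_mono) auto
  also have "\<dots> = (\<bar>l - \<alpha>\<bar> * \<alpha>) * (M + M\<^sup>2)" by simp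
  also have "\<dots> \<le> 2 * M * (M + M\<^sup>2)" using d2 M by (intro mult_right_mono) auto
  finally show "\<bar>l - (\<alpha> + b / \<alpha>)\<bar> \<le> 2 * M * (M + M\<^sup>2) / \<alpha>\<^sup>2"
    using \<alpha>_pos by (simp add: field_simps power2_eq_square)
qed

text \<open>
  With \<open>l + b\<^sup>2 = \<alpha> (1 + t)\<close> the claim is the first order expansion of \<open>ln (1 + t)\<close>, because \<open>t -
  b\<^sup>2 / \<alpha> = (l - \<alpha>) / \<alpha>\<close> is already of order \<open>\<alpha>\<^sup>-\<^sup>2\<close>.
\<close>

lemma log_norming_expansion:
  assumes b: "\<bar>b\<bar> \<le> M" and big: "1 + 2 * M + 2 * M\<^sup>2 \<le> robin_root 0 k"
  defines "\<alpha> \<equiv> robin_root 0 (Suc k)" and "l \<equiv> robin_root b (Suc k)"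
  shows "\<bar>ln (l + b\<^sup>2) - (ln \<alpha> + b\<^sup>2 / \<alpha>)\<bar> \<le> (2 * (M + M\<^sup>2)\<^sup>2 + 2 * M) / \<alpha>\<^sup>2"
proof -
  have M: "0 \<le> M" "0 \<le> M\<^sup>2" using b by auto
  have b2: "b\<^sup>2 \<le> M\<^sup>2" using b by (simp add: abs_le_square_iff[symmetric])
  have d: "\<bar>l - \<alpha>\<bar> \<le> M" "\<bar>l - \<alpha>\<bar> \<le> 2 * M / \<alpha>"
    using robin_root_expansion(1,2)[OF b big] by (simp_all add: \<alpha>_def l_def)
  have "robin_root 0 k < \<alpha>" unfolding \<alpha>_def using robin_root_strict_mono by (simp add: strict_mono_def)
  then have \<alpha>_pos: "0 < \<alpha>" using big M by linarith
  have \<alpha>_big: "2 * (M + M\<^sup>2) \<le> \<alpha>" unfolding distrib_left using \<open>robin_root 0 k < \<alpha>\<close> big M by linarith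
  define t where "t = (l - \<alpha> + b\<^sup>2) / \<alpha>"
  have abs_t: "\<bar>t\<bar> \<le> (M + M\<^sup>2) / \<alpha>"
  proof -
    have "\<bar>l - \<alpha> + b\<^sup>2\<bar> \<le> M + M\<^sup>2" using d(1) b2 zero_le_power2[of b] by linarith
    then show ?thesis unfolding t_def using \<alpha>_pos by (simp add: divide_right_mono)
  qed
  also have "\<dots> \<le> 1 / 2" using \<alpha>_big \<alpha>_pos by (simp add: field_simps)
  finally have t_half: "\<bar>t\<bar> \<le> 1 / 2" .
  have "l + b\<^sup>2 = \<alpha> * (1 + t)" using \<alpha>_pos by (simp add: t_def field_simps)
  then have "ln (l + b\<^sup>2) = ln \<alpha> + ln (1 + t)" using \<alpha>_pos t_half by (simp add: ln_mult)
  then have "ln (l + b\<^sup>2) - (ln \<alpha> + b\<^sup>2 / \<alpha>) = (ln (1 + t) - t) + (l - \<alpha>) / \<alpha>"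
    by (simp add: t_def add_divide_distrib)
  then have "\<bar>ln (l + b\<^sup>2) - (ln \<alpha> + b\<^sup>2 / \<alpha>)\<bar> \<le> \<bar>ln (1 + t) - t\<bar> + \<bar>l - \<alpha>\<bar> / \<alpha>"
    using abs_triangle_ineq[of "ln (1 + t) - t" "(l - \<alpha>) / \<alpha>"] \<alpha>_pos by simp
  also have "\<dots> \<le> 2 * t\<^sup>2 + (2 * M / \<alpha>) / \<alpha>"
    using abs_ln_one_plus_x_minus_x_bound[OF t_half] d(2) \<alpha>_pos
    by (intro add_mono divide_right_mono) auto
  also have "t\<^sup>2 \<le> ((M + M\<^sup>2) / \<alpha>)\<^sup>2" using abs_t M \<alpha>_pos by (subst abs_le_square_iff[symmetric]) simp
  also have "2 * (K / \<alpha>)\<^sup>2 + 2 * M / \<alpha> / \<alpha> = (2 * K\<^sup>2 + 2 * M) / \<alpha>\<^sup>2" for K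
    by (simp add: power_divide add_divide_distrib power2_eq_square)
  finally show ?thesis by simp
qed

lemma robin_root_decay:
  assumes "1 \<le> k"
  shows "1 / (robin_root 0 k)\<^sup>2 \<le> 2 powr (4/3) * real (Suc k) powr (-4/3)"
proof -
  have "real (Suc k) / 2 \<le> real k" using assms by simp
  then have "real k powr (-4/3) \<le> (real (Suc k) / 2) powr (-4/3)" by (intro powr_mono2') auto
  also have "\<dots> = real (Suc k) powr (-4/3) / 2 powr (-4/3)" by (rule powr_divide)
  also have "\<dots> = 2 powr (4/3) * real (Suc k) powr (-4/3)"
  proof -
    have "2 powr (4/3) * 2 powr (-4/3) = (1::real)" by (simp flip: powr_add)
    then show ?thesis by (simp add: field_simps)
  qed
  finally have 1: "real k powr (-4/3) \<le> 2 powr (4/3) * real (Suc k) powr (-4/3)" .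
  have k: "0 < real k powr (2/3)" using assms by simp
  have "(real k powr (2/3))\<^sup>2 = real k powr (4/3)"
    using assms by (simp add: power2_eq_square flip: powr_add)
  moreover have "(real k powr (2/3))\<^sup>2 \<le> (robin_root 0 k)\<^sup>2"
    by (intro power_mono robin_root_0_lower) simp
  ultimately have "real k powr (4/3) \<le> (robin_root 0 k)\<^sup>2" by simp
  then have "1 / (robin_root 0 k)\<^sup>2 \<le> 1 / real k powr (4/3)"
    using k assms robin_root_0_pos[of k] by (intro divide_left_mono) auto
  also have "\<dots> = real k powr (-4/3)" by (simp add: powr_minus_divide)
  finally show ?thesis using 1 by simp
qed

theorem proposition2p2:
  fixes B :: "real set"
  assumes "bounded B"
  shows "(\<exists>C. \<forall>\<^sub>F n in sequentially. \<forall>b\<in>B.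
            \<bar>lam n b - (- airy_deriv_zero n - b / airy_deriv_zero n)\<bar>
              \<le> C * real n powr (-4/3)) \<and>
         (\<exists>C. \<forall>\<^sub>F n in sequentially. \<forall>b\<in>B.
            \<bar>kappa n b - (- ln (- airy_deriv_zero n) + b\<^sup>2 / airy_deriv_zero n)\<bar>
              \<le> C * real n powr (-4/3))"
proof -
  obtain M where M: "\<And>b. b \<in> B \<Longrightarrow> \<bar>b\<bar> \<le> M" "0 < M"
    using assms unfolding bounded_pos by auto
  define C1 where "C1 = 2 * M * (M + M\<^sup>2)"
  define C2 where "C2 = 2 * (M + M\<^sup>2)\<^sup>2 + 2 * M"
  have C: "0 \<le> C1" "0 \<le> C2" using M(2) by (simp_all add: C1_def C2_def)
  define A where "A = 1 + 2 * M + 2 * M\<^sup>2"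
  have A: "0 < A" using M(2) by (simp add: A_def add_pos_nonneg)
  \<comment> \<open>then \<open>N\<^sup>2\<^sup>/\<^sup>3 \<ge> A\<close>, so the lower bound for the zeros takes over\<close>
  obtain N :: nat where N: "A powr (3/2) \<le> real N" using real_arch_simple by blast
  have big: "A \<le> robin_root 0 k" if "N \<le> k" for k
  proof -
    have "A = (A powr (3/2)) powr (2/3)" using A by (simp add: powr_powr)
    also have "\<dots> \<le> real k powr (2/3)" using N that by (intro powr_mono2) auto
    also have "\<dots> \<le> robin_root 0 k" by (rule robin_root_0_lower)
    finally show ?thesis .
  qed
  have scale: "x \<le> C * 2 powr (4/3) * real (Suc (Suc k)) powr (-4/3)"
    if "x \<le> C / (robin_root 0 (Suc k))\<^sup>2" "0 \<le> C" for x C k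
  proof -
    have "x \<le> C * (1 / (robin_root 0 (Suc k))\<^sup>2)" using that(1) by simp
    also have "\<dots> \<le> C * (2 powr (4/3) * real (Suc (Suc k)) powr (-4/3))"
      using that(2) by (intro mult_left_mono robin_root_decay) auto
    finally show ?thesis by (simp only: mult.assoc)
  qed
  have bounds: "\<bar>lam n b - (- airy_deriv_zero n - b / airy_deriv_zero n)\<bar> \<le>
    C1 * 2 powr (4/3) * real n powr (-4/3) \<and>
     \<bar>kappa n b - (- ln (- airy_deriv_zero n) + b\<^sup>2 / airy_deriv_zero n)\<bar> \<le>
       C2 * 2 powr (4/3) * real n powr (-4/3)"
    if n: "N + 2 \<le> n" and b: "b \<in> B" for n b
  proof -
    define k where "k = n - 2"
    have k: "n = Suc (Suc k)" "N \<le> k" using n by (simp_all add: k_def)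
    have bg: "1 + 2 * M + 2 * M\<^sup>2 \<le> robin_root 0 k" using big[OF k(2)] by (simp add: A_def)
    have "\<bar>lam n b - (- airy_deriv_zero n - b / airy_deriv_zero n)\<bar> =
        \<bar>robin_root b (Suc k) - (robin_root 0 (Suc k) + b / robin_root 0 (Suc k))\<bar>"
      unfolding k(1) lam_eq_robin_root airy_deriv_zero_eq by simp
    also have "\<dots> \<le> C1 / (robin_root 0 (Suc k))\<^sup>2"
      unfolding C1_def by (rule robin_root_expansion(3)[OF M(1)[OF b] bg])
    finally have 1: "\<bar>lam n b - (- airy_deriv_zero n - b / airy_deriv_zero n)\<bar> \<le>
      C1 / (robin_root 0 (Suc k))\<^sup>2" .
    have "\<bar>kappa n b - (- ln (- airy_deriv_zero n) + b\<^sup>2 / airy_deriv_zero n)\<bar> =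
        \<bar>ln (robin_root b (Suc k) + b\<^sup>2) - (ln (robin_root 0 (Suc k)) + b\<^sup>2 / robin_root 0 (Suc k))\<bar>"
      unfolding k(1) kappa_eq airy_deriv_zero_eq by simp
    also have "\<dots> \<le> C2 / (robin_root 0 (Suc k))\<^sup>2"
      unfolding C2_def by (rule log_norming_expansion[OF M(1)[OF b] bg])
    finally have 2: "\<bar>kappa n b - (- ln (- airy_deriv_zero n) + b\<^sup>2 / airy_deriv_zero n)\<bar> \<le>
      C2 / (robin_root 0 (Suc k))\<^sup>2" .
    show ?thesis using scale[OF 1 C(1)] scale[OF 2 C(2)] unfolding k(1) by blast
  qed
  have large: "\<forall>\<^sub>F n in sequentially. N + 2 \<le> n" by (rule eventually_ge_at_top)
  show ?thesis
  proof (intro conjI exI)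
    show "\<forall>\<^sub>F n in sequentially. \<forall>b\<in>B. \<bar>lam n b - (- airy_deriv_zero n - b / airy_deriv_zero n)\<bar>
        \<le> C1 * 2 powr (4/3) * real n powr (-4/3)"
      using large by (rule eventually_mono) (use bounds in blast)
    show "\<forall>\<^sub>F n in sequentially. \<forall>b\<in>B. \<bar>kappa n b - (- ln (- airy_deriv_zero n) + b\<^sup>2 / airy_deriv_zero n)\<bar>
        \<le> C2 * 2 powr (4/3) * real n powr (-4/3)"
      using large by (rule eventually_mono) (use bounds in blast)
  qed
qed

end
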